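(* Let $L$ be a connected (oriented) link diagram and let $\mathbb F$ be a field. Then for every integer $i$, $$\dim_{\mathbb F}\operatorname{Kh}^{i,*}(L;\mathbb F)\le 2\binom{n(L)}{i+n_-(L)}.$$
   Context: $\operatorname{Kh}^{i,j}(L;\mathbb F)$ denotes Khovanov homology with coefficients in $\mathbb F$, with homological degree $i$ and quantum degree $j$, normalized so that the Khovanov complex of a diagram is supported in homological degrees $[-n_-(L),n_+(L)]$; $\operatorname{Kh}^{i,*}(L;\mathbb F)=\bigoplus_j \operatorname{Kh}^{i,j}(L;\mathbb F)$. Here $n_+(L)$, $n_-(L)$ are the numbers of positive and negative crossings of the diagram $L$, and $n(L)=n_+(L)+n_-(L)$. A link diagram is connected if it is connected as a subset of the plane (underlying $4$-valent graph). A binomial coefficient $\binom{n}{m}$ is $0$ if $m<0$ or $m>n$. *)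

theory Defs
  imports "Jordan_Normal_Form.VS_Connect" "HOL-Algebra.AbelCoset"
begin

section \<open>Oriented link diagrams\<close>

text \<open>Link diagrams are given by oriented planar diagram codes. In \<open>Crossing s a b c d\<close> the
  entries are the arcs (edges of the underlying 4-valent graph) met when going counterclockwise
  around the crossing, starting with the arc on which the under-strand enters. So the under-strand
  runs from \<open>a\<close> to \<open>c\<close>; the over-strand runs from \<open>d\<close> to \<open>b\<close> if the crossing is positive
  (\<open>s = True\<close>), and from \<open>b\<close> to \<open>d\<close> if it is negative.\<close>

datatype 'a crossing = Crossing (is_positive: bool) 'a 'a 'a 'a

primrec legs :: "'a crossing \<Rightarrow> 'a list" where
  "legs (Crossing s a b c d) = [a, b, c, d]"

text \<open>An element of \<open>arcs\<close> that is met by no crossing is a crossingless circle component.\<close>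

record 'a link_diagram =
  arcs :: "'a set"
  crossings :: "'a crossing list"

definition n_crossings :: "'a link_diagram \<Rightarrow> nat" where
  "n_crossings D = length (crossings D)"

definition n_plus :: "'a link_diagram \<Rightarrow> nat" where
  "n_plus D = card {k. k < n_crossings D \<and> is_positive (crossings D ! k)}"

definition n_minus :: "'a link_diagram \<Rightarrow> nat" where
  "n_minus D = card {k. k < n_crossings D \<and> \<not> is_positive (crossings D ! k)}"

text \<open>A dart is a pair of a crossing and one of its four legs, i.e. an end of an arc.\<close>

definition darts :: "'a link_diagram \<Rightarrow> (nat \<times> nat) set" where
  "darts D = {..<n_crossings D} \<times> {..<4}"

definition dart_arc :: "'a link_diagram \<Rightarrow> nat \<times> nat \<Rightarrow> 'a" where
  "dart_arc D x = legs (crossings D ! fst x) ! snd x"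

definition incoming_darts :: "'a link_diagram \<Rightarrow> (nat \<times> nat) set" where
  "incoming_darts D =
     {(k, p) \<in> darts D. p = 0 \<or> p = (if is_positive (crossings D ! k) then 3 else 1)}"

definition connected_components :: "'b set \<Rightarrow> ('b \<times> 'b) set \<Rightarrow> 'b set set" where
  "connected_components S R = S // {(x, y) \<in> S \<times> S. (x, y) \<in> (R \<union> R\<inverse>)\<^sup>*}"

text \<open>Two darts are in the same component of the underlying 4-valent graph if one can pass from one
  to the other through crossings and along arcs.\<close>

definition graph_components :: "'a link_diagram \<Rightarrow> (nat \<times> nat) set set" where
  "graph_components D = connected_components (darts D)
     {(x, y) \<in> darts D \<times> darts D. fst x = fst y \<or> dart_arc D x = dart_arc D y}"

text \<open>The faces are the orbits of the permutation of the darts that moves along the arc to its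
  other end and then turns to the counterclockwise next leg there. They are counted separately for
  each component of the graph.\<close>

definition diagram_faces :: "'a link_diagram \<Rightarrow> (nat \<times> nat) set set" where
  "diagram_faces D = connected_components (darts D)
     {(x, (k, (p + 1) mod 4)) |x k p.
        x \<in> darts D \<and> (k, p) \<in> darts D \<and> x \<noteq> (k, p) \<and> dart_arc D x = dart_arc D (k, p)}"

text \<open>The last condition is Euler's formula \<open>V - E + F = 2\<close>, summed over the components of the
  graph. As every component satisfies \<open>V - E + F \<le> 2\<close>, it says that each of them, with its given
  rotation system, embeds in the plane. It rules out virtual diagrams.\<close>

definition is_link_diagram :: "'a link_diagram \<Rightarrow> bool" where
  "is_link_diagram D \<longleftrightarrow>
     finite (arcs D) \<and>
     dart_arc D ` darts D \<subseteq> arcs D \<and>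
     (\<forall>e \<in> dart_arc D ` darts D.
        (\<exists>!x. x \<in> incoming_darts D \<and> dart_arc D x = e) \<and>
        (\<exists>!x. x \<in> darts D - incoming_darts D \<and> dart_arc D x = e)) \<and>
     int (n_crossings D) - int (card (dart_arc D ` darts D)) + int (card (diagram_faces D))
       = 2 * int (card (graph_components D))"

text \<open>Connectedness as a subset of the plane; the crossingless circles count. The empty diagram is
  connected, as the empty set is in the library.\<close>

definition connected_diagram :: "'a link_diagram \<Rightarrow> bool" where
  "connected_diagram D \<longleftrightarrow>
     (\<forall>e \<in> arcs D. \<forall>f \<in> arcs D.
        (e, f) \<in> {(dart_arc D x, dart_arc D y) |x y.
                    x \<in> darts D \<and> y \<in> darts D \<and> fst x = fst y}\<^sup>*)"


section \<open>The Khovanov complex\<close>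

text \<open>\<open>smoothing r X\<close> lists the pairs of legs joined by the 0-smoothing (\<open>r = False\<close>) or the
  1-smoothing (\<open>r = True\<close>) of \<open>X\<close>. The 0-smoothing joins the two regions swept when the over-strand
  is turned counterclockwise; it is the oriented smoothing of a positive crossing.\<close>

primrec smoothing :: "bool \<Rightarrow> 'a crossing \<Rightarrow> ('a \<times> 'a) set" where
  "smoothing r (Crossing s a b c d) = (if r then {(a, d), (b, c)} else {(a, b), (c, d)})"

text \<open>A vertex of the cube of resolutions is given by the set \<open>v\<close> of the crossings that are
  1-smoothed. A circle of a resolution is represented by the set of its arcs.\<close>

definition circles :: "'a link_diagram \<Rightarrow> nat set \<Rightarrow> 'a set set" where
  "circles D v = connected_components (arcs D)
     (\<Union>k<n_crossings D. smoothing (k \<in> v) (crossings D ! k))"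

text \<open>The standard basis of the tensor power \<open>V \<otimes> \<dots> \<otimes> V\<close> attached to \<open>v\<close>, with one factor for
  each circle, consists of the labellings of the circles by \<open>v\<^sub>+\<close> and \<open>v\<^sub>-\<close>. Such a labelling is
  represented by the set \<open>P\<close> of the circles with label \<open>v\<^sub>+\<close>.\<close>

type_synonym 'a kh_state = "nat set \<times> 'a set set"

definition kh_states :: "'a link_diagram \<Rightarrow> 'a kh_state set" where
  "kh_states D = {(v, P). v \<subseteq> {..<n_crossings D} \<and> P \<subseteq> circles D v}"

definition hom_degree :: "'a link_diagram \<Rightarrow> 'a kh_state \<Rightarrow> int" where
  "hom_degree D = (\<lambda>(v, P). int (card v) - int (n_minus D))"

definition q_degree :: "'a link_diagram \<Rightarrow> 'a kh_state \<Rightarrow> int" where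
  "q_degree D = (\<lambda>(v, P). int (card P) - int (card (circles D v - P)) + int (card v)
     + int (n_plus D) - 2 * int (n_minus D))"

text \<open>Structure constants, which are all 0 or 1, of the multiplication
  \<open>v\<^sub>+ \<otimes> v\<^sub>+ \<mapsto> v\<^sub>+\<close>, \<open>v\<^sub>+ \<otimes> v\<^sub>- \<mapsto> v\<^sub>-\<close>, \<open>v\<^sub>- \<otimes> v\<^sub>+ \<mapsto> v\<^sub>-\<close>, \<open>v\<^sub>- \<otimes> v\<^sub>- \<mapsto> 0\<close> and the comultiplication
  \<open>v\<^sub>+ \<mapsto> v\<^sub>+ \<otimes> v\<^sub>- + v\<^sub>- \<otimes> v\<^sub>+\<close>, \<open>v\<^sub>- \<mapsto> v\<^sub>- \<otimes> v\<^sub>-\<close>; here \<open>True\<close> stands for \<open>v\<^sub>+\<close>.\<close>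

definition mult_term :: "bool \<Rightarrow> bool \<Rightarrow> bool \<Rightarrow> bool" where
  "mult_term x y z \<longleftrightarrow> (x \<and> y \<and> z) \<or> (x \<noteq> y \<and> \<not> z)"

definition comult_term :: "bool \<Rightarrow> bool \<Rightarrow> bool \<Rightarrow> bool" where
  "comult_term z x y \<longleftrightarrow> (z \<and> x \<noteq> y) \<or> (\<not> z \<and> \<not> x \<and> \<not> y)"

text \<open>Whether the labelling \<open>Q\<close> of the circles \<open>C'\<close> occurs in the image of the labelling \<open>P\<close> of the
  circles \<open>C\<close> under the map induced by an edge of the cube. The circles in \<open>C \<inter> C'\<close> do not meet the
  crossing whose smoothing changes and keep their labels.\<close>

definition edge_term ::
  "'a set set \<Rightarrow> 'a set set \<Rightarrow> 'a set set \<Rightarrow> 'a set set \<Rightarrow> bool" where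
  "edge_term C P C' Q \<longleftrightarrow>
     P \<inter> C' = Q \<inter> C \<and>
     (\<exists>A B. A \<noteq> B \<and>
        (C - C' = {A, B} \<and> C' - C = {A \<union> B} \<and> mult_term (A \<in> P) (B \<in> P) (A \<union> B \<in> Q) \<or>
         C - C' = {A \<union> B} \<and> C' - C = {A, B} \<and> comult_term (A \<union> B \<in> P) (A \<in> Q) (B \<in> Q)))"

definition kh_coeff :: "'a link_diagram \<Rightarrow> 'a kh_state \<Rightarrow> 'a kh_state \<Rightarrow> 'f::field" where
  "kh_coeff D = (\<lambda>(v, P) (w, Q).
     \<Sum>k \<in> {..<n_crossings D} - v.
       if w = insert k v \<and> Q \<subseteq> circles D w \<and> edge_term (circles D v) P (circles D w) Q
       then (- 1) ^ card {l \<in> v. l < k} else 0)"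

definition kh_differential ::
  "'a link_diagram \<Rightarrow> ('a kh_state \<Rightarrow> 'f::field) \<Rightarrow> ('a kh_state \<Rightarrow> 'f)" where
  "kh_differential D c = (\<lambda>t. \<Sum>s \<in> kh_states D. kh_coeff D s t * c s)"

definition kh_chains ::
  "'a link_diagram \<Rightarrow> int \<Rightarrow> int \<Rightarrow> ('f::field, 'a kh_state \<Rightarrow> 'f) module" where
  "kh_chains D i j =
     \<lparr> carrier = {c. \<forall>s. c s \<noteq> 0 \<longrightarrow> s \<in> kh_states D \<and> hom_degree D s = i \<and> q_degree D s = j},
       mult = undefined, one = undefined,
       zero = (\<lambda>s. 0), add = (\<lambda>c c' s. c s + c' s), smult = (\<lambda>a c s. a * c s) \<rparr>"

definition kh_cycles ::
  "'a link_diagram \<Rightarrow> int \<Rightarrow> int \<Rightarrow> ('a kh_state \<Rightarrow> 'f::field) set" where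
  "kh_cycles D i j =
     {c \<in> carrier (kh_chains D i j :: ('f, _) module). kh_differential D c = (\<lambda>s. 0)}"

definition kh_boundaries ::
  "'a link_diagram \<Rightarrow> int \<Rightarrow> int \<Rightarrow> ('a kh_state \<Rightarrow> 'f::field) set" where
  "kh_boundaries D i j =
     kh_differential D ` carrier (kh_chains D (i - 1) j :: ('f, _) module)"


section \<open>Khovanov homology\<close>

definition quotient_module :: "('f, 'v) module \<Rightarrow> 'v set \<Rightarrow> ('f, 'v set) module" where
  "quotient_module M N =
     \<lparr> carrier = a_rcosets\<^bsub>M\<^esub> N, mult = undefined, one = undefined,
       zero = N, add = set_add M,
       smult = (\<lambda>a X. \<Union>x \<in> X. N +>\<^bsub>M\<^esub> (a \<odot>\<^bsub>M\<^esub> x)) \<rparr>"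

definition direct_sum_module :: "('i \<Rightarrow> ('f, 'v) module) \<Rightarrow> ('f, 'i \<Rightarrow> 'v) module" where
  "direct_sum_module M =
     \<lparr> carrier = {f. (\<forall>j. f j \<in> carrier (M j)) \<and> finite {j. f j \<noteq> \<zero>\<^bsub>M j\<^esub>}},
       mult = undefined, one = undefined,
       zero = (\<lambda>j. \<zero>\<^bsub>M j\<^esub>), add = (\<lambda>f g j. f j \<oplus>\<^bsub>M j\<^esub> g j),
       smult = (\<lambda>a f j. a \<odot>\<^bsub>M j\<^esub> f j) \<rparr>"

definition Kh :: "'a link_diagram \<Rightarrow> int \<Rightarrow> int \<Rightarrow> ('f::field, ('a kh_state \<Rightarrow> 'f) set) module" where
  "Kh D i j = quotient_module ((kh_chains D i j)\<lparr>carrier := kh_cycles D i j\<rparr>) (kh_boundaries D i j)"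

definition Kh_total ::
  "'a link_diagram \<Rightarrow> int \<Rightarrow> ('f::field, int \<Rightarrow> ('a kh_state \<Rightarrow> 'f) set) module" where
  "Kh_total D i = direct_sum_module (Kh D i)"

definition int_binomial :: "int \<Rightarrow> int \<Rightarrow> nat" where
  "int_binomial n m = (if 0 \<le> m \<and> m \<le> n then nat n choose nat m else 0)"

end

theory Submission
  imports Defs "HOL-Library.Function_Algebras"
begin

text \<open>The chain group at a vertex of the cube, a tensor product of copies of \<open>F[X]/(X\<^sup>2)\<close> over the
  circles, is identified with a space of functions \<open>f\<close> on sets of arcs: \<open>f S\<close> is the pairing of the
  chain with \<open>v\<^sub>-\<close> placed at the arcs in \<open>S\<close>. If \<open>X\<^sub>a\<close> denotes multiplication at the arc \<open>a\<close>, so that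
  \<open>X\<^sub>a f S\<close> is \<open>f (insert a S)\<close> if \<open>a \<notin> S\<close> and \<open>0\<close> otherwise, this space consists of the \<open>f\<close> with \<open>X\<^sub>a f = X\<^sub>b f\<close> whenever
  \<open>a\<close> and \<open>b\<close> lie on the same circle. Splitting a circle becomes an inclusion, and merging the circles
  through \<open>a\<close> and \<open>c\<close> becomes \<open>X\<^sub>a + X\<^sub>c\<close>.

  The bound is proved by induction on the number of crossings, for cubes with arbitrary nonzero
  scalars on the edges that make the squares anticommute. The complex is the cone of a map between the
  complexes of the two smoothings of a crossing. If both smoothings are connected, the exact sequence
  of the cone and Pascal's rule give the bound. If one of them is not, its circles are separated into
  those inside and outside a set \<open>B\<close> of arcs, and the cone is quasi-isomorphic to the complex of the
  other, connected, smoothing, up to a sign twist \<open>(-1)\<close> to the number of arcs in \<open>B\<close>.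

  That every edge of the cube merges or splits circles, instead of changing a single circle into a
  single circle, follows from planarity: the arcs can be oriented such that the orientations alternate
  around every crossing, so that each resolution is a permutation of the arcs and changing a smoothing
  composes it with a transposition.\<close>

text \<open>With functions in place of tensor products, the chain groups of all resolutions lie in
  one space with commuting operators of square zero. An edge then depends only on whether its source
  has the two strands at the crossing on one circle, and no tensor factors have to be reidentified
  when circles merge or split. If one smoothing of a crossing is disconnected, all edges at that
  crossing go the same way. A disconnected 0-smoothing makes them merges of an inner with an outer
  circle: the cone map is onto, with kernel given by X_p f = - X_q f. A disconnected 1-smoothing
  makes them splits: the cone map is an inclusion, with image given by X_p f = X_q f. The sign turns
  one condition into the other, so kernel or cokernel becomes the complex of the connected
  smoothing, contributing in degree m or m - 1, and one summand of Pascal's rule suffices. The twist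
  does not preserve the standard signs of the cube. This is why the induction admits arbitrary
  nonzero scalars.\<close>

definition contract :: "'a \<Rightarrow> ('a set \<Rightarrow> 'f::field) \<Rightarrow> 'a set \<Rightarrow> 'f" where
  "contract a f S = (if a \<in> S then 0 else f (insert a S))"

definition scale :: "'f::field \<Rightarrow> ('b \<Rightarrow> 'f) \<Rightarrow> 'b \<Rightarrow> 'f" where
  "scale c f = (\<lambda>S. c * f S)"

definition scale2 :: "'f::field \<Rightarrow> ('v \<Rightarrow> 'b \<Rightarrow> 'f) \<Rightarrow> 'v \<Rightarrow> 'b \<Rightarrow> 'f" where
  "scale2 c z = (\<lambda>v. scale c (z v))"

text \<open>Linearity is required on all functions rather than on chains, so that functionals and
  primitives assembled from parts, flips and lifts are handled by composition rules without carrier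
  conditions.\<close>

definition linear_functional :: "(('v \<Rightarrow> 'b \<Rightarrow> 'f::field) \<Rightarrow> 'f) \<Rightarrow> bool" where
  "linear_functional \<phi> \<longleftrightarrow> (\<forall>y z. \<phi> (y + z) = \<phi> y + \<phi> z) \<and> (\<forall>c z. \<phi> (scale2 c z) = c * \<phi> z)"

definition linear_operator :: "(('v \<Rightarrow> 'b \<Rightarrow> 'f::field) \<Rightarrow> 'v \<Rightarrow> 'b \<Rightarrow> 'f) \<Rightarrow> bool" where
  "linear_operator h \<longleftrightarrow> (\<forall>y z. h (y + z) = h y + h z) \<and> (\<forall>c z. h (scale2 c z) = scale2 c (h z))"

lemma scale_apply [simp]: "scale c f S = c * f S"
  by (simp add: scale_def)

lemma scale_zero [simp]: "scale c 0 = 0"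
  by (simp add: fun_eq_iff)

lemma scale_scale: "scale a (scale b f) = scale (a * b) f"
  by (simp add: fun_eq_iff mult.assoc)

lemma scale_one: "scale 1 f = f"
  by (simp add: fun_eq_iff)

lemma scale2_apply [simp]: "scale2 c z v = scale c (z v)"
  by (simp add: scale2_def)

lemma linear_operator_comp:
  "linear_operator g \<Longrightarrow> linear_operator h \<Longrightarrow> linear_operator (\<lambda>z. g (h z))"
  by (simp add: linear_operator_def)

lemma linear_operator_add:
  "linear_operator g \<Longrightarrow> linear_operator h \<Longrightarrow> linear_operator (\<lambda>z. g z + h z)"
  by (simp add: linear_operator_def fun_eq_iff algebra_simps)

lemma linear_operator_diff:
  "linear_operator g \<Longrightarrow> linear_operator h \<Longrightarrow> linear_operator (\<lambda>z. g z - h z)"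
  by (simp add: linear_operator_def fun_eq_iff algebra_simps)

lemma linear_functional_comp:
  "linear_functional \<phi> \<Longrightarrow> linear_operator h \<Longrightarrow> linear_functional (\<lambda>z. \<phi> (h z))"
  by (simp add: linear_operator_def linear_functional_def)

lemma linear_operator_zero: "linear_operator h \<Longrightarrow> h 0 = 0"
proof -
  assume h: "linear_operator h"
  have "h (0 + 0) = h 0 + h 0" using h unfolding linear_operator_def by blast
  then show ?thesis by simp
qed

lemma linear_operator_minus: "linear_operator h \<Longrightarrow> h (y - z) = h y - h z"
proof -
  assume h: "linear_operator h"
  have "h ((y - z) + z) = h (y - z) + h z" using h unfolding linear_operator_def by blast
  then show ?thesis by (simp add: algebra_simps)
qed

lemma linear_operator_plus: "linear_operator h \<Longrightarrow> h (y + z) = h y + h z"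
  by (simp add: linear_operator_def)

lemma linear_operator_pointwise:
  assumes "\<And>v f g. h v (f + g) = h v f + h v g" "\<And>v c f. h v (scale c f) = scale c (h v f)"
  shows "linear_operator (\<lambda>z v. h v (z v))"
  using assms by (simp add: linear_operator_def fun_eq_iff)

lemma contract_notin: "a \<notin> W \<Longrightarrow> contract a f W = f (insert a W)"
  by (simp add: contract_def)

lemma contract_add: "contract a (f + g) = contract a f + contract a g"
  by (auto simp: contract_def fun_eq_iff)

lemma contract_diff: "contract a (f - g) = contract a f - contract a g"
  by (auto simp: contract_def fun_eq_iff)

lemma contract_scale: "contract a (scale c f) = scale c (contract a f)"
  by (auto simp: contract_def fun_eq_iff)

lemma contract_zero [simp]: "contract a 0 = 0"
  by (auto simp: contract_def fun_eq_iff)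

lemma contract_commute: "contract a (contract b f) = contract b (contract a f)"
  by (auto simp: contract_def fun_eq_iff insert_commute)

lemma contract_contract [simp]: "contract a (contract a f) = 0"
  by (auto simp: contract_def fun_eq_iff)

section \<open>Cubes of circles\<close>

text \<open>Swapping the two indices would only show that twice the sum vanishes, which says nothing
  in characteristic 2. The induction cancels the pairs one by one instead.\<close>

lemma sum_antisymmetric_pairs:
  fixes t :: "nat \<Rightarrow> nat \<Rightarrow> 'f::field"
  assumes "finite A" "\<And>k l. k \<in> A \<Longrightarrow> l \<in> A \<Longrightarrow> k \<noteq> l \<Longrightarrow> t k l + t l k = 0"
  shows "(\<Sum>l\<in>A. \<Sum>k\<in>A - {l}. t k l) = 0"
  using assms
proof (induction A rule: finite_induct)
  case (insert a A)
  have "(\<Sum>l\<in>insert a A. \<Sum>k\<in>insert a A - {l}. t k l)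
      = (\<Sum>k\<in>A. t k a) + (\<Sum>l\<in>A. \<Sum>k\<in>insert a (A - {l}). t k l)"
  proof -
    have "insert a A - {a} = A" "\<And>l. l \<in> A \<Longrightarrow> insert a A - {l} = insert a (A - {l})"
      using insert.hyps by auto
    then show ?thesis using insert.hyps by (simp cong: sum.cong)
  qed
  also have "(\<Sum>l\<in>A. \<Sum>k\<in>insert a (A - {l}). t k l) = (\<Sum>l\<in>A. t a l + (\<Sum>k\<in>A - {l}. t k l))"
    using insert.hyps by (intro sum.cong) auto
  also have "\<dots> = (\<Sum>l\<in>A. t a l) + (\<Sum>l\<in>A. \<Sum>k\<in>A - {l}. t k l)" by (rule sum.distrib)
  also have "(\<Sum>l\<in>A. \<Sum>k\<in>A - {l}. t k l) = 0" using insert by simp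
  also have "(\<Sum>k\<in>A. t k a) + ((\<Sum>l\<in>A. t a l) + 0) = (\<Sum>k\<in>A. t k a + t a k)"
    by (simp add: sum.distrib)
  also have "\<dots> = 0" using insert by (intro sum.neutral) auto
  finally show ?case .
qed simp

lemma int_binomial_Suc: "int_binomial (int n + 1) m = int_binomial (int n) m + int_binomial (int n) (m - 1)"
proof -
  consider "m < 0" | "m = 0" | "m > 0" by linarith
  then show ?thesis
  proof cases
    case 3
    then obtain j where j: "m = int (Suc j)" by (metis gr0_conv_Suc zero_less_imp_eq_int)
    then have "nat (int n + 1) = Suc n" "nat m = Suc j" "nat (m - 1) = j" by auto
    then show ?thesis using j by (auto simp: int_binomial_def binomial_eq_0)
  qed (auto simp: int_binomial_def)
qed

text \<open>\<open>p k\<close> and \<open>q k\<close> play the role of two opposite legs of the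
  crossing \<open>k\<close>. Opposite legs lie on different strands of either smoothing, so they
  mark the two strands whichever smoothing is chosen.\<close>

locale cube_of_circles =
  fixes E :: "'a set" and p q :: "nat \<Rightarrow> 'a"
  assumes finite_E: "finite E"
begin

definition U :: "'a rel \<Rightarrow> ('a set \<Rightarrow> 'f::field) set" where
  "U \<rho> = {f. (\<forall>S. f S \<noteq> 0 \<longrightarrow> S \<subseteq> E) \<and> (\<forall>(x, y) \<in> \<rho>. contract x f = contract y f)}"

definition joined :: "nat \<Rightarrow> 'a rel \<Rightarrow> 'a rel \<Rightarrow> bool" where
  "joined k \<rho> \<rho>' \<longleftrightarrow> (p k, q k) \<notin> \<rho> \<and> \<rho>' = \<rho> \<union> \<rho> `` {p k, q k} \<times> \<rho> `` {p k, q k}"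

definition merge_map :: "nat \<Rightarrow> ('a set \<Rightarrow> 'f::field) \<Rightarrow> 'a set \<Rightarrow> 'f" where
  "merge_map k f = contract (p k) f + contract (q k) f"

definition edge :: "'a rel \<Rightarrow> nat \<Rightarrow> ('a set \<Rightarrow> 'f::field) \<Rightarrow> 'a set \<Rightarrow> 'f" where
  "edge \<rho> k f = (if (p k, q k) \<in> \<rho> then f else merge_map k f)"

definition cube :: "nat set \<Rightarrow> (nat set \<Rightarrow> 'a rel) \<Rightarrow> bool" where
  "cube K r \<longleftrightarrow> finite K \<and> (\<forall>v\<subseteq>K. equiv E (r v)) \<and> (\<forall>k\<in>K. p k \<in> E \<and> q k \<in> E) \<and>
     (\<forall>k\<in>K. \<forall>v\<subseteq>K - {k}. joined k (r v) (r (insert k v)) \<or> joined k (r (insert k v)) (r v))"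

text \<open>The two smoothings of a crossing together link all its legs, so the union over all
  resolutions generates the connectivity of the diagram. On a face of the cube it is the
  connectivity after smoothing one crossing.\<close>

definition connected_cube :: "nat set \<Rightarrow> (nat set \<Rightarrow> 'a rel) \<Rightarrow> bool" where
  "connected_cube K r \<longleftrightarrow> E \<times> E \<subseteq> (\<Union>v\<in>Pow K. r v)\<^sup>*"

definition diff :: "nat set \<Rightarrow> (nat set \<Rightarrow> 'a rel) \<Rightarrow> (nat set \<Rightarrow> nat \<Rightarrow> 'f::field)
    \<Rightarrow> (nat set \<Rightarrow> 'a set \<Rightarrow> 'f) \<Rightarrow> nat set \<Rightarrow> 'a set \<Rightarrow> 'f" where
  "diff K r e z w S = (\<Sum>k\<in>w \<inter> K. e (w - {k}) k * edge (r (w - {k})) k (z (w - {k})) S)"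

definition chains :: "nat set \<Rightarrow> (nat set \<Rightarrow> 'a rel) \<Rightarrow> int \<Rightarrow> (nat set \<Rightarrow> 'a set \<Rightarrow> 'f::field) set" where
  "chains K r m = {z. \<forall>v. z v \<in> U (r v) \<and> (z v \<noteq> 0 \<longrightarrow> v \<subseteq> K \<and> int (card v) = m)}"

text \<open>Restricted to \<open>U (r v)\<close> because the two ways around a square can be
  different operators, such as \<open>merge_map k\<close> and \<open>merge_map l\<close>, that agree
  only there.\<close>

definition anticommuting :: "nat set \<Rightarrow> (nat set \<Rightarrow> 'a rel) \<Rightarrow> (nat set \<Rightarrow> nat \<Rightarrow> 'f::field) \<Rightarrow> bool" where
  "anticommuting K r e \<longleftrightarrow> (\<forall>v\<subseteq>K. \<forall>k\<in>K - v. \<forall>l\<in>K - v. k \<noteq> l \<longrightarrow> (\<forall>f\<in>U (r v).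
     scale (e v k * e (insert k v) l) (edge (r (insert k v)) l (edge (r v) k f)) +
     scale (e v l * e (insert l v) k) (edge (r (insert l v)) k (edge (r v) l f)) = 0))"

text \<open>The homology in degree \<open>m\<close> has dimension at most \<open>N\<close>: the functionals detect the classes, and
  the linear choice \<open>h\<close> of primitives lets the bound pass through cones without choosing bases.\<close>

definition homology_bound :: "nat set \<Rightarrow> (nat set \<Rightarrow> 'a rel) \<Rightarrow> (nat set \<Rightarrow> nat \<Rightarrow> 'f::field)
    \<Rightarrow> int \<Rightarrow> nat \<Rightarrow> bool" where
  "homology_bound K r e m N \<longleftrightarrow>
     (\<exists>\<phi> h. (\<forall>i::nat. linear_functional (\<phi> i)) \<and> linear_operator h \<and>
        (\<forall>z\<in>chains K r m. diff K r e z = 0 \<longrightarrow> (\<forall>i<N. \<phi> i z = 0) \<longrightarrow>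
           h z \<in> chains K r (m - 1) \<and> diff K r e (h z) = z))"

lemma U_add: "f \<in> U \<rho> \<Longrightarrow> g \<in> U \<rho> \<Longrightarrow> f + g \<in> U \<rho>"
  unfolding U_def by (force simp: contract_add split_beta)

lemma U_diff: "f \<in> U \<rho> \<Longrightarrow> g \<in> U \<rho> \<Longrightarrow> f - g \<in> U \<rho>"
  unfolding U_def by (force simp: contract_diff split_beta)

lemma U_scale: "f \<in> U \<rho> \<Longrightarrow> scale c f \<in> U \<rho>"
  unfolding U_def by (force simp: contract_scale split_beta)

lemma U_zero [simp]: "0 \<in> U \<rho>"
  unfolding U_def by simp

lemma U_sum: "(\<And>i. i \<in> I \<Longrightarrow> f i \<in> U \<rho>) \<Longrightarrow> (\<lambda>S. \<Sum>i\<in>I. f i S) \<in> U \<rho>"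
proof (induction I rule: infinite_finite_induct)
  case (insert i I)
  have "f i + (\<lambda>S. \<Sum>i\<in>I. f i S) \<in> U \<rho>" using insert by (intro U_add) auto
  then show ?case using insert.hyps by (simp add: plus_fun_def)
qed (auto simp: zero_fun_def[symmetric])

lemma U_support: "f \<in> U \<rho> \<Longrightarrow> f S \<noteq> 0 \<Longrightarrow> S \<subseteq> E"
  by (auto simp: U_def)

lemma U_contract_eq: "f \<in> U \<rho> \<Longrightarrow> (x, y) \<in> \<rho> \<Longrightarrow> contract x f = contract y f"
  by (auto simp: U_def)

lemma U_antimono: "\<rho> \<subseteq> \<rho>' \<Longrightarrow> U \<rho>' \<subseteq> U \<rho>"
  by (auto simp: U_def)

lemma U_contract: "f \<in> U \<rho> \<Longrightarrow> contract a f \<in> U \<rho>"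
  unfolding U_def
proof safe
  fix S x assume f: "\<forall>S. f S \<noteq> 0 \<longrightarrow> S \<subseteq> E" and "contract a f S \<noteq> 0" "x \<in> S"
  then have "f (insert a S) \<noteq> 0" by (auto simp: contract_def split: if_splits)
  then show "x \<in> E" using f \<open>x \<in> S\<close> by blast
next
  fix x y assume "\<forall>(x, y)\<in>\<rho>. contract x f = contract y f" "(x, y) \<in> \<rho>"
  then have "contract x f = contract y f" by blast
  then show "contract x (contract a f) = contract y (contract a f)"
    by (metis contract_commute)
qed

lemma joined_subset: "joined k \<rho> \<rho>' \<Longrightarrow> \<rho> \<subseteq> \<rho>'"
  by (auto simp: joined_def)

lemma joined_mem: "joined k \<rho> \<rho>' \<Longrightarrow> equiv E \<rho> \<Longrightarrow> p k \<in> E \<Longrightarrow> q k \<in> E \<Longrightarrow> (p k, q k) \<in> \<rho>'"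
  by (auto simp: joined_def equiv_def refl_on_def)

lemma U_joined:
  assumes "joined k \<rho> \<rho>'" "f \<in> U \<rho>" "contract (p k) f = contract (q k) f"
  shows "f \<in> U \<rho>'"
proof -
  have "contract x f = contract (p k) f" if "x \<in> \<rho> `` {p k, q k}" for x
    using that U_contract_eq[OF assms(2)] assms(3) by fastforce
  then have "contract x f = contract y f" if "(x, y) \<in> \<rho> `` {p k, q k} \<times> \<rho> `` {p k, q k}" for x y
    using that by auto
  then have "contract x f = contract y f" if "(x, y) \<in> \<rho>'" for x y
    using that assms(1) U_contract_eq[OF assms(2)] unfolding joined_def by blast
  then show ?thesis using U_support[OF assms(2)] by (auto simp: U_def)
qed

text \<open>Since the squares of X_p and X_q are zero, X_p (X_p + X_q) = X_p X_q = X_q (X_p +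
  X_q).\<close>

lemma merge_map_in_U:
  assumes "joined k \<rho> \<rho>'" "f \<in> U \<rho>"
  shows "merge_map k f \<in> U \<rho>'"
proof (rule U_joined[OF assms(1)])
  show "merge_map k f \<in> U \<rho>"
    unfolding merge_map_def using assms(2) by (intro U_add U_contract)
  show "contract (p k) (merge_map k f) = contract (q k) (merge_map k f)"
    by (simp add: merge_map_def contract_add contract_commute)
qed

lemma merge_map_add: "merge_map k (f + g) = merge_map k f + merge_map k g"
  by (simp add: merge_map_def contract_add algebra_simps)

lemma merge_map_scale: "merge_map k (scale c f) = scale c (merge_map k f)"
  by (simp add: merge_map_def contract_scale fun_eq_iff algebra_simps)

lemma merge_map_commute: "merge_map k (merge_map l f) = merge_map l (merge_map k f)"
  by (simp add: merge_map_def contract_add contract_commute add_ac)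

lemma edge_add: "edge \<rho> k (f + g) = edge \<rho> k f + edge \<rho> k g"
  by (simp add: edge_def merge_map_add)

lemma edge_scale: "edge \<rho> k (scale c f) = scale c (edge \<rho> k f)"
  by (simp add: edge_def merge_map_scale)

lemma edge_zero [simp]: "edge \<rho> k 0 = 0"
  by (simp add: edge_def merge_map_def)

lemma edge_sum: "edge \<rho> k (\<lambda>S. \<Sum>i\<in>I. f i S) = (\<lambda>S. \<Sum>i\<in>I. edge \<rho> k (f i) S)"
proof (induction I rule: infinite_finite_induct)
  case (insert i I)
  have "edge \<rho> k (f i + (\<lambda>S. \<Sum>i\<in>I. f i S)) = edge \<rho> k (f i) + (\<lambda>S. \<Sum>i\<in>I. edge \<rho> k (f i) S)"
    using insert by (simp add: edge_add)
  then show ?case using insert.hyps by (simp add: plus_fun_def)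
qed (auto simp: zero_fun_def[symmetric])

lemma cubeD:
  assumes "cube K r"
  shows "finite K" "v \<subseteq> K \<Longrightarrow> equiv E (r v)" "k \<in> K \<Longrightarrow> p k \<in> E" "k \<in> K \<Longrightarrow> q k \<in> E"
    "k \<in> K \<Longrightarrow> v \<subseteq> K \<Longrightarrow> k \<notin> v \<Longrightarrow>
      joined k (r v) (r (insert k v)) \<or> joined k (r (insert k v)) (r v)"
proof -
  note * = assms[unfolded cube_def]
  show "finite K" using * by (rule conjunct1)
  show "v \<subseteq> K \<Longrightarrow> equiv E (r v)" using * by iprover
  show "k \<in> K \<Longrightarrow> p k \<in> E" "k \<in> K \<Longrightarrow> q k \<in> E" using * by auto
  assume "k \<in> K" "v \<subseteq> K" "k \<notin> v"
  then have "v \<subseteq> K - {k}" by blast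
  with \<open>k \<in> K\<close> show "joined k (r v) (r (insert k v)) \<or> joined k (r (insert k v)) (r v)"
    using * by simp
qed

lemma edge_in_U:
  assumes "cube K r" "k \<in> K" "v \<subseteq> K" "k \<notin> v" "f \<in> U (r v)"
  shows "edge (r v) k f \<in> U (r (insert k v))"
proof -
  have eq: "equiv E (r v)" "equiv E (r (insert k v))" using assms by (auto intro!: cubeD(2))
  have pq: "p k \<in> E" "q k \<in> E" using assms by (auto intro!: cubeD(3,4))
  show ?thesis
    using cubeD(5)[OF assms(1-4)]
  proof
    assume j: "joined k (r v) (r (insert k v))"
    then have "(p k, q k) \<notin> r v" by (simp add: joined_def)
    then show ?thesis using merge_map_in_U[OF j assms(5)] by (simp add: edge_def)
  next
    assume j: "joined k (r (insert k v)) (r v)"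
    then have "(p k, q k) \<in> r v" using joined_mem eq pq by blast
    moreover have "f \<in> U (r (insert k v))"
      using U_antimono[OF joined_subset[OF j]] assms(5) by blast
    ultimately show ?thesis by (simp add: edge_def)
  qed
qed

lemma linear_diff: "linear_operator (diff K r e)"
  by (auto simp: linear_operator_def fun_eq_iff diff_def edge_add edge_scale sum.distrib
      sum_distrib_left algebra_simps)

lemma chains_zero [simp]: "0 \<in> chains K r m"
  by (simp add: chains_def)

lemma chainsI:
  "(\<And>v. z v \<in> U (r v)) \<Longrightarrow> (\<And>v. z v \<noteq> 0 \<Longrightarrow> v \<subseteq> K \<and> int (card v) = m) \<Longrightarrow> z \<in> chains K r m"
  by (simp add: chains_def)

lemma chainsD:
  assumes "z \<in> chains K r m"
  shows "z v \<in> U (r v)" "z v \<noteq> 0 \<Longrightarrow> v \<subseteq> K" "z v \<noteq> 0 \<Longrightarrow> int (card v) = m"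
  using assms by (simp_all add: chains_def)

lemma chains_add:
  assumes "y \<in> chains K r m" "z \<in> chains K r m"
  shows "y + z \<in> chains K r m"
proof (rule chainsI)
  fix v
  show "(y + z) v \<in> U (r v)" using assms by (simp add: U_add chainsD)
  assume "(y + z) v \<noteq> 0"
  then have "y v \<noteq> 0 \<or> z v \<noteq> 0" by auto
  then show "v \<subseteq> K \<and> int (card v) = m" using chainsD(2,3)[OF assms(1)] chainsD(2,3)[OF assms(2)] by blast
qed

lemma chains_diff:
  assumes "y \<in> chains K r m" "z \<in> chains K r m"
  shows "y - z \<in> chains K r m"
proof (rule chainsI)
  fix v
  show "(y - z) v \<in> U (r v)" using assms by (simp add: U_diff chainsD)
  assume "(y - z) v \<noteq> 0"
  then have "y v \<noteq> 0 \<or> z v \<noteq> 0" by auto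
  then show "v \<subseteq> K \<and> int (card v) = m" using chainsD(2,3)[OF assms(1)] chainsD(2,3)[OF assms(2)] by blast
qed

lemma diff_in_chains:
  assumes c: "cube K r" and z: "z \<in> chains K r m"
  shows "diff K r e z \<in> chains K r (m + 1)"
proof -
  have *: "v \<subseteq> K \<and> int (card v) = m + 1" if "diff K r e z v \<noteq> 0" for v
  proof -
    have "\<exists>S. diff K r e z v S \<noteq> 0" using that by (rule contrapos_np) (simp add: fun_eq_iff)
    then obtain S where "diff K r e z v S \<noteq> 0" by blast
    then obtain k where k: "k \<in> v \<inter> K" "e (v - {k}) k * edge (r (v - {k})) k (z (v - {k})) S \<noteq> 0"
      unfolding diff_def by (meson sum.neutral)
    then have "z (v - {k}) \<noteq> 0" by auto
    then have w: "v - {k} \<subseteq> K" "int (card (v - {k})) = m" using chainsD(2,3)[OF z] by blast+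
    then have "finite (v - {k})" using cubeD(1)[OF c] finite_subset by blast
    then have "finite v" by simp
    then have "card v = Suc (card (v - {k}))" using k(1) by (intro card.remove) auto
    then show ?thesis using w k by auto
  qed
  moreover have "diff K r e z v \<in> U (r v)" for v
  proof (cases "diff K r e z v = 0")
    case False
    then have v: "v \<subseteq> K" by (rule *[THEN conjunct1])
    have "scale (e (v - {k}) k) (edge (r (v - {k})) k (z (v - {k}))) \<in> U (r v)" if "k \<in> v \<inter> K" for k
    proof -
      have "z (v - {k}) \<in> U (r (v - {k}))" by (rule chainsD(1)[OF z])
      then have "edge (r (v - {k})) k (z (v - {k})) \<in> U (r (insert k (v - {k})))"
        using edge_in_U[OF c, of k "v - {k}"] v that by auto
      moreover have "insert k (v - {k}) = v" using that by auto
      ultimately show ?thesis by (simp add: U_scale)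
    qed
    then have "(\<lambda>S. \<Sum>k\<in>v \<inter> K. scale (e (v - {k}) k) (edge (r (v - {k})) k (z (v - {k}))) S) \<in> U (r v)"
      by (rule U_sum)
    then show ?thesis by (simp add: diff_def[abs_def] fun_eq_iff)
  qed simp
  ultimately show ?thesis by (intro chainsI)
qed

lemma anticommutingD:
  assumes "anticommuting K r e" "v \<subseteq> K" "k \<in> K - v" "l \<in> K - v" "k \<noteq> l" "f \<in> U (r v)"
  shows "scale (e v k * e (insert k v) l) (edge (r (insert k v)) l (edge (r v) k f)) +
     scale (e v l * e (insert l v) k) (edge (r (insert l v)) k (edge (r v) l f)) = 0"
  using assms(1)[unfolded anticommuting_def, rule_format, OF assms(2-6)] .

lemma diff_diff:
  assumes c: "cube K r" and a: "anticommuting K r e" and z: "z \<in> chains K r m"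
  shows "diff K r e (diff K r e z) = 0"
proof -
  have "diff K r e (diff K r e z) w S = 0" for w S
  proof (cases "w \<subseteq> K")
    case False
    have "diff K r e (diff K r e z) \<in> chains K r (m + 1 + 1)"
      by (intro diff_in_chains c z)
    then have "diff K r e (diff K r e z) w = 0" using False chainsD(2) by blast
    then show ?thesis by simp
  next
    case True
    have fin: "finite w" using True cubeD(1)[OF c] finite_subset by blast
    \<comment> \<open>The contribution of the path into \<open>w\<close> that adds \<open>k\<close>
      first and \<open>l\<close> second.\<close>
    define t where "t k l = e (w - {l} - {k}) k * e (w - {l}) l *
      edge (r (w - {l})) l (edge (r (w - {l} - {k})) k (z (w - {l} - {k}))) S" for k l
    have "t k l + t l k = 0" if kl: "k \<in> w" "l \<in> w" "k \<noteq> l" for k l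
    proof -
      define v where "v = w - {l} - {k}"
      have v: "v \<subseteq> K" "k \<in> K - v" "l \<in> K - v" "insert k v = w - {l}" "insert l v = w - {k}"
        "w - {k} - {l} = v" "w - {l} - {k} = v"
        using kl True by (auto simp: v_def)
      have "z v \<in> U (r v)" by (rule chainsD(1)[OF z])
      from fun_cong[OF anticommutingD[OF a v(1-3) kl(3) this], of S] show ?thesis
        unfolding t_def v(6,7) by (simp add: v(4,5))
    qed
    then have "(\<Sum>l\<in>w. \<Sum>k\<in>w - {l}. t k l) = 0" by (rule sum_antisymmetric_pairs[OF fin])
    moreover have "diff K r e (diff K r e z) w S = (\<Sum>l\<in>w. \<Sum>k\<in>w - {l}. t k l)"
    proof -
      have wK: "w \<inter> K = w" "\<And>l. (w - {l}) \<inter> K = w - {l}" using True by auto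
      have "edge (r (w - {l})) l (diff K r e z (w - {l})) S =
         (\<Sum>k\<in>w - {l}. e (w - {l} - {k}) k *
           edge (r (w - {l})) l (edge (r (w - {l} - {k})) k (z (w - {l} - {k}))) S)" for l
      proof -
        have "diff K r e z (w - {l}) = (\<lambda>S. \<Sum>k\<in>w - {l}.
           scale (e (w - {l} - {k}) k) (edge (r (w - {l} - {k})) k (z (w - {l} - {k}))) S)"
          by (simp add: fun_eq_iff diff_def wK)
        then show ?thesis by (simp only: edge_sum edge_scale) simp
      qed
      then show ?thesis
        unfolding diff_def[of K r e "diff K r e z"] wK t_def
        by (simp add: sum_distrib_left mult_ac)
    qed
    ultimately show ?thesis by simp
  qed
  then show ?thesis by (simp add: fun_eq_iff)
qed

section \<open>Sign changes along a separating set of arcs, and a right inverse of merging\<close>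

text \<open>For finite \<open>B\<close>, conjugation by this involution negates X_a for the arcs a
  in \<open>B\<close> and fixes the other X_a.\<close>

definition flip :: "'a set \<Rightarrow> ('a set \<Rightarrow> 'f::field) \<Rightarrow> 'a set \<Rightarrow> 'f" where
  "flip B f S = (- 1) ^ card (S \<inter> B) * f S"

definition separates :: "'a set \<Rightarrow> 'a rel \<Rightarrow> bool" where
  "separates B \<rho> \<longleftrightarrow> (\<forall>(x, y)\<in>\<rho>. x \<in> B \<longleftrightarrow> y \<in> B)"

text \<open>The price of moving \<open>flip B\<close> past an edge with both legs on the same side
  of \<open>B\<close>: a split is an inclusion and commutes with it, while both summands of a merge
  inside \<open>B\<close> change sign.\<close>

definition edge_sign :: "'a set \<Rightarrow> 'a rel \<Rightarrow> nat \<Rightarrow> 'f::field" where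
  "edge_sign B \<rho> k = (if (p k, q k) \<notin> \<rho> \<and> p k \<in> B then - 1 else 1)"

text \<open>Dual to putting the unit on the circle through \<open>a\<close>, hence a right inverse of merging it.\<close>

definition lift :: "'a rel \<Rightarrow> 'a \<Rightarrow> ('a set \<Rightarrow> 'f::field) \<Rightarrow> 'a set \<Rightarrow> 'f" where
  "lift \<rho> a g S = (if \<exists>s. S \<inter> \<rho> `` {a} = {s} then g (S - \<rho> `` {a}) else 0)"

lemma flip_flip [simp]: "flip B (flip B f) = f"
  by (simp add: flip_def fun_eq_iff)

lemma flip_add: "flip B (f + g) = flip B f + flip B g"
  by (simp add: flip_def fun_eq_iff algebra_simps)

lemma flip_diff: "flip B (f - g) = flip B f - flip B g"
  by (simp add: flip_def fun_eq_iff algebra_simps)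

lemma flip_scale: "flip B (scale c f) = scale c (flip B f)"
  by (simp add: flip_def fun_eq_iff algebra_simps)

lemma flip_zero [simp]: "flip B 0 = 0"
  by (simp add: flip_def fun_eq_iff)

lemma flip_eq_zero_iff [simp]: "flip B f = 0 \<longleftrightarrow> f = 0"
  by (metis flip_flip flip_zero)

lemma flip_sum: "flip B (\<lambda>S. \<Sum>i\<in>I. f i S) = (\<lambda>S. \<Sum>i\<in>I. flip B (f i) S)"
  by (simp add: flip_def fun_eq_iff sum_distrib_left)

lemma merge_map_sum: "merge_map k (\<lambda>S. \<Sum>i\<in>I. f i S) = (\<lambda>S. \<Sum>i\<in>I. merge_map k (f i) S)"
  by (auto simp: merge_map_def contract_def fun_eq_iff sum.distrib)

lemma merge_map_zero [simp]: "merge_map k 0 = 0"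
  by (simp add: merge_map_def)

lemma contract_flip:
  assumes "finite B"
  shows "contract x (flip B f) = scale (if x \<in> B then - 1 else 1) (flip B (contract x f))"
  using assms by (auto simp: contract_def flip_def fun_eq_iff)

lemma flip_in_U:
  assumes "finite B" "separates B \<rho>" "f \<in> U \<rho>"
  shows "flip B f \<in> U \<rho>"
proof -
  have "S \<subseteq> E" if "flip B f S \<noteq> 0" for S
    using that U_support[OF assms(3)] by (auto simp: flip_def)
  moreover have "contract x (flip B f) = contract y (flip B f)" if "(x, y) \<in> \<rho>" for x y
  proof -
    have "x \<in> B \<longleftrightarrow> y \<in> B" using assms(2) that by (auto simp: separates_def)
    then show ?thesis
      using U_contract_eq[OF assms(3) that] by (simp add: contract_flip[OF assms(1)])
  qed
  ultimately show ?thesis by (auto simp: U_def)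
qed

lemma edge_flip:
  assumes "finite B" "p k \<in> B \<longleftrightarrow> q k \<in> B"
  shows "edge \<rho> k (flip B f) = scale (edge_sign B \<rho> k) (flip B (edge \<rho> k f))"
  using assms
  by (auto simp: edge_def edge_sign_def merge_map_def contract_flip flip_add fun_eq_iff)

text \<open>At a crossing between the two sides of \<open>B\<close> only one summand changes sign.
  The resulting difference vanishes exactly when the condition for joining the two circles holds,
  which is how membership in the smaller space becomes the kernel of a merge.\<close>

lemma merge_map_flip:
  assumes "finite B" "p k \<notin> B" "q k \<in> B"
  shows "merge_map k (flip B f) = flip B (contract (p k) f - contract (q k) f)"
  using assms by (simp add: merge_map_def contract_flip flip_diff fun_eq_iff)

lemma edge_merge_map: "edge \<rho> l (merge_map k f) = merge_map k (edge \<rho> l f)"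
  by (simp add: edge_def merge_map_commute)

lemma edge_sign_square: "edge_sign B \<rho> k * edge_sign B \<rho> k = (1 :: 'f::field)"
  by (simp add: edge_sign_def)

lemma edge_sign_nonzero: "edge_sign B \<rho> k \<noteq> (0 :: 'f::field)"
  by (simp add: edge_sign_def)

lemma lift_add: "lift \<rho> a (f + g) = lift \<rho> a f + lift \<rho> a g"
  by (auto simp: lift_def fun_eq_iff)

lemma lift_scale: "lift \<rho> a (scale c f) = scale c (lift \<rho> a f)"
  by (auto simp: lift_def fun_eq_iff)

lemma lift_zero [simp]: "lift \<rho> a 0 = 0"
  by (auto simp: lift_def fun_eq_iff)

text \<open>Applying the square-zero X_y to the rest of \<open>S\<close> accounts for
  \<open>y\<close> twice. Hence elements of \<open>U \<rho>\<close> are determined by their values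
  on sets that meet each circle at most once, as a basis of labellings demands.\<close>

lemma U_meets_twice:
  assumes "f \<in> U \<rho>" "(x, y) \<in> \<rho>" "x \<noteq> y" "x \<in> S" "y \<in> S"
  shows "f S = 0"
proof -
  have "f S = contract x f (S - {x})"
    using assms by (simp add: contract_def insert_absorb)
  also have "\<dots> = contract y f (S - {x})" using U_contract_eq[OF assms(1,2)] by simp
  also have "\<dots> = 0" using assms by (simp add: contract_def)
  finally show ?thesis .
qed

text \<open>Let A be the circle through \<open>p k\<close>. If \<open>S\<close> misses A, the
  summand at \<open>p k\<close> returns \<open>g S\<close> and the one at \<open>q k\<close> is
  zero. If \<open>S\<close> meets A once, in s, the summand at \<open>p k\<close> is zero and the
  one at \<open>q k\<close> replaces s by \<open>q k\<close>, which \<open>g\<close> does not notice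
  because the two lie on one circle of \<open>\<rho>'\<close>. If \<open>S\<close> meets A more
  often, both sides vanish.\<close>

lemma lift_correct:
  assumes eq: "equiv E \<rho>" and j: "joined k \<rho> \<rho>'" and p: "p k \<in> E" "q k \<in> E" and g: "g \<in> U \<rho>'"
  shows lift_in_U: "lift \<rho> (p k) g \<in> U \<rho>" and merge_map_lift: "merge_map k (lift \<rho> (p k) g) = g"
proof -
  define A where "A = \<rho> `` {p k}"
  have AE: "A \<subseteq> E" and pA: "p k \<in> A" and qA: "q k \<notin> A"
    using eq p j by (auto simp: A_def equiv_def refl_on_def joined_def)
  let ?f = "lift \<rho> (p k) g"
  have f: "?f S = (if \<exists>s. S \<inter> A = {s} then g (S - A) else 0)" for S
    by (simp add: lift_def A_def)
  have in_A: "contract x ?f S = (if S \<inter> A = {} then g S else 0)" if "x \<in> A" for x S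
  proof (cases "S \<inter> A = {}")
    case True
    then have "x \<notin> S" "insert x S \<inter> A = {x}" "insert x S - A = S" using that by auto
    then show ?thesis using True by (simp add: contract_def f)
  next
    case False
    have "\<not> (\<exists>s. insert x S \<inter> A = {s})" if "x \<notin> S"
    proof
      assume "\<exists>s. insert x S \<inter> A = {s}"
      then obtain s where s: "insert x S \<inter> A = {s}" by blast
      obtain y where "y \<in> S \<inter> A" using False by blast
      then have "y = s" "x = s" using s \<open>x \<in> A\<close> by blast+
      then show False using \<open>y \<in> S \<inter> A\<close> \<open>x \<notin> S\<close> by blast
    qed
    then show ?thesis using False by (auto simp: contract_def f)
  qed
  have not_in_A: "contract x ?f S = (if \<exists>s. S \<inter> A = {s} then contract x g (S - A) else 0)"
    if "x \<notin> A" for x S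
  proof -
    have "insert x S \<inter> A = S \<inter> A" "insert x S - A = insert x (S - A)" "x \<in> S - A \<longleftrightarrow> x \<in> S"
      using that by auto
    then show ?thesis by (simp add: contract_def f)
  qed
  have "S \<subseteq> E" if "?f S \<noteq> 0" for S
  proof -
    have "g (S - A) \<noteq> 0" using that by (auto simp: f split: if_splits)
    then have "S - A \<subseteq> E" using U_support[OF g] by blast
    then show ?thesis using AE by blast
  qed
  moreover have "contract x ?f = contract y ?f" if xy: "(x, y) \<in> \<rho>" for x y
  proof (cases "x \<in> A")
    case True
    then have "y \<in> A" using xy eq by (auto simp: A_def equiv_def intro: transD)
    then show ?thesis using True by (simp add: fun_eq_iff in_A)
  next
    case False
    have "y \<notin> A"
    proof
      assume "y \<in> A"
      then have "(p k, y) \<in> \<rho>" "(y, x) \<in> \<rho>"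
        using xy eq by (auto simp: A_def equiv_def dest: symD)
      then show False using False eq by (auto simp: A_def equiv_def dest: transD)
    qed
    moreover have "contract x g = contract y g"
      using U_contract_eq[OF g] joined_subset[OF j] xy by blast
    ultimately show ?thesis using False by (simp add: fun_eq_iff not_in_A)
  qed
  ultimately show "?f \<in> U \<rho>" by (auto simp: U_def)
  have A_rel: "(s, q k) \<in> \<rho>'" "(s, t) \<in> \<rho>'" if "s \<in> A" "t \<in> A" for s t
    using that j p eq by (auto simp: joined_def A_def equiv_def refl_on_def)
  have "merge_map k ?f S = g S" for S
  proof -
    consider "S \<inter> A = {}" | s where "S \<inter> A = {s}" | s t where "s \<in> S \<inter> A" "t \<in> S \<inter> A" "s \<noteq> t"
      by blast
    then show ?thesis
    proof cases
      case 1
      then show ?thesis by (simp add: merge_map_def in_A[OF pA] not_in_A[OF qA])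
    next
      case 2
      then have s: "s \<in> A" "s \<in> S" by auto
      then have "contract (q k) g = contract s g" using U_contract_eq[OF g A_rel(1)] by auto
      moreover have "insert s (S - A) = S" "s \<notin> S - A" using 2 by auto
      ultimately have "contract (q k) g (S - A) = g S" using s by (simp add: contract_def)
      then show ?thesis using 2 by (simp add: merge_map_def in_A[OF pA] not_in_A[OF qA])
    next
      case 3
      then have "g S = 0" using U_meets_twice[OF g A_rel(2)[of s t]] by blast
      moreover have "\<not> (\<exists>u. S \<inter> A = {u})" using 3 by (metis singletonD)
      moreover have "S \<inter> A \<noteq> {}" using 3 by blast
      ultimately show ?thesis by (simp add: merge_map_def in_A[OF pA] not_in_A[OF qA])
    qed
  qed
  then show "merge_map k ?f = g" by (simp add: fun_eq_iff)
qed

section \<open>The two faces of a cube at a crossing\<close>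

text \<open>Both parts are set to zero at vertices containing \<open>k\<close>, so that they are
  chains over \<open>K - {k}\<close> and \<open>glue\<close> inverts the decomposition.\<close>

definition part0 :: "nat \<Rightarrow> (nat set \<Rightarrow> 'a set \<Rightarrow> 'f::field) \<Rightarrow> nat set \<Rightarrow> 'a set \<Rightarrow> 'f" where
  "part0 k z v = (if k \<in> v then 0 else z v)"

definition part1 :: "nat \<Rightarrow> (nat set \<Rightarrow> 'a set \<Rightarrow> 'f::field) \<Rightarrow> nat set \<Rightarrow> 'a set \<Rightarrow> 'f" where
  "part1 k z v = (if k \<in> v then 0 else z (insert k v))"

definition glue :: "nat \<Rightarrow> (nat set \<Rightarrow> 'a set \<Rightarrow> 'f::field) \<Rightarrow> (nat set \<Rightarrow> 'a set \<Rightarrow> 'f)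
    \<Rightarrow> nat set \<Rightarrow> 'a set \<Rightarrow> 'f" where
  "glue k y x v = (if k \<in> v then x (v - {k}) else y v)"

definition connecting :: "nat \<Rightarrow> (nat set \<Rightarrow> 'a rel) \<Rightarrow> (nat set \<Rightarrow> nat \<Rightarrow> 'f::field)
    \<Rightarrow> (nat set \<Rightarrow> 'a set \<Rightarrow> 'f) \<Rightarrow> nat set \<Rightarrow> 'a set \<Rightarrow> 'f" where
  "connecting k r e z w = (if k \<in> w then 0 else scale (e w k) (edge (r w) k (z w)))"

abbreviation upper :: "nat \<Rightarrow> (nat set \<Rightarrow> 'b) \<Rightarrow> nat set \<Rightarrow> 'b" where
  "upper k r \<equiv> \<lambda>v. r (insert k v)"

lemma linear_part0: "linear_operator (part0 k)"
  by (auto simp: linear_operator_def part0_def fun_eq_iff)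

lemma linear_part1: "linear_operator (part1 k)"
  by (auto simp: linear_operator_def part1_def fun_eq_iff)

lemma linear_connecting: "linear_operator (connecting k r e)"
  by (auto simp: linear_operator_def connecting_def fun_eq_iff edge_add edge_scale algebra_simps)

lemma linear_glue:
  "linear_operator g \<Longrightarrow> linear_operator h \<Longrightarrow> linear_operator (\<lambda>z. glue k (g z) (h z))"
  by (auto simp: linear_operator_def glue_def fun_eq_iff)

lemma part0_diff: "part0 k (diff K r e z) = diff (K - {k}) r e (part0 k z)"
proof -
  have "part0 k (diff K r e z) v S = diff (K - {k}) r e (part0 k z) v S" for v S
  proof (cases "k \<in> v")
    case True
    then show ?thesis by (auto simp: part0_def diff_def intro!: sum.neutral[symmetric])
  next
    case False
    then have "v \<inter> (K - {k}) = v \<inter> K" by auto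
    then show ?thesis using False by (simp add: part0_def diff_def)
  qed
  then show ?thesis by (simp add: fun_eq_iff)
qed

lemma part1_diff:
  assumes "finite K" "k \<in> K"
  shows "part1 k (diff K r e z)
    = connecting k r e (part0 k z) + diff (K - {k}) (upper k r) (upper k e) (part1 k z)"
proof -
  have "part1 k (diff K r e z) w S
    = (connecting k r e (part0 k z) + diff (K - {k}) (upper k r) (upper k e) (part1 k z)) w S" for w S
  proof (cases "k \<in> w")
    case True
    then show ?thesis by (auto simp: part1_def connecting_def diff_def intro!: sum.neutral[symmetric])
  next
    case False
    have "insert k w \<inter> K = insert k (w \<inter> (K - {k}))" using assms False by auto
    moreover have "finite (w \<inter> (K - {k}))" using assms by auto
    moreover have "(\<Sum>l\<in>w \<inter> (K - {k}). e (insert k w - {l}) l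
        * edge (r (insert k w - {l})) l (z (insert k w - {l})) S)
      = (\<Sum>l\<in>w \<inter> (K - {k}). e (insert k (w - {l})) l
        * edge (r (insert k (w - {l}))) l (part1 k z (w - {l})) S)"
    proof (rule sum.cong)
      fix l
      assume "l \<in> w \<inter> (K - {k})"
      then have "insert k w - {l} = insert k (w - {l})" by auto
      then show "e (insert k w - {l}) l * edge (r (insert k w - {l})) l (z (insert k w - {l})) S
        = e (insert k (w - {l})) l * edge (r (insert k (w - {l}))) l (part1 k z (w - {l})) S"
        using False by (simp add: part1_def)
    qed simp
    moreover have "insert k w - {k} = w" using False by auto
    ultimately show ?thesis
      using False by (simp add: part1_def[of k "diff K r e z"] connecting_def diff_def part0_def)
  qed
  then show ?thesis by (simp add: fun_eq_iff)
qed

lemma cube_lower: "cube K r \<Longrightarrow> cube (K - {k}) r"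
  unfolding cube_def by (auto 0 0 simp: subset_Diff_insert)

lemma cube_upper:
  assumes c: "cube K r" and k: "k \<in> K"
  shows "cube (K - {k}) (upper k r)"
  unfolding cube_def
proof (intro conjI ballI allI impI)
  show "finite (K - {k})" using cubeD(1)[OF c] by simp
  show "equiv E (r (insert k v))" if "v \<subseteq> K - {k}" for v
    using cubeD(2)[OF c, of "insert k v"] that k by auto
  fix l assume l: "l \<in> K - {k}"
  then show "p l \<in> E" "q l \<in> E" using cubeD(3,4)[OF c] by auto
  fix v assume v: "v \<subseteq> K - {k} - {l}"
  show "joined l (r (insert k v)) (r (insert k (insert l v))) \<or>
     joined l (r (insert k (insert l v))) (r (insert k v))"
    using cubeD(5)[OF c, of l "insert k v"] l v k
    by (auto simp: insert_commute)
qed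

lemma anticommuting_lower: "anticommuting K r e \<Longrightarrow> anticommuting (K - {k}) r e"
  unfolding anticommuting_def by blast

lemma anticommuting_upper:
  assumes a: "anticommuting K r e" and k: "k \<in> K"
  shows "anticommuting (K - {k}) (upper k r) (upper k e)"
  unfolding anticommuting_def
proof (intro allI ballI impI)
  fix v l m and f :: "'a set \<Rightarrow> 'b"
  assume *: "v \<subseteq> K - {k}" "l \<in> K - {k} - v" "m \<in> K - {k} - v" "l \<noteq> m" "f \<in> U (r (insert k v))"
  then have "insert k v \<subseteq> K" "l \<in> K - insert k v" "m \<in> K - insert k v" using k by auto
  from anticommutingD[OF a this *(4,5)]
  show "scale (e (insert k v) l * e (insert k (insert l v)) m)
      (edge (r (insert k (insert l v))) m (edge (r (insert k v)) l f)) +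
     scale (e (insert k v) m * e (insert k (insert m v)) l)
      (edge (r (insert k (insert m v))) l (edge (r (insert k v)) m f)) = 0"
    by (simp add: insert_commute)
qed

lemma part0_in_chains:
  assumes "z \<in> chains K r m"
  shows "part0 k z \<in> chains (K - {k}) r m"
proof (rule chainsI)
  fix v
  show "part0 k z v \<in> U (r v)" using chainsD(1)[OF assms] by (simp add: part0_def)
  assume "part0 k z v \<noteq> 0"
  then have "k \<notin> v" "z v \<noteq> 0" by (auto simp: part0_def split: if_splits)
  then show "v \<subseteq> K - {k} \<and> int (card v) = m" using chainsD(2,3)[OF assms] by blast
qed

lemma part1_in_chains:
  assumes "z \<in> chains K r m" "finite K" "k \<in> K"
  shows "part1 k z \<in> chains (K - {k}) (upper k r) (m - 1)"
proof (rule chainsI)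
  fix v
  show "part1 k z v \<in> U (r (insert k v))" using chainsD(1)[OF assms(1)] by (simp add: part1_def)
  assume "part1 k z v \<noteq> 0"
  then have *: "k \<notin> v" "z (insert k v) \<noteq> 0" by (auto simp: part1_def split: if_splits)
  then have "insert k v \<subseteq> K" "int (card (insert k v)) = m" using chainsD[OF assms(1)] by blast+
  then show "v \<subseteq> K - {k} \<and> int (card v) = m - 1"
    using * assms(2) by (auto dest: finite_subset)
qed

lemma glue_in_chains:
  assumes "y \<in> chains (K - {k}) r m" "x \<in> chains (K - {k}) (upper k r) (m - 1)" "finite K" "k \<in> K"
  shows "glue k y x \<in> chains K r m"
proof (rule chainsI)
  fix v
  show "glue k y x v \<in> U (r v)"
    using chainsD(1)[OF assms(1), of v] chainsD(1)[OF assms(2), of "v - {k}"]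
    by (auto simp: glue_def insert_absorb)
  assume *: "glue k y x v \<noteq> 0"
  show "v \<subseteq> K \<and> int (card v) = m"
  proof (cases "k \<in> v")
    case True
    then have "x (v - {k}) \<noteq> 0" using * by (simp add: glue_def)
    then have **: "v - {k} \<subseteq> K - {k}" "int (card (v - {k})) = m - 1"
      using chainsD(2,3)[OF assms(2)] by blast+
    then have "finite (v - {k})" using assms(3) by (meson finite_Diff finite_subset)
    then have "card v = Suc (card (v - {k}))" using True by (intro card.remove) auto
    then show ?thesis using ** assms(4) by auto
  next
    case False
    then have "y v \<noteq> 0" using * by (simp add: glue_def)
    then show ?thesis using chainsD(2,3)[OF assms(1)] by blast
  qed
qed

lemma chains_lower_zero: "y \<in> chains (K - {k}) r m \<Longrightarrow> k \<in> v \<Longrightarrow> y v = 0"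
  using chainsD(2) by blast

lemma part0_glue: "y \<in> chains (K - {k}) r m \<Longrightarrow> part0 k (glue k y x) = y"
  by (auto simp: part0_def glue_def fun_eq_iff chains_lower_zero)

lemma part1_glue: "x \<in> chains (K - {k}) r m \<Longrightarrow> part1 k (glue k y x) = x"
  by (auto simp: part1_def glue_def fun_eq_iff chains_lower_zero)

lemma parts_eqI:
  assumes "part0 k y = part0 k z" "part1 k y = part1 k z"
  shows "y = z"
proof
  fix v
  show "y v = z v"
  proof (cases "k \<in> v")
    case True
    then have "insert k (v - {k}) = v" by auto
    then show ?thesis using fun_cong[OF assms(2), of "v - {k}"] by (simp add: part1_def)
  next
    case False
    then show ?thesis using fun_cong[OF assms(1), of v] by (simp add: part0_def)
  qed
qed

lemma connecting_in_chains:
  assumes c: "cube K r" and k: "k \<in> K" and z: "z \<in> chains (K - {k}) r m"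
  shows "connecting k r e z \<in> chains (K - {k}) (upper k r) m"
proof (rule chainsI)
  fix v
  show *: "v \<subseteq> K - {k} \<and> int (card v) = m" if "connecting k r e z v \<noteq> 0"
  proof -
    have "z v \<noteq> 0"
    proof
      assume "z v = 0"
      then have "connecting k r e z v = 0" by (auto simp: connecting_def)
      then show False using that by contradiction
    qed
    then show ?thesis using chainsD(2,3)[OF z] by blast
  qed
  show "connecting k r e z v \<in> U (r (insert k v))"
  proof (cases "connecting k r e z v = 0")
    case False
    then have "v \<subseteq> K" "k \<notin> v" using *[OF False] by auto
    then show ?thesis
      using edge_in_U[OF c k _ _ chainsD(1)[OF z]] by (simp add: connecting_def U_scale)
  qed simp
qed

lemma diff_glue:
  assumes c: "cube K r" and k: "k \<in> K"
    and y: "y \<in> chains (K - {k}) r m" and x: "x \<in> chains (K - {k}) (upper k r) m'"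
  shows "part0 k (diff K r e (glue k y x)) = diff (K - {k}) r e y"
    and "part1 k (diff K r e (glue k y x))
      = connecting k r e y + diff (K - {k}) (upper k r) (upper k e) x"
  by (simp_all add: part0_diff part1_diff[OF cubeD(1)[OF c] k] part0_glue[OF y] part1_glue[OF x])

text \<open>The component in the upper face of the fact that the differential squares to zero. With
  \<open>x = 0\<close> it says that \<open>connecting\<close> anticommutes with the differentials of
  the faces.\<close>

lemma diff_glue_diff:
  assumes c: "cube K r" and a: "anticommuting K r e" and k: "k \<in> K"
    and y: "y \<in> chains (K - {k}) r m" and x: "x \<in> chains (K - {k}) (upper k r) (m - 1)"
  shows "connecting k r e (diff (K - {k}) r e y)
     + diff (K - {k}) (upper k r) (upper k e) (connecting k r e y + diff (K - {k}) (upper k r) (upper k e) x) = 0"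
proof -
  have "glue k y x \<in> chains K r m" by (rule glue_in_chains[OF y x cubeD(1)[OF c] k])
  then have "diff K r e (diff K r e (glue k y x)) = 0" by (rule diff_diff[OF c a])
  then have "part1 k (diff K r e (diff K r e (glue k y x))) = 0"
    by (simp add: part1_def fun_eq_iff)
  then show ?thesis
    by (simp add: part1_diff[OF cubeD(1)[OF c] k, of r e "diff K r e (glue k y x)"]
        diff_glue[OF c k y x])
qed

lemma diff_parts:
  assumes c: "cube K r" and k: "k \<in> K" and z: "diff K r e z = 0"
  shows "diff (K - {k}) r e (part0 k z) = 0"
    and "connecting k r e (part0 k z) + diff (K - {k}) (upper k r) (upper k e) (part1 k z) = 0"
  unfolding part0_diff[symmetric] part1_diff[OF cubeD(1)[OF c] k, symmetric] z
  by (simp_all add: part0_def part1_def fun_eq_iff)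

section \<open>Induction on the number of crossings\<close>

lemma homology_boundI:
  assumes "\<And>i. linear_functional (\<phi> i)" "linear_operator h"
    and "\<And>z. z \<in> chains K r m \<Longrightarrow> diff K r e z = 0 \<Longrightarrow> (\<forall>i<N. \<phi> i z = 0)
      \<Longrightarrow> h z \<in> chains K r (m - 1) \<and> diff K r e (h z) = z"
  shows "homology_bound K r e m N"
  unfolding homology_bound_def
  by (rule exI[where x = \<phi>], rule exI[where x = h]) (use assms in auto)

lemma homology_boundE:
  assumes "homology_bound K r e m N"
  obtains \<phi> h where "\<And>i. linear_functional (\<phi> i)" "linear_operator h"
    "\<And>z. z \<in> chains K r m \<Longrightarrow> diff K r e z = 0 \<Longrightarrow> (\<forall>i<N. \<phi> i z = 0)
      \<Longrightarrow> h z \<in> chains K r (m - 1) \<and> diff K r e (h z) = z"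
  using assms unfolding homology_bound_def by metis

lemma homology_bound_mono:
  assumes b: "homology_bound K r e m N" and le: "N \<le> N'"
  shows "homology_bound K r e m N'"
proof -
  obtain \<phi> h where *: "\<And>i. linear_functional (\<phi> i)" "linear_operator h"
    "\<And>z. z \<in> chains K r m \<Longrightarrow> diff K r e z = 0 \<Longrightarrow> (\<forall>i<N. \<phi> i z = 0)
      \<Longrightarrow> h z \<in> chains K r (m - 1) \<and> diff K r e (h z) = z"
    by (rule homology_boundE[OF b]) (rule that)
  show ?thesis by (rule homology_boundI[where \<phi> = \<phi> and h = h]) (use * le in auto)
qed

text \<open>The reflexive transitive closure of \<open>G\<close> is the connectivity of the face
  \<open>s\<close>. If it related \<open>p k\<close> to \<open>q k\<close>, joining their classes
  would add nothing, so the face \<open>t\<close> would not connect more than \<open>s\<close> does,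
  against the connectedness of the whole cube. Hence the two legs are never on one circle in
  \<open>s\<close>, and every edge at \<open>k\<close> joins circles from \<open>s\<close> to
  \<open>t\<close>. \<open>B\<close> is the component of \<open>q k\<close>, and \<open>t\<close> is
  connected because its relations contain those of \<open>s\<close>. The pair \<open>s\<close>,
  \<open>t\<close> covers both positions of the disconnected face.\<close>

lemma disconnected_face:
  assumes c: "cube K r" and con: "connected_cube K r" and k: "k \<in> K"
    and st: "s = r \<and> t = upper k r \<or> s = upper k r \<and> t = r"
    and dis: "\<not> connected_cube (K - {k}) s"
  obtains B where "finite B" "p k \<notin> B" "q k \<in> B"
    "\<And>v. v \<subseteq> K - {k} \<Longrightarrow> separates B (s v)"
    "\<And>v. v \<subseteq> K - {k} \<Longrightarrow> joined k (s v) (t v)"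
    "connected_cube (K - {k}) t"
proof -
  have eq: "equiv E (s v)" "equiv E (t v)" if "v \<subseteq> K - {k}" for v
    using st cubeD(2)[OF c, of v] cubeD(2)[OF c, of "insert k v"] that k by auto
  have j: "joined k (s v) (t v) \<or> joined k (t v) (s v)" if "v \<subseteq> K - {k}" for v
    using st cubeD(5)[OF c k, of v] that by auto
  have pq: "p k \<in> E" "q k \<in> E" using cubeD(3,4)[OF c k] .
  define G where "G = (\<Union>v\<in>Pow (K - {k}). s v)"
  have sG: "s v \<subseteq> G" if "v \<subseteq> K - {k}" for v using that by (auto simp: G_def)
  have "sym G" using eq by (auto simp: G_def sym_def equiv_def)
  then have symG: "sym (G\<^sup>*)" by (rule sym_rtrancl)
  have symG': "(y, x) \<in> G\<^sup>*" if "(x, y) \<in> G\<^sup>*" for x y using symD[OF symG that] .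
  have "(\<Union>v\<in>Pow K. r v) \<subseteq> G \<union> (\<Union>v\<in>Pow (K - {k}). t v)"
  proof
    fix x assume "x \<in> (\<Union>v\<in>Pow K. r v)"
    then obtain v where v: "v \<subseteq> K" "x \<in> r v" by auto
    have "r v = s (v - {k}) \<or> r v = t (v - {k})"
    proof (cases "k \<in> v")
      case True
      then show ?thesis using st by (auto simp: insert_absorb)
    next
      case False
      then show ?thesis using st by auto
    qed
    moreover have "v - {k} \<in> Pow (K - {k})" using v(1) by blast
    ultimately show "x \<in> G \<union> (\<Union>v\<in>Pow (K - {k}). t v)"
      using v(2) unfolding G_def by blast
  qed
  then have tot: "E \<times> E \<subseteq> (G \<union> (\<Union>v\<in>Pow (K - {k}). t v))\<^sup>*"
    using con unfolding connected_cube_def by (rule order.trans[OF _ rtrancl_mono, rotated])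
  have apart: "(p k, q k) \<notin> G\<^sup>*"
  proof
    assume pq_rel: "(p k, q k) \<in> G\<^sup>*"
    have "t v \<subseteq> G\<^sup>*" if v: "v \<subseteq> K - {k}" for v
      using j[OF v]
    proof
      assume jj: "joined k (s v) (t v)"
      have "(p k, x) \<in> G\<^sup>*" if "x \<in> s v `` {p k, q k}" for x
      proof -
        have "(p k, x) \<in> s v \<or> (q k, x) \<in> s v" using that by auto
        then show ?thesis using sG[OF v] pq_rel by (meson r_into_rtrancl rtrancl_trans subsetD)
      qed
      then have "(x, y) \<in> G\<^sup>*" if "x \<in> s v `` {p k, q k}" "y \<in> s v `` {p k, q k}" for x y
        using that symG' rtrancl_trans by metis
      then show ?thesis using jj sG[OF v] unfolding joined_def by blast
    next
      assume "joined k (t v) (s v)"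
      then show ?thesis using joined_subset sG[OF v] by blast
    qed
    then have "G \<union> (\<Union>v\<in>Pow (K - {k}). t v) \<subseteq> G\<^sup>*" by auto
    then have "(G \<union> (\<Union>v\<in>Pow (K - {k}). t v))\<^sup>* \<subseteq> G\<^sup>*"
      by (rule rtrancl_subset_rtrancl)
    then have "E \<times> E \<subseteq> G\<^sup>*" using tot by (rule order.trans[rotated])
    then show False using dis by (simp add: connected_cube_def G_def)
  qed
  have st_joined: "joined k (s v) (t v)" if v: "v \<subseteq> K - {k}" for v
  proof -
    have "(p k, q k) \<notin> s v" using apart sG[OF v] by blast
    then show ?thesis using j[OF v] joined_mem eq(2)[OF v] pq by blast
  qed
  define B where "B = E \<inter> G\<^sup>* `` {q k}"
  show ?thesis
  proof
    show "finite B" using finite_E by (simp add: B_def)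
    show "p k \<notin> B" using apart symG' by (auto simp: B_def)
    show "q k \<in> B" using pq by (simp add: B_def)
    show "joined k (s v) (t v)" if "v \<subseteq> K - {k}" for v by (rule st_joined[OF that])
    show "separates B (s v)" if v: "v \<subseteq> K - {k}" for v
    proof -
      have "x \<in> E" "y \<in> E" "(x, y) \<in> G\<^sup>*" "(y, x) \<in> G\<^sup>*" if "(x, y) \<in> s v" for x y
        using that eq(1)[OF v] sG[OF v] symG' by (auto simp: equiv_def)
      then show ?thesis unfolding separates_def B_def
        by (auto intro: rtrancl_trans)
    qed
    have "G \<subseteq> (\<Union>v\<in>Pow (K - {k}). t v)"
      unfolding G_def by (rule UN_mono) (auto dest: subsetD[OF joined_subset[OF st_joined]])
    then have "G \<union> (\<Union>v\<in>Pow (K - {k}). t v) = (\<Union>v\<in>Pow (K - {k}). t v)" by (rule Un_absorb1)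
    then show "connected_cube (K - {k}) t"
      using tot by (simp add: connected_cube_def)
  qed
qed

text \<open>The long exact sequence of the cone of \<^term>\<open>connecting\<close>.\<close>

lemma homology_bound_cone:
  assumes c: "cube K r" and a: "anticommuting K r e" and k: "k \<in> K"
    and b0: "homology_bound (K - {k}) r e m N0"
    and b1: "homology_bound (K - {k}) (upper k r) (upper k e) (m - 1) N1"
  shows "homology_bound K r e m (N0 + N1)"
proof -
  let ?d0 = "diff (K - {k}) r e" and ?d1 = "diff (K - {k}) (upper k r) (upper k e)"
  obtain \<phi>0 h0 where lin0: "\<And>i. linear_functional (\<phi>0 i)" "linear_operator h0"
    and h0: "\<And>z. z \<in> chains (K - {k}) r m \<Longrightarrow> ?d0 z = 0 \<Longrightarrow> (\<forall>i<N0. \<phi>0 i z = 0)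
      \<Longrightarrow> h0 z \<in> chains (K - {k}) r (m - 1) \<and> ?d0 (h0 z) = z"
    by (rule homology_boundE[OF b0]) (rule that)
  obtain \<phi>1 h1 where lin1: "\<And>i. linear_functional (\<phi>1 i)" "linear_operator h1"
    and h1: "\<And>z. z \<in> chains (K - {k}) (upper k r) (m - 1) \<Longrightarrow> ?d1 z = 0 \<Longrightarrow> (\<forall>i<N1. \<phi>1 i z = 0)
      \<Longrightarrow> h1 z \<in> chains (K - {k}) (upper k r) (m - 1 - 1) \<and> ?d1 (h1 z) = z"
    by (rule homology_boundE[OF b1]) (rule that)
  \<comment> \<open>\<open>?y z\<close> is to bound the lower part of \<open>z\<close>. Its image
    under \<open>connecting\<close> generally misses the upper part, and the difference
    \<open>?x z\<close> is a cycle of the upper face, to which the second batch of functionals is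
    applied.\<close>
  let ?y = "\<lambda>z. h0 (part0 k z)"
  let ?x = "\<lambda>z. part1 k z - connecting k r e (?y z)"
  have liny: "linear_operator ?y"
    by (intro linear_operator_comp[OF lin0(2)] linear_part0)
  have linx: "linear_operator ?x"
    by (intro linear_operator_diff linear_part1 linear_operator_comp[OF linear_connecting liny])
  show ?thesis
  proof (rule homology_boundI)
    show "linear_functional (\<lambda>z. if i < N0 then \<phi>0 i (part0 k z) else \<phi>1 (i - N0) (?x z))" for i
      using linear_functional_comp[OF lin0(1)[of i] linear_part0]
        linear_functional_comp[OF lin1(1)[of "i - N0"] linx]
      by (cases "i < N0") simp_all
    show "linear_operator (\<lambda>z. glue k (?y z) (h1 (?x z)))"
      by (intro linear_glue liny linear_operator_comp[OF lin1(2) linx])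
    fix z assume z: "z \<in> chains K r m" and dz: "diff K r e z = 0"
      and \<phi>: "\<forall>i<N0 + N1. (if i < N0 then \<phi>0 i (part0 k z) else \<phi>1 (i - N0) (?x z)) = 0"
    note dz' = diff_parts[OF c k dz]
    have "\<forall>i<N0. \<phi>0 i (part0 k z) = 0" using \<phi> by (metis trans_less_add1)
    then have y: "?y z \<in> chains (K - {k}) r (m - 1)" and dy: "?d0 (?y z) = part0 k z"
      using h0[OF part0_in_chains[OF z] dz'(1)] by blast+
    have x: "?x z \<in> chains (K - {k}) (upper k r) (m - 1)"
      by (intro chains_diff connecting_in_chains c k y part1_in_chains z cubeD(1)[OF c])
    have "connecting k r e (part0 k z) + ?d1 (connecting k r e (?y z)) = 0"
      using diff_glue_diff[OF c a k y chains_zero]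
      by (simp only: dy linear_operator_zero[OF linear_diff] add_0_right)
    then have "?d1 (?x z) = 0"
      using dz'(2) unfolding linear_operator_minus[OF linear_diff] right_minus_eq
      by (metis add_left_imp_eq)
    moreover have "\<forall>i<N1. \<phi>1 i (?x z) = 0"
    proof (intro allI impI)
      fix i assume "i < N1"
      then show "\<phi>1 i (?x z) = 0" using \<phi>[rule_format, of "N0 + i"] by simp
    qed
    ultimately have hx: "h1 (?x z) \<in> chains (K - {k}) (upper k r) (m - 1 - 1)"
      and dhx: "?d1 (h1 (?x z)) = ?x z"
      using h1[OF x] by blast+
    have "diff K r e (glue k (?y z) (h1 (?x z))) = z"
      by (rule parts_eqI[where k = k]) (simp_all add: diff_glue[OF c k y hx] dy dhx)
    then show "glue k (?y z) (h1 (?x z)) \<in> chains K r (m - 1) \<and>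
        diff K r e (glue k (?y z) (h1 (?x z))) = z"
      using glue_in_chains[OF y hx cubeD(1)[OF c] k] by blast
  qed
qed

text \<open>Among the arcs on the two joined circles, lying in \<open>B\<close> means lying on the
  circle of \<open>q k\<close>, so two such arcs on the same side of \<open>B\<close> were on one
  circle before. Hence the remaining crossings have the same kind of edge in both faces.\<close>

lemma joined_same_side:
  assumes "equiv E \<rho>" "joined k \<rho> \<rho>'" "separates B \<rho>" "p k \<notin> B" "q k \<in> B" "x \<in> B \<longleftrightarrow> y \<in> B"
  shows "(x, y) \<in> \<rho>' \<longleftrightarrow> (x, y) \<in> \<rho>"
proof
  assume "(x, y) \<in> \<rho>'"
  then consider "(x, y) \<in> \<rho>" | "x \<in> \<rho> `` {p k, q k}" "y \<in> \<rho> `` {p k, q k}"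
    using assms(2) by (auto simp: joined_def)
  then show "(x, y) \<in> \<rho>"
  proof cases
    case 2
    have "z \<in> B \<longleftrightarrow> (q k, z) \<in> \<rho>" "z \<notin> B \<longleftrightarrow> (p k, z) \<in> \<rho>" if "z \<in> \<rho> `` {p k, q k}" for z
      using that assms(3-5) by (auto simp: separates_def)
    then show ?thesis using 2 assms(1,6) unfolding equiv_def by (metis symD transD)
  qed
qed (use joined_subset[OF assms(2)] in blast)

text \<open>At one end of the edge the two legs lie on a common circle, and no circle there crosses
  \<open>B\<close>.\<close>

lemma edge_same_side:
  assumes c: "cube K s" and l: "l \<in> K" "v \<subseteq> K" "l \<notin> v"
    and sep: "separates B (s v)" "separates B (s (insert l v))"
  shows "p l \<in> B \<longleftrightarrow> q l \<in> B"
proof -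
  have "(p l, q l) \<in> s v \<or> (p l, q l) \<in> s (insert l v)"
    using cubeD(5)[OF c l] joined_mem cubeD(2)[OF c, of v] cubeD(2)[OF c, of "insert l v"]
      cubeD(3,4)[OF c l(1)] l by blast
  then show ?thesis using sep by (auto simp: separates_def)
qed

lemma edge_cong: "((p l, q l) \<in> \<rho> \<longleftrightarrow> (p l, q l) \<in> \<rho>') \<Longrightarrow> edge \<rho> l f = edge \<rho>' l f"
  by (simp add: edge_def)

text \<open>Chosen so that \<open>flip B\<close> intertwines the differential of the disconnected
  face with the twisted one of the opposite face.\<close>

definition twist :: "'a set \<Rightarrow> (nat set \<Rightarrow> 'a rel) \<Rightarrow> (nat set \<Rightarrow> nat \<Rightarrow> 'f::field) \<Rightarrow> nat set \<Rightarrow> nat \<Rightarrow> 'f" where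
  "twist B s e v l = e v l * edge_sign B (s v) l"

end

section \<open>A crossing with a disconnected smoothing\<close>

text \<open>\<open>s\<close> is the disconnected face and \<open>t\<close> the opposite one,
  regardless of which of them is the 0-smoothing. \<open>K\<close> is instantiated with the
  crossings other than \<open>k\<close>.\<close>

locale disconnected_face = cube_of_circles +
  fixes K :: "nat set" and s t :: "nat set \<Rightarrow> 'a rel" and B :: "'a set" and k :: nat
  assumes cube_s: "cube K s" and finite_B: "finite B" and p_B: "p k \<notin> B" and q_B: "q k \<in> B"
    and separates_s: "v \<subseteq> K \<Longrightarrow> separates B (s v)"
    and joined_st: "v \<subseteq> K \<Longrightarrow> joined k (s v) (t v)"
    and pq_E: "p k \<in> E" "q k \<in> E"
begin

text \<open>The edge at \<open>l\<close> has the same kind in both faces, and its two legs lie on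
  the same side of \<open>B\<close>, so \<open>flip B\<close> passes it at the cost of
  \<open>edge_sign\<close>, which \<open>twist\<close> compensates.\<close>

lemma edge_flip_cross:
  fixes f :: "'a set \<Rightarrow> 'c::field"
  assumes "l \<in> K" "v \<subseteq> K" "l \<notin> v"
  shows "scale (twist B s e v l) (edge (t v) l (flip B f)) = scale (e v l) (flip B (edge (s v) l f))"
    and "scale (twist B s e v l) (flip B (edge (t v) l f)) = scale (e v l) (edge (s v) l (flip B f))"
proof -
  have side: "p l \<in> B \<longleftrightarrow> q l \<in> B"
    using edge_same_side[OF cube_s assms] separates_s[of v] separates_s[of "insert l v"] assms by auto
  then have edge_t: "edge (t v) l g = edge (s v) l g" for g :: "'a set \<Rightarrow> 'c::field"
    using joined_same_side[OF cubeD(2)[OF cube_s] joined_st separates_s p_B q_B] assms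
    by (intro edge_cong) auto
  have "twist B s e v l * edge_sign B (s v) l = e v l"
    by (simp add: twist_def mult.assoc edge_sign_square)
  then show "scale (twist B s e v l) (edge (t v) l (flip B f)) = scale (e v l) (flip B (edge (s v) l f))"
    by (simp only: edge_t) (simp add: edge_flip[OF finite_B side] scale_scale)
  show "scale (twist B s e v l) (flip B (edge (t v) l f)) = scale (e v l) (edge (s v) l (flip B f))"
    by (simp only: edge_t) (simp add: edge_flip[OF finite_B side] scale_scale twist_def)
qed

lemma twist_nonzero: "e v l \<noteq> 0 \<Longrightarrow> twist B s e v l \<noteq> 0"
  by (simp add: twist_def edge_sign_nonzero)

lemma contract_pq_t: "v \<subseteq> K \<Longrightarrow> f \<in> U (t v) \<Longrightarrow> contract (p k) f = contract (q k) f"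
  using U_contract_eq joined_mem[OF joined_st cubeD(2)[OF cube_s]] pq_E by blast

lemma U_t_subset: "v \<subseteq> K \<Longrightarrow> f \<in> U (t v) \<Longrightarrow> f \<in> U (s v)"
  using U_antimono[OF joined_subset[OF joined_st]] by blast

text \<open>Together with \<open>in_U_t\<close> and \<open>lift_s\<close> this gives a short exact
  sequence from \<open>U (t v)\<close> through \<open>U (s v)\<close> to \<open>U (t v)\<close>,
  with the inclusion as first map and \<open>merge_map k\<close> after \<open>flip B\<close> as
  second. Both disconnected cases rest on it.\<close>

lemma merge_map_flip_t: "v \<subseteq> K \<Longrightarrow> f \<in> U (t v) \<Longrightarrow> merge_map k (flip B f) = 0"
  by (simp add: merge_map_flip[OF finite_B p_B q_B] contract_pq_t)

lemma in_U_t: "v \<subseteq> K \<Longrightarrow> f \<in> U (s v) \<Longrightarrow> merge_map k (flip B f) = 0 \<Longrightarrow> f \<in> U (t v)"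
  by (rule U_joined[OF joined_st]) (auto simp: merge_map_flip[OF finite_B p_B q_B])

lemma flip_in_U_s: "v \<subseteq> K \<Longrightarrow> f \<in> U (s v) \<Longrightarrow> flip B f \<in> U (s v)"
  by (rule flip_in_U[OF finite_B separates_s])

lemma lift_s:
  "v \<subseteq> K \<Longrightarrow> g \<in> U (t v) \<Longrightarrow> lift (s v) (p k) g \<in> U (s v)"
  "v \<subseteq> K \<Longrightarrow> g \<in> U (t v) \<Longrightarrow> merge_map k (lift (s v) (p k) g) = g"
  using lift_correct[OF cubeD(2)[OF cube_s] joined_st pq_E] by auto

lemma diff_flip_cross:
  assumes z: "\<And>v. z v \<noteq> 0 \<Longrightarrow> v \<subseteq> K"
  shows "diff K t (twist B s e) (\<lambda>v. flip B (z v)) = (\<lambda>v. flip B (diff K s e z v))"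
    and "(\<lambda>v. flip B (diff K t (twist B s e) z v)) = diff K s e (\<lambda>v. flip B (z v))"
proof -
  have 1: "scale (twist B s e (v - {l}) l) (edge (t (v - {l})) l (flip B (z (v - {l}))))
    = scale (e (v - {l}) l) (flip B (edge (s (v - {l})) l (z (v - {l}))))"
    if "l \<in> v \<inter> K" for v l
    using edge_flip_cross(1)[of l "v - {l}"] z[of "v - {l}"] that by (cases "z (v - {l}) = 0") auto
  have 2: "scale (twist B s e (v - {l}) l) (flip B (edge (t (v - {l})) l (z (v - {l}))))
    = scale (e (v - {l}) l) (edge (s (v - {l})) l (flip B (z (v - {l}))))"
    if "l \<in> v \<inter> K" for v l
    using edge_flip_cross(2)[of l "v - {l}"] z[of "v - {l}"] that by (cases "z (v - {l}) = 0") auto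
  have d: "diff K r' e' z' v = (\<lambda>S. \<Sum>l\<in>v \<inter> K. scale (e' (v - {l}) l) (edge (r' (v - {l})) l (z' (v - {l}))) S)"
    for r' e' and z' :: "nat set \<Rightarrow> 'a set \<Rightarrow> 'b" and v
    by (simp add: diff_def fun_eq_iff)
  show "diff K t (twist B s e) (\<lambda>v. flip B (z v)) = (\<lambda>v. flip B (diff K s e z v))"
    unfolding d flip_sum flip_scale by (intro ext sum.cong refl) (simp only: 1)
  show "(\<lambda>v. flip B (diff K t (twist B s e) z v)) = diff K s e (\<lambda>v. flip B (z v))"
    unfolding d flip_sum flip_scale by (intro ext sum.cong refl) (simp only: 2)
qed

lemma merge_map_diff_commute: "(\<lambda>v. merge_map k (diff K r e z v)) = diff K r e (\<lambda>v. merge_map k (z v))"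
  for r :: "nat set \<Rightarrow> 'a rel"
proof -
  have d: "diff K r e z v = (\<lambda>S. \<Sum>l\<in>v \<inter> K. scale (e (v - {l}) l) (edge (r (v - {l})) l (z (v - {l}))) S)"
    for z :: "nat set \<Rightarrow> 'a set \<Rightarrow> 'b" and v
    by (simp add: diff_def fun_eq_iff)
  show ?thesis unfolding d merge_map_sum merge_map_scale edge_merge_map ..
qed

definition lifted :: "(nat set \<Rightarrow> 'a set \<Rightarrow> 'f::field) \<Rightarrow> nat set \<Rightarrow> 'a set \<Rightarrow> 'f" where
  "lifted z v = lift (s v) (p k) (z v)"

lemma linear_flip: "linear_operator (\<lambda>z v. flip B (z v))"
  by (rule linear_operator_pointwise) (rule flip_add flip_scale)+

lemma linear_merge_map: "linear_operator (\<lambda>z v. merge_map k (z v))"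
  by (rule linear_operator_pointwise) (rule merge_map_add merge_map_scale)+

lemma linear_lifted: "linear_operator lifted"
  unfolding lifted_def[abs_def]
  by (rule linear_operator_pointwise) (rule lift_add lift_scale)+

lemma linear_weights: "linear_operator (\<lambda>z v. scale (c v) (z v))"
  by (rule linear_operator_pointwise) (simp_all add: fun_eq_iff algebra_simps)

lemma pointwise_in_chains:
  assumes z: "z \<in> chains K r m" and "\<And>v. h v 0 = 0"
    and h: "\<And>v. v \<subseteq> K \<Longrightarrow> z v \<in> U (r v) \<Longrightarrow> h v (z v) \<in> U (r' v)"
  shows "(\<lambda>v. h v (z v)) \<in> chains K r' m"
proof (rule chainsI)
  fix v
  show "h v (z v) \<in> U (r' v)"
  proof (cases "z v = 0")
    case False
    then show ?thesis using h[of v] chainsD(1,2)[OF z] by blast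
  qed (simp add: assms(2))
  assume "h v (z v) \<noteq> 0"
  then have "z v \<noteq> 0" using assms(2)[of v] by metis
  then show "v \<subseteq> K \<and> int (card v) = m" using chainsD(2,3)[OF z] by blast
qed

lemma lifted_in_chains: "z \<in> chains K t m \<Longrightarrow> lifted z \<in> chains K s m"
  unfolding lifted_def[abs_def]
  by (rule pointwise_in_chains[where h = "\<lambda>v. lift (s v) (p k)" and r = t]) (simp_all add: lift_s)

lemma merge_map_lifted:
  assumes z: "z \<in> chains K t m"
  shows "(\<lambda>v. merge_map k (lifted z v)) = z"
proof
  fix v
  show "merge_map k (lifted z v) = z v"
  proof (cases "z v = 0")
    case False
    then show ?thesis using lift_s(2)[OF chainsD(2)[OF z False] chainsD(1)[OF z]] by (simp add: lifted_def)
  qed (simp add: lifted_def)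
qed

lemma flip_in_chains: "z \<in> chains K s m \<Longrightarrow> (\<lambda>v. flip B (z v)) \<in> chains K s m"
  by (rule pointwise_in_chains[where h = "\<lambda>v. flip B" and r = s]) (simp_all add: flip_in_U_s)

lemma chains_t_subset: "z \<in> chains K t m \<Longrightarrow> z \<in> chains K s m"
  by (rule pointwise_in_chains[where h = "\<lambda>v f. f" and r = t]) (simp_all add: U_t_subset)

lemma merge_map_flip_in_chains: "z \<in> chains K s m \<Longrightarrow> (\<lambda>v. merge_map k (flip B (z v))) \<in> chains K t m"
  by (rule pointwise_in_chains[where h = "\<lambda>v f. merge_map k (flip B f)" and r = s])
    (simp_all add: merge_map_in_U[OF joined_st] flip_in_U_s)

text \<open>\<open>flip B\<close> carries the two paths around a square of \<open>t\<close> that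
  start at \<open>g\<close> to those around the square of \<open>s\<close> that start at
  \<open>flip B g\<close>, and it is injective.\<close>

lemma anticommuting_twist:
  assumes a: "anticommuting K s e"
  shows "anticommuting K t (twist B s e)"
  unfolding anticommuting_def
proof (intro allI ballI impI)
  fix v l m and g :: "'a set \<Rightarrow> 'b"
  assume v: "v \<subseteq> K" and l: "l \<in> K - v" and m: "m \<in> K - v" and lm: "l \<noteq> m" and g: "g \<in> U (t v)"
  have *: "flip B (scale (twist B s e v l * twist B s e (insert l v) m) (edge (t (insert l v)) m (edge (t v) l g)))
    = scale (e v l * e (insert l v) m) (edge (s (insert l v)) m (edge (s v) l (flip B g)))"
    if lm': "l \<in> K - v" "m \<in> K - v" "l \<noteq> m" for l m
  proof -
    have "flip B (scale (twist B s e v l * twist B s e (insert l v) m) (edge (t (insert l v)) m (edge (t v) l g)))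
      = scale (twist B s e v l) (scale (twist B s e (insert l v) m) (flip B (edge (t (insert l v)) m (edge (t v) l g))))"
      by (simp only: flip_scale scale_scale)
    also have "scale (twist B s e (insert l v) m) (flip B (edge (t (insert l v)) m (edge (t v) l g)))
      = scale (e (insert l v) m) (edge (s (insert l v)) m (flip B (edge (t v) l g)))"
      using edge_flip_cross(2)[of m "insert l v"] v lm' by auto
    also have "scale (twist B s e v l) \<dots>
      = scale (e (insert l v) m) (edge (s (insert l v)) m (scale (twist B s e v l) (flip B (edge (t v) l g))))"
      by (simp only: edge_scale scale_scale mult.commute)
    also have "scale (twist B s e v l) (flip B (edge (t v) l g)) = scale (e v l) (edge (s v) l (flip B g))"
      using edge_flip_cross(2)[of l v] v lm' by auto
    finally show ?thesis by (simp only: edge_scale scale_scale mult.commute)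
  qed
  have "flip B (scale (twist B s e v l * twist B s e (insert l v) m) (edge (t (insert l v)) m (edge (t v) l g))
    + scale (twist B s e v m * twist B s e (insert m v) l) (edge (t (insert m v)) l (edge (t v) m g))) = 0"
    using anticommutingD[OF a v l m lm flip_in_U_s[OF v U_t_subset[OF v g]]] l m lm
    by (simp only: flip_add * not_False_eq_True)
  then show "scale (twist B s e v l * twist B s e (insert l v) m) (edge (t (insert l v)) m (edge (t v) l g))
    + scale (twist B s e v m * twist B s e (insert m v) l) (edge (t (insert m v)) l (edge (t v) m g)) = 0"
    by (simp only: flip_eq_zero_iff)
qed

end

context cube_of_circles
begin

lemma diff_in_chains_pred:
  assumes "cube K r" "z \<in> chains K r (m - 1)"
  shows "diff K r e z \<in> chains K r m"
  using diff_in_chains[OF assms] by simp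

text \<open>Here \<open>connecting\<close> is, up to nonzero scalars, the inclusion of the lower
  face into the upper one. Its cokernel is identified by \<open>P\<close> with the lower face under
  twisted signs, so the cone has the homology of that complex in degree
  \<open>m - 1\<close>.\<close>

lemma homology_bound_upper_disconnected:
  fixes e :: "nat set \<Rightarrow> nat \<Rightarrow> 'f::field"
  assumes c: "cube K r" and a: "anticommuting K r e" and nz: "\<And>v l. e v l \<noteq> 0" and k: "k \<in> K"
    and face: "disconnected_face E p q (K - {k}) (upper k r) r B k"
    and b: "homology_bound (K - {k}) r (twist B (upper k r) (upper k e)) (m - 1) N"
  shows "homology_bound K r e m N"
proof -
  interpret disconnected_face E p q "K - {k}" "upper k r" r B k by (rule face)
  let ?K = "K - {k}"
  let ?d0 = "diff ?K r e" and ?d1 = "diff ?K (upper k r) (upper k e)"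
    and ?d' = "diff ?K r (twist B (upper k r) (upper k e))"
  note fin = cubeD(1)[OF c]
  obtain \<phi> h where lin: "\<And>i. linear_functional (\<phi> i)" "linear_operator h"
    and h: "\<And>z. z \<in> chains ?K r (m - 1) \<Longrightarrow> ?d' z = 0 \<Longrightarrow> \<forall>i<N. \<phi> i z = 0
      \<Longrightarrow> h z \<in> chains ?K r (m - 1 - 1) \<and> ?d' (h z) = z"
    by (rule homology_boundE[OF b]) (rule that)
  define P where "P x v = merge_map k (flip B (x v))" for x :: "nat set \<Rightarrow> 'a set \<Rightarrow> 'f" and v
  have linP: "linear_operator P"
    unfolding P_def[abs_def] by (intro linear_operator_comp[OF linear_merge_map linear_flip])
  \<comment> \<open>A preimage under \<open>P\<close> of the primitive of
    \<open>P (part1 k z)\<close>. After subtracting its boundary, what remains of the upper part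
    lies in the kernel of \<open>P\<close>, hence in the image of \<open>connecting\<close>.\<close>
  let ?w = "\<lambda>z v. flip B (lifted (h (P (part1 k z))) v)"
  have linw: "linear_operator ?w"
    by (intro linear_operator_comp[OF linear_flip] linear_operator_comp[OF linear_lifted]
        linear_operator_comp[OF lin(2)] linear_operator_comp[OF linP] linear_part1)
  let ?u = "\<lambda>z. part1 k z - ?d1 (?w z)"
  let ?y = "\<lambda>z v. scale (inverse (e v k)) (?u z v)"
  have liny: "linear_operator ?y"
    by (intro linear_operator_comp[OF linear_weights] linear_operator_diff linear_part1
        linear_operator_comp[OF linear_diff] linw)
  have connecting: "connecting k r e z v = scale (e v k) (z v)" if "z \<in> chains ?K r m'" for z v m'
  proof (cases "z v = 0")
    case False
    then have v: "v \<subseteq> ?K" by (rule chainsD(2)[OF that])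
    then have "(p k, q k) \<in> r v"
      using joined_mem[OF joined_st cubeD(2)[OF cube_s] pq_E] by blast
    then show ?thesis using v by (auto simp: connecting_def edge_def)
  qed (auto simp: connecting_def)
  have P_diff: "P (?d1 z) = ?d' (P z)" if "z \<in> chains ?K (upper k r) m'" for z m'
    using diff_flip_cross(1)[of z "upper k e"] chainsD(2)[OF that]
    by (simp add: P_def[abs_def] merge_map_diff_commute[symmetric])
  have P_conn: "P (connecting k r e z) = 0" if z: "z \<in> chains ?K r m'" for z m'
  proof
    fix v
    show "P (connecting k r e z) v = 0 v"
    proof (cases "z v = 0")
      case False
      then have "merge_map k (flip B (z v)) = 0" using merge_map_flip_t chainsD(1,2)[OF z] by blast
      then show ?thesis by (simp add: P_def connecting[OF z] flip_scale merge_map_scale)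
    qed (simp add: P_def connecting[OF z])
  qed
  show ?thesis
  proof (rule homology_boundI)
    show "linear_functional (\<lambda>z. \<phi> i (P (part1 k z)))" for i
      by (intro linear_functional_comp[OF lin(1)] linear_operator_comp[OF linP] linear_part1)
    show "linear_operator (\<lambda>z. glue k (?y z) (?w z))"
      by (intro linear_glue liny linw)
    fix z assume z: "z \<in> chains K r m" and dz: "diff K r e z = 0"
      and \<phi>: "\<forall>i<N. \<phi> i (P (part1 k z)) = 0"
    have z0: "part0 k z \<in> chains ?K r m" by (rule part0_in_chains[OF z])
    have z1: "part1 k z \<in> chains ?K (upper k r) (m - 1)" by (rule part1_in_chains[OF z fin k])
    note dz' = diff_parts[OF c k dz]
    have Pz: "P (part1 k z) \<in> chains ?K r (m - 1)"
      unfolding P_def[abs_def] by (rule merge_map_flip_in_chains[OF z1])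
    have "P (connecting k r e (part0 k z) + ?d1 (part1 k z)) = 0"
      unfolding dz'(2) by (rule linear_operator_zero[OF linP])
    then have "?d' (P (part1 k z)) = 0"
      by (simp add: linear_operator_plus[OF linP] P_conn[OF z0] P_diff[OF z1])
    with h[OF Pz] \<phi> have hz: "h (P (part1 k z)) \<in> chains ?K r (m - 1 - 1)"
      and dhz: "?d' (h (P (part1 k z))) = P (part1 k z)" by auto
    have w: "?w z \<in> chains ?K (upper k r) (m - 1 - 1)"
      by (rule flip_in_chains[OF lifted_in_chains[OF hz]])
    have Pw: "P (?w z) = h (P (part1 k z))"
    proof
      fix v
      show "P (?w z) v = h (P (part1 k z)) v"
        unfolding P_def[of "?w z"] flip_flip by (rule fun_cong[OF merge_map_lifted[OF hz]])
    qed
    have u: "?u z \<in> chains ?K (upper k r) (m - 1)"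
      by (rule chains_diff[OF z1 diff_in_chains_pred[OF cube_s w]])
    have "P (?u z) = 0"
      by (simp add: linear_operator_minus[OF linP] P_diff[OF w] Pw dhz)
    then have "merge_map k (flip B (?u z v)) = 0" for v
      by (simp add: P_def fun_eq_iff)
    then have u_r: "?u z v \<in> U (r v)" for v
      using in_U_t[OF _ chainsD(1)[OF u]] chainsD(2)[OF u, of v] by (cases "?u z v = 0") auto
    have y: "?y z \<in> chains ?K r (m - 1)"
    proof (rule chainsI)
      fix v
      show "?y z v \<in> U (r v)" by (rule U_scale[OF u_r])
      assume "?y z v \<noteq> 0"
      then have "?u z v \<noteq> 0" by (metis scale_zero)
      then show "v \<subseteq> ?K \<and> int (card v) = m - 1" using chainsD(2,3)[OF u] by blast
    qed
    have connecting_y: "connecting k r e (?y z) = ?u z"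
      by (rule ext) (simp only: connecting[OF y] scale_scale right_inverse[OF nz] scale_one)
    \<comment> \<open>By the choice of \<open>?y z\<close>, the upper part of the boundary of the
      glued chain is \<open>part1 k z\<close>. That \<open>?y z\<close> also bounds the lower part
      of \<open>z\<close> then follows from the injectivity of \<open>connecting\<close>.\<close>
    have "connecting k r e (?d0 (?y z)) + ?d1 (part1 k z) = 0"
      using diff_glue_diff[OF c a k y w] unfolding connecting_y by simp
    from add_right_imp_eq[OF trans[OF this dz'(2)[symmetric]]]
    have "connecting k r e (?d0 (?y z)) = connecting k r e (part0 k z)" .
    from fun_cong[OF this]
    have "scale (e v k) (?d0 (?y z) v) = scale (e v k) (part0 k z v)" for v
      unfolding connecting[OF diff_in_chains[OF cube_lower[OF c] y]] connecting[OF z0] .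
    then have dy: "?d0 (?y z) = part0 k z"
      by (simp add: fun_eq_iff nz)
    have "diff K r e (glue k (?y z) (?w z)) = z"
      by (rule parts_eqI[where k = k]) (simp_all only: diff_glue[OF c k y w] dy connecting_y diff_add_cancel)
    then show "glue k (?y z) (?w z) \<in> chains K r (m - 1) \<and> diff K r e (glue k (?y z) (?w z)) = z"
      using glue_in_chains[OF y w fin k] by blast
  qed
qed

text \<open>Here \<open>connecting\<close> is, up to nonzero scalars, a merge at every vertex, hence
  onto by \<open>lift\<close>. Its kernel is the image under \<open>flip B\<close> of the upper
  chain groups, so the cone has the homology of the upper face with twisted signs in degree
  \<open>m\<close>.\<close>

lemma homology_bound_lower_disconnected:
  fixes e :: "nat set \<Rightarrow> nat \<Rightarrow> 'f::field"
  assumes c: "cube K r" and a: "anticommuting K r e" and nz: "\<And>v l. e v l \<noteq> 0" and k: "k \<in> K"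
    and face: "disconnected_face E p q (K - {k}) r (upper k r) B k"
    and b: "homology_bound (K - {k}) (upper k r) (twist B r e) m N"
  shows "homology_bound K r e m N"
proof -
  interpret disconnected_face E p q "K - {k}" r "upper k r" B k by (rule face)
  let ?K = "K - {k}"
  let ?d0 = "diff ?K r e" and ?d1 = "diff ?K (upper k r) (upper k e)"
    and ?d' = "diff ?K (upper k r) (twist B r e)"
  note fin = cubeD(1)[OF c]
  obtain \<phi> h where lin: "\<And>i. linear_functional (\<phi> i)" "linear_operator h"
    and h: "\<And>z. z \<in> chains ?K (upper k r) m \<Longrightarrow> ?d' z = 0 \<Longrightarrow> \<forall>i<N. \<phi> i z = 0
      \<Longrightarrow> h z \<in> chains ?K (upper k r) (m - 1) \<and> ?d' (h z) = z"
    by (rule homology_boundE[OF b]) (rule that)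
  define F where "F x v = flip B (x v)" for x :: "nat set \<Rightarrow> 'a set \<Rightarrow> 'f" and v
  have linF: "linear_operator F"
    unfolding F_def[abs_def] by (rule linear_flip)
  have FF: "F (F x) = x" for x by (simp add: F_def[abs_def])
  have F_zero: "F x = 0 \<longleftrightarrow> x = 0" for x
    by (metis FF linear_operator_zero[OF linF])
  have F_diff: "F (?d' x) = ?d0 (F x)" if "x \<in> chains ?K (upper k r) m'" for x m'
    using diff_flip_cross(2)[of x e] chainsD(2)[OF that] unfolding F_def[abs_def] by blast
  \<comment> \<open>A preimage of the upper part under \<open>connecting\<close>; subtracting its
    boundary from the lower part leaves a cycle in the kernel.\<close>
  let ?y = "\<lambda>z v. scale (inverse (e v k)) (lifted (part1 k z) v)"
  have liny: "linear_operator ?y"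
    by (intro linear_operator_comp[OF linear_weights] linear_operator_comp[OF linear_lifted] linear_part1)
  let ?u = "\<lambda>z. part0 k z - ?d0 (?y z)"
  have linu: "linear_operator (\<lambda>z. F (?u z))"
    by (intro linear_operator_comp[OF linF] linear_operator_diff linear_part0
        linear_operator_comp[OF linear_diff] liny)
  have connecting: "connecting k r e z v = scale (e v k) (merge_map k (z v))" if "z \<in> chains ?K r m'" for z v m'
  proof (cases "z v = 0")
    case False
    then have v: "v \<subseteq> ?K" by (rule chainsD(2)[OF that])
    then have "(p k, q k) \<notin> r v" using joined_st by (auto simp: joined_def)
    then show ?thesis using v by (auto simp: connecting_def edge_def)
  qed (auto simp: connecting_def)
  show ?thesis
  proof (rule homology_boundI)
    show "linear_functional (\<lambda>z. \<phi> i (F (?u z)))" for i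
      by (intro linear_functional_comp[OF lin(1) linu])
    show "linear_operator (\<lambda>z. glue k (?y z + F (h (F (?u z)))) 0)"
      by (intro linear_glue linear_operator_add liny linear_operator_comp[OF linF]
          linear_operator_comp[OF lin(2) linu]) (simp add: linear_operator_def fun_eq_iff)
    fix z assume z: "z \<in> chains K r m" and dz: "diff K r e z = 0"
      and \<phi>: "\<forall>i<N. \<phi> i (F (?u z)) = 0"
    have z0: "part0 k z \<in> chains ?K r m" by (rule part0_in_chains[OF z])
    have z1: "part1 k z \<in> chains ?K (upper k r) (m - 1)" by (rule part1_in_chains[OF z fin k])
    note dz' = diff_parts[OF c k dz]
    have y: "?y z \<in> chains ?K r (m - 1)"
      by (rule pointwise_in_chains[OF lifted_in_chains[OF z1], where h = "\<lambda>v. scale (inverse (e v k))"])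
        (simp_all add: U_scale)
    have connecting_y: "connecting k r e (?y z) = part1 k z"
      by (rule ext) (simp only: connecting[OF y] merge_map_scale scale_scale right_inverse[OF nz] scale_one
          fun_cong[OF merge_map_lifted[OF z1]])
    have du: "?d0 (?u z) = 0"
      using diff_diff[OF cube_lower[OF c] anticommuting_lower[OF a] y] dz'(1)
      by (simp add: linear_operator_minus[OF linear_diff])
    have "connecting k r e (?d0 (?y z)) + ?d1 (part1 k z) = 0"
      using diff_glue_diff[OF c a k y chains_zero]
      by (simp only: linear_operator_zero[OF linear_diff] add_0_right connecting_y)
    from add_right_imp_eq[OF trans[OF this dz'(2)[symmetric]]]
    have "connecting k r e (?u z) = 0" by (simp only: linear_operator_minus[OF linear_connecting] diff_self)
    moreover have u: "?u z \<in> chains ?K r m"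
      by (rule chains_diff[OF z0 diff_in_chains_pred[OF cube_lower[OF c] y]])
    ultimately have merge_map_u: "merge_map k (?u z v) = 0" for v
      using connecting[OF u, of v] nz[of v k] by (simp add: fun_eq_iff)
    have Fu: "F (?u z) \<in> chains ?K (upper k r) m"
    proof (rule chainsI)
      fix v
      have v: "v \<subseteq> ?K \<and> int (card v) = m" if "F (?u z) v \<noteq> 0"
      proof -
        have "?u z v \<noteq> 0" using that unfolding F_def by (metis flip_zero)
        then show ?thesis using chainsD(2,3)[OF u] by blast
      qed
      then show "F (?u z) v \<noteq> 0 \<Longrightarrow> v \<subseteq> ?K \<and> int (card v) = m" .
      show "F (?u z) v \<in> U (r (insert k v))"
      proof (cases "F (?u z) v = 0")
        case False
        then have vK: "v \<subseteq> ?K" using v by blast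
        have "merge_map k (flip B (F (?u z) v)) = 0" unfolding F_def flip_flip by (rule merge_map_u)
        then show ?thesis
          using in_U_t[OF vK] flip_in_U_s[OF vK chainsD(1)[OF u]] unfolding F_def by blast
      qed simp
    qed
    have "F (?d' (F (?u z))) = 0"
      using F_diff[OF Fu] by (simp only: FF du)
    then have "?d' (F (?u z)) = 0" by (simp only: F_zero)
    with h[OF Fu] \<phi> have hu: "h (F (?u z)) \<in> chains ?K (upper k r) (m - 1)"
      and dhu: "?d' (h (F (?u z))) = F (?u z)" by blast+
    have x: "F (h (F (?u z))) \<in> chains ?K r (m - 1)"
      unfolding F_def[abs_def] by (rule flip_in_chains[OF chains_t_subset[OF hu[unfolded F_def[abs_def]]]])
    have dx: "?d0 (F (h (F (?u z)))) = ?u z"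
      unfolding F_diff[OF hu, symmetric] dhu by (rule FF)
    have connecting_x: "connecting k r e (F (h (F (?u z)))) = 0"
    proof
      fix v
      have "merge_map k (F (h (F (?u z))) v) = 0"
      proof (cases "h (F (?u z)) v = 0")
        case False
        then show ?thesis
          unfolding F_def[of "h _"] using merge_map_flip_t chainsD(1,2)[OF hu] by blast
      qed (simp add: F_def[of "h _"])
      then show "connecting k r e (F (h (F (?u z)))) v = 0 v" by (simp add: connecting[OF x])
    qed
    note yx = chains_add[OF y x]
    have "diff K r e (glue k (?y z + F (h (F (?u z)))) 0) = z"
      by (rule parts_eqI[where k = k])
        (simp_all only: diff_glue[OF c k yx chains_zero] linear_operator_plus[OF linear_diff] dx
          linear_operator_plus[OF linear_connecting] connecting_x connecting_y linear_operator_zero[OF linear_diff]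
          add_0_left add_0_right add_diff_eq add_diff_cancel_left')
    then show "glue k (?y z + F (h (F (?u z)))) 0 \<in> chains K r (m - 1) \<and>
       diff K r e (glue k (?y z + F (h (F (?u z)))) 0) = z"
      using glue_in_chains[OF yx chains_zero fin k] by blast
  qed
qed

text \<open>The factor 2 comes from here: without crossings a connected diagram has at most one
  circle, and a function in \<open>U\<close> is then determined by its values at the empty set and
  at one singleton.\<close>

lemma homology_bound_empty:
  fixes e :: "nat set \<Rightarrow> nat \<Rightarrow> 'f::field"
  assumes con: "connected_cube {} r" and eq: "equiv E (r {})"
  shows "homology_bound {} r e m (2 * int_binomial 0 m)"
proof -
  \<comment> \<open>If \<open>E\<close> is empty, \<open>a\<close> is arbitrary; every chain is then
    supported on the empty set alone.\<close>
  obtain a where a: "E \<noteq> {} \<Longrightarrow> a \<in> E" by blast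
  have rel: "(x, y) \<in> r {}" if "x \<in> E" "y \<in> E" for x y
  proof -
    have "(x, y) \<in> (r {})\<^sup>*" using con that by (auto simp: connected_cube_def)
    then have "x = y \<or> (x, y) \<in> (r {})\<^sup>+" by (auto simp: rtrancl_eq_or_trancl)
    moreover have "(r {})\<^sup>+ = r {}" using eq by (simp add: equiv_def trancl_id)
    ultimately show ?thesis
      using eq that by (auto simp: equiv_def refl_on_def)
  qed
  show ?thesis
  proof (rule homology_boundI)
    show "linear_functional (\<lambda>z. z {} (if i = 0 then {} else {a}))" for i :: nat
      by (simp add: linear_functional_def)
    show "linear_operator (\<lambda>z. 0)" by (simp add: linear_operator_def fun_eq_iff)
    fix z :: "nat set \<Rightarrow> 'a set \<Rightarrow> 'f"
    assume z: "z \<in> chains {} r m"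
      and zero: "\<forall>i<2 * int_binomial 0 m. z {} (if i = 0 then {} else {a}) = 0"
    have "z v S = 0" for v S
    proof (rule ccontr)
      assume nz: "z v S \<noteq> 0"
      then have "z v \<noteq> 0" by auto
      then have v: "v = {}" "m = 0" using chainsD(2,3)[OF z, of v] by auto
      then have "int_binomial 0 m = 1" by (simp add: int_binomial_def)
      then have *: "z {} {} = 0" "z {} {a} = 0"
        using zero[rule_format, of 0] zero[rule_format, of 1] by simp_all
      have U: "z {} \<in> U (r {})" by (rule chainsD(1)[OF z])
      have S: "S \<subseteq> E" using U_support[OF U] nz v by blast
      consider "S = {}" | x where "S = {x}" | x y where "x \<in> S" "y \<in> S" "x \<noteq> y"
        by blast
      then show False
      proof cases
        case 1
        then show ?thesis using nz v * by simp
      next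
        case 2
        then have "x \<in> E" "a \<in> E" using S a by auto
        from U_contract_eq[OF U rel[OF this]] have "contract x (z {}) {} = contract a (z {}) {}"
          by simp
        then show ?thesis using nz v * 2 by (simp add: contract_def)
      next
        case 3
        then have "z {} S = 0" using U_meets_twice[OF U rel, of x y S] S by blast
        then show ?thesis using nz v by simp
      qed
    qed
    then have "z = 0" by (simp add: fun_eq_iff)
    then show "0 \<in> chains {} r (m - 1) \<and> diff {} r e 0 = z"
      by (simp add: linear_operator_zero[OF linear_diff])
  qed
qed

text \<open>The induction generalizes over \<open>r\<close> and \<open>e\<close>, since passing to a
  face changes the relations and passing to a connected face opposite to a disconnected one also
  twists the scalars. In the two disconnected cases a single summand of Pascal's rule is used and
  the other one is given away.\<close>

theorem homology_bound_connected:
  fixes e :: "nat set \<Rightarrow> nat \<Rightarrow> 'f::field"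
  assumes "cube K r" "anticommuting K r e" "\<And>v l. e v l \<noteq> 0" "connected_cube K r"
  shows "homology_bound K r e m (2 * int_binomial (int (card K)) m)"
  using assms
proof (induction "card K" arbitrary: K r e m)
  case 0
  then have "K = {}" using cubeD(1) by fastforce
  then show ?case using homology_bound_empty 0(5) cubeD(2)[OF 0(2)] by simp
next
  case (Suc n)
  note c = Suc.prems(1) and a = Suc.prems(2) and nz = Suc.prems(3) and con = Suc.prems(4)
  obtain k where k: "k \<in> K" using Suc.hyps(2) by fastforce
  have n: "n = card (K - {k})" using Suc.hyps(2) k by simp
  have card: "int (card K) = int (card (K - {k})) + 1" using Suc.hyps(2) n by simp
  note c0 = cube_lower[OF c, of k] and c1 = cube_upper[OF c k]
  note bin = int_binomial_Suc[of "card (K - {k})" m, folded card]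
  have pq: "p k \<in> E" "q k \<in> E" using cubeD(3,4)[OF c k] .
  consider "connected_cube (K - {k}) r" "connected_cube (K - {k}) (upper k r)"
    | "\<not> connected_cube (K - {k}) r" | "\<not> connected_cube (K - {k}) (upper k r)" by blast
  then show ?case
  proof cases
    case 1
    have "homology_bound (K - {k}) r e m (2 * int_binomial (int (card (K - {k}))) m)"
      by (rule Suc.hyps(1)[OF n c0 anticommuting_lower[OF a] nz 1(1)])
    moreover have "homology_bound (K - {k}) (upper k r) (upper k e) (m - 1)
        (2 * int_binomial (int (card (K - {k}))) (m - 1))"
      by (rule Suc.hyps(1)[OF n c1 anticommuting_upper[OF a k] nz 1(2)])
    ultimately show ?thesis
      unfolding bin distrib_left by (rule homology_bound_cone[OF c a k])
  next
    case 2
    obtain B where B: "finite B" "p k \<notin> B" "q k \<in> B"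
      "\<And>v. v \<subseteq> K - {k} \<Longrightarrow> separates B (r v)"
      "\<And>v. v \<subseteq> K - {k} \<Longrightarrow> joined k (r v) (upper k r v)"
      and con': "connected_cube (K - {k}) (upper k r)"
      by (rule disconnected_face[OF c con k disjI1[OF conjI[OF refl refl]] 2]) (rule that)
    interpret f: disconnected_face E p q "K - {k}" r "upper k r" B k
      by unfold_locales (fact c0 B pq)+
    have "homology_bound (K - {k}) (upper k r) (twist B r e) m (2 * int_binomial (int (card (K - {k}))) m)"
      by (rule Suc.hyps(1)[OF n c1 f.anticommuting_twist[OF anticommuting_lower[OF a]] _ con'])
        (rule f.twist_nonzero[OF nz])
    from homology_bound_lower_disconnected[OF c a nz k f.disconnected_face_axioms this]
    show ?thesis by (rule homology_bound_mono) (simp add: bin)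
  next
    case 3
    obtain B where B: "finite B" "p k \<notin> B" "q k \<in> B"
      "\<And>v. v \<subseteq> K - {k} \<Longrightarrow> separates B (upper k r v)"
      "\<And>v. v \<subseteq> K - {k} \<Longrightarrow> joined k (upper k r v) (r v)"
      and con': "connected_cube (K - {k}) r"
      by (rule disconnected_face[OF c con k disjI2[OF conjI[OF refl refl]] 3]) (rule that)
    interpret f: disconnected_face E p q "K - {k}" "upper k r" r B k
      by unfold_locales (fact c1 B pq)+
    have "homology_bound (K - {k}) r (twist B (upper k r) (upper k e)) (m - 1)
        (2 * int_binomial (int (card (K - {k}))) (m - 1))"
      by (rule Suc.hyps(1)[OF n c0 f.anticommuting_twist[OF anticommuting_upper[OF a k]] _ con'])
        (rule f.twist_nonzero[OF nz])
    from homology_bound_upper_disconnected[OF c a nz k f.disconnected_face_axioms this]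
    show ?thesis by (rule homology_bound_mono) (simp add: bin)
  qed
qed

section \<open>Circle counts and commuting squares\<close>

lemma joined_classes:
  assumes eq: "equiv E \<rho>" and j: "joined k \<rho> \<rho>'"
  shows "\<rho>' `` {x} = (if x \<in> \<rho> `` {p k, q k} then \<rho> `` {p k, q k} else \<rho> `` {x})"
proof -
  have "\<rho>' `` {x} = \<rho> `` {x} \<union> (if x \<in> \<rho> `` {p k, q k} then \<rho> `` {p k, q k} else {})"
    using j unfolding joined_def by auto
  moreover have "\<rho> `` {x} \<subseteq> \<rho> `` {p k, q k}" if "x \<in> \<rho> `` {p k, q k}"
    using that eq by (auto simp: equiv_def elim: transE)
  ultimately show ?thesis by auto
qed

text \<open>Supplies the set differences in the form in which \<open>edge_term\<close> recognizes a
  merge or, read backwards, a split.\<close>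

lemma joined_quotient:
  assumes eq: "equiv E \<rho>" and j: "joined k \<rho> \<rho>'" and pq: "p k \<in> E" "q k \<in> E"
  defines "A \<equiv> \<rho> `` {p k}" and "C \<equiv> \<rho> `` {q k}"
  shows "A \<noteq> C" "E // \<rho> - E // \<rho>' = {A, C}" "E // \<rho>' - E // \<rho> = {A \<union> C}"
    "p k \<in> A" "q k \<in> C"
proof -
  have AC: "A \<in> E // \<rho>" "C \<in> E // \<rho>" using pq by (auto simp: A_def C_def intro: quotientI)
  show pA: "p k \<in> A" and qC: "q k \<in> C" using pq eq by (auto simp: A_def C_def equiv_def refl_on_def)
  have qA: "q k \<notin> A" using j by (simp add: A_def joined_def)
  show "A \<noteq> C" using qA qC by auto
  have disj: "A \<inter> C = {}" using quotient_disj[OF eq AC] \<open>A \<noteq> C\<close> by blast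
  have AuC: "\<rho> `` {p k, q k} = A \<union> C" by (auto simp: A_def C_def)
  have AuCE: "A \<union> C \<subseteq> E" using eq by (auto simp: A_def C_def equiv_def)
  let ?R = "(\<lambda>x. \<rho> `` {x}) ` (E - (A \<union> C))"
  have img: "E // \<sigma> = (\<lambda>x. \<sigma> `` {x}) ` (A \<union> C) \<union> (\<lambda>x. \<sigma> `` {x}) ` (E - (A \<union> C))" for \<sigma>
    using AuCE unfolding quotient_def by blast
  have "\<rho>' `` {x} = A \<union> C" if "x \<in> A \<union> C" for x
    using that by (simp only: joined_classes[OF eq j] AuC if_True)
  then have "(\<lambda>x. \<rho>' `` {x}) ` (A \<union> C) = {A \<union> C}" using pA by auto
  moreover have "(\<lambda>x. \<rho>' `` {x}) ` (E - (A \<union> C)) = ?R"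
    by (intro image_cong refl) (simp add: joined_classes[OF eq j] AuC)
  ultimately have E': "E // \<rho>' = insert (A \<union> C) ?R" by (simp add: img)
  have "\<rho> `` {x} = A" if "x \<in> A" for x
    using that unfolding A_def by (intro equiv_class_eq[OF eq, symmetric]) simp
  moreover have "\<rho> `` {x} = C" if "x \<in> C" for x
    using that unfolding C_def by (intro equiv_class_eq[OF eq, symmetric]) simp
  ultimately have "(\<lambda>x. \<rho> `` {x}) ` (A \<union> C) = {A, C}" using pA qC by (auto simp: image_Un)
  then have E0: "E // \<rho> = insert A (insert C ?R)" by (simp add: img)
  have "X \<inter> (A \<union> C) = {}" if XR: "X \<in> ?R" for X
  proof -
    obtain x where x: "x \<in> E" "x \<notin> A" "x \<notin> C" "X = \<rho> `` {x}"
      using XR by blast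
    then have "X \<in> E // \<rho>" "x \<in> X" using eq by (auto simp: quotientI equiv_def refl_on_def)
    then show ?thesis
      using quotient_disj[OF eq _ AC(1), of X] quotient_disj[OF eq _ AC(2), of X] x(2,3) by blast
  qed
  then have "A \<notin> ?R" "C \<notin> ?R" "A \<union> C \<notin> ?R" using pA qC by blast+
  moreover have "A \<noteq> A \<union> C" "C \<noteq> A \<union> C" using pA qC disj by blast+
  moreover have "insert A (insert C R) - insert D R = {A, C}" "insert D R - insert A (insert C R) = {D}"
    if "A \<notin> R" "C \<notin> R" "D \<notin> R" "A \<noteq> D" "C \<noteq> D" for R D
    using that by auto
  ultimately show "E // \<rho> - E // \<rho>' = {A, C}" "E // \<rho>' - E // \<rho> = {A \<union> C}"
    unfolding E' E0 by metis+
qed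

lemma joined_card:
  assumes "equiv E \<rho>" "equiv E \<rho>'" "joined k \<rho> \<rho>'" "p k \<in> E" "q k \<in> E"
  shows "card (E // \<rho>) = card (E // \<rho>') + 1"
proof -
  note Q = joined_quotient[OF assms(1,3,4,5)]
  have fin: "finite (E // \<rho>)" "finite (E // \<rho>')"
    using assms(1,2) finite_E by (auto simp: equiv_def intro!: finite_quotient)
  have "card (E // \<rho>) = card (E // \<rho> \<inter> E // \<rho>') + card (E // \<rho> - E // \<rho>')"
    using fin by (metis card_Int_Diff)
  moreover have "card (E // \<rho>') = card (E // \<rho> \<inter> E // \<rho>') + card (E // \<rho>' - E // \<rho>)"
    using fin by (metis card_Int_Diff inf.commute)
  ultimately show ?thesis using Q by simp
qed

text \<open>The number of circles at the last corner does not depend on the path, so both paths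
  contain equally many splits. This leaves the squares where each crossing keeps its kind, for which
  the merge maps commute, and two exceptional kinds.\<close>

lemma edges_commute:
  assumes c: "cube K r" and v: "v \<subseteq> K" and k: "k \<in> K - v" and l: "l \<in> K - v" and kl: "k \<noteq> l"
    and f: "f \<in> U (r v)"
  shows "edge (r (insert k v)) l (edge (r v) k f) = edge (r (insert l v)) k (edge (r v) l f)"
proof -
  let ?vk = "insert k v" and ?vl = "insert l v" and ?vkl = "insert l (insert k v)"
  have sub: "?vk \<subseteq> K" "?vl \<subseteq> K" "?vkl \<subseteq> K" using v k l by auto
  note eq = cubeD(2)[OF c v] cubeD(2)[OF c sub(1)] cubeD(2)[OF c sub(2)] cubeD(2)[OF c sub(3)]
  have pq: "p k \<in> E" "q k \<in> E" "p l \<in> E" "q l \<in> E" using cubeD(3,4)[OF c] k l by auto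
  define cnt where "cnt w = int (card (E // r w))" for w
  have step: "if (p m, q m) \<in> r w then joined m (r (insert m w)) (r w) \<and> cnt (insert m w) = cnt w + 1
      else joined m (r w) (r (insert m w)) \<and> cnt (insert m w) = cnt w - 1"
    if "m \<in> K" "w \<subseteq> K" "m \<notin> w" for m w
  proof -
    have mw: "insert m w \<subseteq> K" using that by auto
    note eqs = cubeD(2)[OF c that(2)] cubeD(2)[OF c mw] and pqm = cubeD(3,4)[OF c that(1)]
    from cubeD(5)[OF c that] show ?thesis
    proof
      assume j: "joined m (r w) (r (insert m w))"
      then have "(p m, q m) \<notin> r w" by (simp add: joined_def)
      then show ?thesis using j joined_card[OF eqs j pqm] by (simp add: cnt_def)
    next
      assume j: "joined m (r (insert m w)) (r w)"
      then have "(p m, q m) \<in> r w" by (rule joined_mem[OF _ eqs(2) pqm])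
      then show ?thesis using j joined_card[OF eqs(2,1) j pqm] by (simp add: cnt_def)
    qed
  qed
  have kv: "k \<in> K" "k \<notin> v" "l \<in> K" "l \<notin> v" "l \<notin> ?vk" "k \<notin> ?vl" using k l kl by auto
  note s1 = step[OF kv(1) v kv(2)] and s2 = step[OF kv(3) sub(1) kv(5)]
    and s3 = step[OF kv(3) v kv(4)] and s4 = step[OF kv(1) sub(2) kv(6)]
  have ins: "insert k ?vl = ?vkl" by auto
  let ?a = "(p k, q k) \<in> r v" and ?b = "(p l, q l) \<in> r ?vk"
    and ?c = "(p l, q l) \<in> r v" and ?d = "(p k, q k) \<in> r ?vl"
  have E: "contract x f = contract y f" if "(x, y) \<in> r v" for x y
    by (rule U_contract_eq[OF f that])
  consider "?a \<longleftrightarrow> ?d" "?b \<longleftrightarrow> ?c" | "?a" "?c" "\<not> ?b" "\<not> ?d" | "\<not> ?a" "\<not> ?c" "?b" "?d"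
    using s1 s2 s3 s4 unfolding ins by (cases ?a; cases ?b; cases ?c; cases ?d) simp_all
  then show ?thesis
  proof cases
    case 1
    then show ?thesis by (simp add: edge_def merge_map_commute)
  next
    case 2
    \<comment> \<open>Both paths split first and merge afterwards. All four legs then lie on one
      circle at \<open>v\<close>, where all their X agree.\<close>
    have "joined k (r ?vk) (r v)" using s1 2 by simp
    then have "p l \<in> r v `` {p k, q k}" using 2 unfolding joined_def by blast
    then have "contract (p k) f = contract (p l) f" using E[of "p k" "p l"] E[of "q k" "p l"] E[OF 2(1)] by auto
    then have "merge_map l f = merge_map k f" using E[OF 2(1)] E[OF 2(2)] by (simp add: merge_map_def)
    then show ?thesis using 2 by (simp add: edge_def)
  next
    case 3
    \<comment> \<open>Both paths merge first and split afterwards. The crossings \<open>k\<close>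
      and \<open>l\<close> then lie between the same two circles, so their merge maps have the same
      pair of summands.\<close>
    have j: "joined k (r v) (r ?vk)" using s1 3 by simp
    then have pl: "p l \<in> r v `` {p k, q k}" "q l \<in> r v `` {p k, q k}"
      using 3 unfolding joined_def by blast+
    have "(p l, q l) \<in> r v" if "(x, p l) \<in> r v" "(x, q l) \<in> r v" for x
      using that eq(1) unfolding equiv_def by (meson symD transD)
    then have "(p k, p l) \<in> r v \<and> (q k, q l) \<in> r v \<or> (q k, p l) \<in> r v \<and> (p k, q l) \<in> r v"
      using pl 3 by auto
    then have "merge_map l f = merge_map k f"
      using E[of "p k" "p l"] E[of "q k" "q l"] E[of "q k" "p l"] E[of "p k" "q l"]
      by (auto simp: merge_map_def add.commute)
    then show ?thesis using 3 by (simp add: edge_def)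
  qed
qed

lemma anticommuting_standard_signs:
  assumes c: "cube K r"
  shows "anticommuting K r (\<lambda>v k. (- 1) ^ card {l \<in> v. l < k} :: 'f::field)"
  unfolding anticommuting_def
proof (intro allI ballI impI)
  fix v k l and f :: "'a set \<Rightarrow> 'f"
  assume v: "v \<subseteq> K" and k: "k \<in> K - v" and l: "l \<in> K - v" and kl: "k \<noteq> l" and f: "f \<in> U (r v)"
  let ?e = "\<lambda>v k. (- 1) ^ card {l \<in> v. l < k} :: 'f"
  have fin: "finite v" using v cubeD(1)[OF c] finite_subset by blast
  have sign: "?e v a * ?e (insert a v) b = - (?e v b * ?e (insert b v) a)"
    if ab: "a < b" "a \<notin> v" for a b
  proof -
    have "{l \<in> insert a v. l < b} = insert a {l \<in> v. l < b}" "{l \<in> insert b v. l < a} = {l \<in> v. l < a}"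
      using ab by auto
    then show ?thesis using ab fin by simp
  qed
  have "?e v k * ?e (insert k v) l = - (?e v l * ?e (insert l v) k)"
    using sign[of k l] sign[of l k] k l kl by (cases "k < l") auto
  then show "scale (?e v k * ?e (insert k v) l) (edge (r (insert k v)) l (edge (r v) k f)) +
     scale (?e v l * ?e (insert l v) k) (edge (r (insert l v)) k (edge (r v) l f)) = 0"
    by (simp only: edges_commute[OF c v k l kl f]) (simp add: fun_eq_iff)
qed

end

section \<open>The merge and split maps on labelled circles\<close>

lemma sum_filter_eq:
  assumes "finite A" "{x \<in> A. Pr x} = B"
  shows "(\<Sum>x\<in>A. if Pr x then h x else 0) = sum h B"
  using assms by (simp add: sum.inter_filter[symmetric])

lemma mult_term_commute: "mult_term x y z = mult_term y x z"
  by (auto simp: mult_term_def)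

lemma comult_term_commute: "comult_term z x y = comult_term z y x"
  by (auto simp: comult_term_def)

text \<open>The two circles in the existential of \<open>edge_term\<close> are fixed up to order,
  and the multiplication is symmetric. The alternative with a comultiplication would make a
  one-element set equal to a two-element set.\<close>

lemma edge_term_merge:
  assumes "A \<noteq> B" "C - C' = {A, B}" "C' - C = {A \<union> B}"
  shows "edge_term C P C' Q \<longleftrightarrow> P \<inter> C' = Q \<inter> C \<and> mult_term (A \<in> P) (B \<in> P) (A \<union> B \<in> Q)"
proof
  assume *: "edge_term C P C' Q"
  then have PQ: "P \<inter> C' = Q \<inter> C" by (simp add: edge_term_def)
  from * obtain X Y where XY:
    "{A, B} = {X, Y} \<and> {A \<union> B} = {X \<union> Y} \<and> mult_term (X \<in> P) (Y \<in> P) (X \<union> Y \<in> Q) \<or>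
     {A, B} = {X \<union> Y} \<and> {A \<union> B} = {X, Y} \<and> comult_term (X \<union> Y \<in> P) (X \<in> Q) (Y \<in> Q)"
    unfolding edge_term_def assms(2,3) by (elim conjE exE) (rule that)
  have "{A, B} \<noteq> {X \<union> Y}" using assms(1) by auto
  then have "{A, B} = {X, Y} \<and> mult_term (X \<in> P) (Y \<in> P) (X \<union> Y \<in> Q)" using XY by argo
  then show "P \<inter> C' = Q \<inter> C \<and> mult_term (A \<in> P) (B \<in> P) (A \<union> B \<in> Q)"
    using PQ by (auto simp: doubleton_eq_iff mult_term_commute Un_commute)
next
  assume "P \<inter> C' = Q \<inter> C \<and> mult_term (A \<in> P) (B \<in> P) (A \<union> B \<in> Q)"
  then show "edge_term C P C' Q"
    unfolding edge_term_def assms(2,3) using assms(1) by (intro conjI exI[of _ A] exI[of _ B]) auto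
qed

lemma edge_term_split:
  assumes "A \<noteq> B" "C - C' = {A \<union> B}" "C' - C = {A, B}"
  shows "edge_term C P C' Q \<longleftrightarrow> P \<inter> C' = Q \<inter> C \<and> comult_term (A \<union> B \<in> P) (A \<in> Q) (B \<in> Q)"
proof
  assume *: "edge_term C P C' Q"
  then have PQ: "P \<inter> C' = Q \<inter> C" by (simp add: edge_term_def)
  from * obtain X Y where XY:
    "{A \<union> B} = {X, Y} \<and> {A, B} = {X \<union> Y} \<and> mult_term (X \<in> P) (Y \<in> P) (X \<union> Y \<in> Q) \<or>
     {A \<union> B} = {X \<union> Y} \<and> {A, B} = {X, Y} \<and> comult_term (X \<union> Y \<in> P) (X \<in> Q) (Y \<in> Q)"
    unfolding edge_term_def assms(2,3) by (elim conjE exE) (rule that)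
  have "{A, B} \<noteq> {X \<union> Y}" using assms(1) by auto
  then have "{A, B} = {X, Y} \<and> comult_term (X \<union> Y \<in> P) (X \<in> Q) (Y \<in> Q)" using XY by argo
  then show "P \<inter> C' = Q \<inter> C \<and> comult_term (A \<union> B \<in> P) (A \<in> Q) (B \<in> Q)"
    using PQ by (auto simp: doubleton_eq_iff comult_term_commute Un_commute)
next
  assume "P \<inter> C' = Q \<inter> C \<and> comult_term (A \<union> B \<in> P) (A \<in> Q) (B \<in> Q)"
  then show "edge_term C P C' Q"
    unfolding edge_term_def assms(2,3) using assms(1) by (intro conjI exI[of _ A] exI[of _ B]) auto
qed

lemma labellings_extending:
  assumes "C - C' = X" "Q0 \<subseteq> C" "Q0 \<subseteq> C'"
  shows "P \<subseteq> C \<and> P \<inter> C' = Q0 \<longleftrightarrow> (\<exists>Y\<in>Pow X. P = Q0 \<union> Y)"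
proof
  assume "P \<subseteq> C \<and> P \<inter> C' = Q0"
  then have "P - C' \<in> Pow X" "P = Q0 \<union> (P - C')" using assms(1) by blast+
  then show "\<exists>Y\<in>Pow X. P = Q0 \<union> Y" by (rule bexI[rotated])
next
  assume "\<exists>Y\<in>Pow X. P = Q0 \<union> Y"
  then show "P \<subseteq> C \<and> P \<inter> C' = Q0" using assms by blast
qed

lemma Pow_doubleton: "Pow {A, B} = {{}, {A}, {B}, {A, B}}"
  by (auto simp: Pow_insert)

text \<open>The multiplication read from its target: \<open>v\<^sub>-\<close> on the merged circle
  comes from either mixed labelling, and \<open>v\<^sub>+\<close> only from two labels
  \<open>v\<^sub>+\<close>. Labels off the crossing are fixed by \<open>Q0\<close>.\<close>

lemma edge_terms_merge:
  assumes AB: "A \<noteq> B" and C: "C - C' = {A, B}" "C' - C = {A \<union> B}" and Q0: "Q0 \<subseteq> C" "Q0 \<subseteq> C'"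
  shows "{P \<in> Pow C. edge_term C P C' Q0} = {insert A Q0, insert B Q0}"
    and "{P \<in> Pow C. edge_term C P C' (insert (A \<union> B) Q0)} = {insert A (insert B Q0)}"
proof -
  have notin: "A \<notin> Q0" "B \<notin> Q0" "A \<union> B \<notin> Q0" "A \<union> B \<notin> C"
    using C Q0 by (metis Diff_iff insertI1 insertI2 subsetD)+
  have *: "{P \<in> Pow C. edge_term C P C' Q}
      = {P. \<exists>Y\<in>Pow {A, B}. P = Q0 \<union> Y \<and> mult_term (A \<in> Y) (B \<in> Y) (A \<union> B \<in> Q)}"
    if "Q \<inter> C = Q0" for Q
  proof -
    have "P \<in> Pow C \<and> edge_term C P C' Q \<longleftrightarrow>
        (P \<subseteq> C \<and> P \<inter> C' = Q0) \<and> mult_term (A \<in> P) (B \<in> P) (A \<union> B \<in> Q)" for P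
      unfolding edge_term_merge[OF AB C] that by blast
    then show ?thesis
      unfolding labellings_extending[OF C(1) Q0] using notin(1,2) by auto
  qed
  have "Q0 \<inter> C = Q0" "insert (A \<union> B) Q0 \<inter> C = Q0" using Q0(1) notin(4) by auto
  from this[THEN *] show "{P \<in> Pow C. edge_term C P C' Q0} = {insert A Q0, insert B Q0}"
    "{P \<in> Pow C. edge_term C P C' (insert (A \<union> B) Q0)} = {insert A (insert B Q0)}"
    using AB notin(3) by (auto simp: Pow_doubleton mult_term_def)
qed

text \<open>The comultiplication read from its target: two labels \<open>v\<^sub>-\<close> come from
  \<open>v\<^sub>-\<close>, mixed labels come from \<open>v\<^sub>+\<close>, and two labels
  \<open>v\<^sub>+\<close> never occur.\<close>

lemma edge_terms_split:
  assumes AB: "A \<noteq> B" and C: "C - C' = {A \<union> B}" "C' - C = {A, B}" and Q0: "Q0 \<subseteq> C" "Q0 \<subseteq> C'"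
    and Y: "Y \<subseteq> {A, B}"
  shows "{P \<in> Pow C. edge_term C P C' (Q0 \<union> Y)}
    = (if Y = {A, B} then {} else if Y = {} then {Q0} else {insert (A \<union> B) Q0})"
proof -
  have notin: "A \<notin> Q0" "B \<notin> Q0" "A \<union> B \<notin> Q0" "A \<notin> C" "B \<notin> C"
    using C Q0 by (metis Diff_iff insertI1 insertI2 subsetD)+
  have "(Q0 \<union> Y) \<inter> C = Q0" using Y Q0(1) notin(4,5) by auto
  then have "P \<in> Pow C \<and> edge_term C P C' (Q0 \<union> Y) \<longleftrightarrow>
      (P \<subseteq> C \<and> P \<inter> C' = Q0) \<and> comult_term (A \<union> B \<in> P) (A \<in> Q0 \<union> Y) (B \<in> Q0 \<union> Y)" for P
    unfolding edge_term_split[OF AB C] by auto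
  then have eq: "{P \<in> Pow C. edge_term C P C' (Q0 \<union> Y)}
      = {P. \<exists>Z\<in>{{}, {A \<union> B}}. P = Q0 \<union> Z \<and> comult_term (A \<union> B \<in> Z) (A \<in> Y) (B \<in> Y)}"
    unfolding labellings_extending[OF C(1) Q0] using notin(1,2,3) by (auto simp: Pow_insert)
  have "Y \<in> Pow {A, B}" using Y by simp
  then consider "Y = {}" | "Y = {A}" | "Y = {B}" | "Y = {A, B}" unfolding Pow_doubleton by blast
  then show ?thesis
    unfolding eq by cases (use AB in \<open>simp_all add: comult_term_def doubleton_eq_iff\<close>)
qed

section \<open>Labellings of circles as functions on sets of arcs\<close>

context cube_of_circles
begin

abbreviation cls :: "'a rel \<Rightarrow> 'a \<Rightarrow> 'a set" where
  "cls \<rho> x \<equiv> \<rho> `` {x}"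

text \<open>The value at \<open>S\<close> is the coefficient of the labelling by \<open>v\<^sub>-\<close> only in the product of the
  labelled circles with the elements \<open>v\<^sub>-\<close> placed at the arcs in \<open>S\<close>.\<close>

definition pairing :: "'a rel \<Rightarrow> ('a set set \<Rightarrow> 'f::field) \<Rightarrow> 'a set \<Rightarrow> 'f" where
  "pairing \<rho> c S = (if S \<subseteq> E \<and> inj_on (cls \<rho>) S then c (cls \<rho> ` S) else 0)"

lemma pairing_in_U:
  assumes eq: "equiv E \<rho>"
  shows "pairing \<rho> c \<in> U \<rho>"
proof -
  have "contract x (pairing \<rho> c) S = contract y (pairing \<rho> c) S" if xy: "(x, y) \<in> \<rho>" for x y S
  proof -
    have c: "cls \<rho> x = cls \<rho> y" by (rule equiv_class_eq[OF eq xy])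
    have E: "x \<in> E" "y \<in> E" using xy eq by (auto simp: equiv_def)
    have zero: "pairing \<rho> c (insert b S) = 0" if "a \<in> S" "b \<notin> S" "cls \<rho> a = cls \<rho> b" for a b
    proof -
      have ni: "\<not> inj_on (cls \<rho>) (insert b S)" using that by (auto simp: inj_on_def)
      show ?thesis unfolding pairing_def by (simp only: ni simp_thms if_False)
    qed
    consider "x \<in> S" "y \<in> S" | "x \<in> S" "y \<notin> S" | "x \<notin> S" "y \<in> S" | "x \<notin> S" "y \<notin> S" by blast
    then show ?thesis
    proof cases
      case 4
      then have "inj_on (cls \<rho>) (insert x S) \<longleftrightarrow> inj_on (cls \<rho>) (insert y S)"
        by (simp add: c)
      then show ?thesis using 4 E by (simp add: contract_def pairing_def c)
    qed (auto simp: contract_def zero[of x y] zero[of y x] c)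
  qed
  then show ?thesis by (auto simp: U_def pairing_def fun_eq_iff)
qed

text \<open>Arcs are moved one at a time along their circles, which does not change the value
  because X agrees along a circle. As \<open>S\<close> meets each circle at most once, a moved arc
  never meets another arc of the set. It makes evaluation at chosen representatives of the circles
  legitimate.\<close>

lemma U_replace:
  assumes f: "f \<in> U \<rho>" and eq: "equiv E \<rho>" and S: "S \<subseteq> E" "inj_on (cls \<rho>) S"
    and g: "\<And>x. x \<in> S \<Longrightarrow> (x, g x) \<in> \<rho>"
  shows "f (g ` S) = f S"
proof -
  have apart: "x = y" if "x \<in> S" "y \<in> S" "(x, y) \<in> \<rho>" for x y
    using inj_onD[OF S(2) equiv_class_eq[OF eq that(3)] that(1,2)] .
  have sym: "(y, x) \<in> \<rho>" if "(x, y) \<in> \<rho>" for x y using that eq by (auto simp: equiv_def dest: symD)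
  have trans: "(x, z) \<in> \<rho>" if "(x, y) \<in> \<rho>" "(y, z) \<in> \<rho>" for x y z
    using that eq by (auto simp: equiv_def dest: transD)
  have "finite S" using S(1) finite_E finite_subset by blast
  have "f (g ` T \<union> (S - T)) = f S" if "finite T" "T \<subseteq> S" for T
    using that
  proof (induction T rule: finite_induct)
    case (insert x T)
    let ?W = "g ` T \<union> (S - insert x T)"
    have x: "x \<in> S" "x \<notin> T" using insert by auto
    have xW: "x \<notin> ?W"
    proof
      assume "x \<in> ?W"
      then obtain t where "t \<in> T" "x = g t" by auto
      then show False using apart[of t x] g[of t] x insert.prems by auto
    qed
    have gW: "g x \<notin> ?W"
    proof
      assume "g x \<in> ?W"
      then consider t where "t \<in> T" "g x = g t" | "g x \<in> S" "g x \<noteq> x" by auto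
      then show False
      proof cases
        case 1
        then have "(x, g t) \<in> \<rho>" "t \<in> S" using g[OF x(1)] insert.prems by auto
        then have "(x, t) \<in> \<rho>" using trans sym[OF g[of t]] by blast
        then show False using apart[of x t] 1 x insert.prems by auto
      next
        case 2
        then show False using apart[of x "g x"] g[OF x(1)] x by auto
      qed
    qed
    have "f (g ` insert x T \<union> (S - insert x T)) = contract (g x) f ?W"
      by (simp only: contract_notin[OF gW] image_insert Un_insert_left)
    also have "\<dots> = contract x f ?W" by (simp only: U_contract_eq[OF f g[OF x(1)]])
    also have "\<dots> = f (insert x ?W)" by (rule contract_notin[OF xW])
    also have "insert x ?W = g ` T \<union> (S - T)" using x by auto
    finally show ?case using insert by simp
  qed simp
  from this[OF \<open>finite S\<close> order.refl] show ?thesis by simp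
qed

text \<open>\<open>S\<close> meets the merged circle at most once. If it misses it, inserting
  \<open>p k\<close> or \<open>q k\<close> yields the two source labellings with one
  \<open>v\<^sub>+\<close>. If it meets it on one of the two old circles, inserting the leg on that
  circle gives zero and inserting the other leg gives the labelling with both
  \<open>v\<^sub>+\<close>.\<close>

lemma merge_map_pairing:
  assumes eq: "equiv E \<rho>" and j: "joined k \<rho> \<rho>'" and pq: "p k \<in> E" "q k \<in> E"
    and S: "S \<subseteq> E" "inj_on (cls \<rho>') S"
  shows "merge_map k (pairing \<rho> c) S
    = (\<Sum>P\<in>Pow (E // \<rho>). if edge_term (E // \<rho>) P (E // \<rho>') (cls \<rho>' ` S) then c P else 0)"
proof -
  define A B where "A = cls \<rho> (p k)" and "B = cls \<rho> (q k)"
  note Q = joined_quotient[OF eq j pq, folded A_def B_def]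
  let ?C = "E // \<rho>" and ?C' = "E // \<rho>'" and ?Q = "cls \<rho>' ` S"
  have fin: "finite ?C" using eq finite_E by (auto simp: equiv_def intro!: finite_quotient)
  have AC: "A \<in> ?C" "B \<in> ?C" "A \<union> B \<notin> ?C" "A \<notin> ?C'" "B \<notin> ?C'" using Q by blast+
  have M: "\<rho> `` {p k, q k} = A \<union> B" by (auto simp: A_def B_def)
  have cls': "cls \<rho>' x = (if x \<in> A \<union> B then A \<union> B else cls \<rho> x)" for x
    unfolding joined_classes[OF eq j] M ..
  have clsA: "cls \<rho> x = A" if "x \<in> A" for x
    using that unfolding A_def by (intro equiv_class_eq[OF eq, symmetric]) simp
  have clsB: "cls \<rho> x = B" if "x \<in> B" for x
    using that unfolding B_def by (intro equiv_class_eq[OF eq, symmetric]) simp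
  have AB: "A \<inter> B = {}" using clsA clsB Q(1) by blast
  have self: "x \<in> cls \<rho> x" if "x \<in> E" for x using that eq by (auto simp: equiv_def refl_on_def)
  define T where "T = S - (A \<union> B)"
  define Q0 where "Q0 = cls \<rho> ` T"
  have Q0: "Q0 \<subseteq> ?C" "Q0 \<subseteq> ?C'" "A \<notin> Q0" "B \<notin> Q0" "A \<union> B \<notin> Q0"
  proof -
    show "Q0 \<subseteq> ?C" using S(1) by (auto simp: Q0_def T_def intro: quotientI)
    show "A \<notin> Q0" "B \<notin> Q0" "A \<union> B \<notin> Q0"
      using self S(1) unfolding Q0_def T_def by blast+
    show "Q0 \<subseteq> ?C'"
    proof
      fix X assume X: "X \<in> Q0"
      then have "X \<notin> ?C - ?C'" unfolding Q(2) using \<open>A \<notin> Q0\<close> \<open>B \<notin> Q0\<close> by auto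
      then show "X \<in> ?C'" using X \<open>Q0 \<subseteq> ?C\<close> by blast
    qed
  qed
  have injT: "inj_on (cls \<rho>) T"
  proof (rule inj_onI)
    fix x y assume "x \<in> T" "y \<in> T" "cls \<rho> x = cls \<rho> y"
    then show "x = y" using inj_onD[OF S(2), of x y] by (simp add: cls' T_def)
  qed
  have TE: "T \<subseteq> E" "p k \<notin> T" "q k \<notin> T" using S(1) Q(4,5) by (auto simp: T_def)
  have pA: "cls \<rho> (p k) = A" "cls \<rho> (q k) = B" by (simp_all add: A_def B_def)
  have one: "pairing \<rho> c (insert x T) = c (insert (cls \<rho> x) Q0)" if "x \<in> A \<union> B" for x
  proof -
    have "x \<in> E" using that eq by (auto simp: A_def B_def equiv_def)
    moreover have "cls \<rho> x \<notin> cls \<rho> ` T" using that clsA clsB Q0(3,4) unfolding Q0_def by auto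
    moreover have "T - {x} = T" using that by (auto simp: T_def)
    ultimately show ?thesis using TE injT by (simp add: pairing_def Q0_def)
  qed
  have two: "pairing \<rho> c (insert x (insert y T)) = c (insert A (insert B Q0))" if "x \<in> A" "y \<in> B" for x y
  proof -
    have "x \<in> E" "y \<in> E" using that eq by (auto simp: A_def B_def equiv_def)
    moreover have "A \<notin> cls \<rho> ` T" "B \<notin> cls \<rho> ` T" using Q0(3,4) unfolding Q0_def by auto
    moreover have "T - {x} = T" "T - {y} = T" "x \<noteq> y" using that AB by (auto simp: T_def)
    moreover have "cls \<rho> ` (insert y T - {x}) = insert B Q0"
      using \<open>T - {x} = T\<close> \<open>x \<noteq> y\<close> clsB[OF that(2)] by (simp add: insert_Diff_if Q0_def)
    ultimately show ?thesis
      using TE injT Q(1) clsA[OF that(1)] clsB[OF that(2)] by (simp add: pairing_def Q0_def)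
  qed
  show ?thesis
  proof (cases "S \<inter> (A \<union> B) = {}")
    case True
    then have ST: "S = T" by (auto simp: T_def)
    have "?Q = Q0" unfolding Q0_def ST by (intro image_cong refl) (auto simp: cls' T_def)
    have "{P \<in> Pow ?C. edge_term ?C P ?C' ?Q} = {insert A Q0, insert B Q0}"
      unfolding \<open>?Q = Q0\<close> by (rule edge_terms_merge[OF Q(1-3) Q0(1,2)])
    then have "(\<Sum>P\<in>Pow ?C. if edge_term ?C P ?C' ?Q then c P else 0)
        = (\<Sum>P\<in>{insert A Q0, insert B Q0}. c P)"
      using fin by (intro sum_filter_eq) auto
    also have "\<dots> = c (insert A Q0) + c (insert B Q0)"
      using Q(1) Q0 by (subst sum.insert) auto
    also have "\<dots> = merge_map k (pairing \<rho> c) S"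
      using TE one[of "p k"] one[of "q k"] Q(4,5) by (simp add: merge_map_def contract_def ST pA)
    finally show ?thesis ..
  next
    case False
    then obtain s where s: "s \<in> S" "s \<in> A \<union> B" by blast
    have only: "x = s" if "x \<in> S" "x \<in> A \<union> B" for x
      using inj_onD[OF S(2) _ that(1) s(1)] that s by (simp add: cls')
    have ST: "S = insert s T"
    proof
      show "S \<subseteq> insert s T" using only unfolding T_def by blast
      show "insert s T \<subseteq> S" using s(1) by (simp add: T_def)
    qed
    have "cls \<rho>' ` T = Q0" unfolding Q0_def by (intro image_cong refl) (auto simp: cls' T_def)
    then have QQ: "?Q = insert (A \<union> B) Q0" using s(2) by (simp add: ST cls')
    have "{P \<in> Pow ?C. edge_term ?C P ?C' ?Q} = {insert A (insert B Q0)}"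
      unfolding QQ by (rule edge_terms_merge[OF Q(1-3) Q0(1,2)])
    then have "(\<Sum>P\<in>Pow ?C. if edge_term ?C P ?C' ?Q then c P else 0)
        = (\<Sum>P\<in>{insert A (insert B Q0)}. c P)"
      using fin by (intro sum_filter_eq) auto
    also have "\<dots> = merge_map k (pairing \<rho> c) S"
    proof -
      have sT: "s \<notin> T" using s by (auto simp: T_def)
      have zero: "pairing \<rho> c (insert x S) = 0" if "cls \<rho> x = cls \<rho> s" "x \<notin> S" for x
      proof -
        have ni: "\<not> inj_on (cls \<rho>) (insert x S)" using that s(1) by (auto simp: inj_on_def)
        show ?thesis unfolding pairing_def by (simp only: ni simp_thms if_False)
      qed
      show ?thesis
      proof (cases "s \<in> A")
        case True
        then have "contract (p k) (pairing \<rho> c) S = 0"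
          using zero[of "p k"] clsA[OF True] by (simp add: contract_def pA)
        moreover have "q k \<noteq> s" using True AB Q(5) by auto
        then have "contract (q k) (pairing \<rho> c) S = c (insert A (insert B Q0))"
          using two[OF True Q(5)] TE by (simp add: contract_def ST insert_commute)
        ultimately show ?thesis by (simp add: merge_map_def)
      next
        case False
        then have sB: "s \<in> B" using s by auto
        then have "contract (q k) (pairing \<rho> c) S = 0"
          using zero[of "q k"] clsB[OF sB] by (simp add: contract_def pA)
        moreover have "p k \<noteq> s" using False Q(4) by auto
        then have "contract (p k) (pairing \<rho> c) S = c (insert A (insert B Q0))"
          using two[OF Q(4) sB] TE by (simp add: contract_def ST)
        ultimately show ?thesis by (simp add: merge_map_def)
      qed
    qed
    finally show ?thesis ..
  qed
qed

text \<open>\<open>S\<close> may meet either of the two new circles. If it meets both, it meets the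
  old circle twice and the left side vanishes, just as no comultiplication produces two labels
  \<open>v\<^sub>+\<close>. Otherwise the old circle has label \<open>v\<^sub>+\<close> exactly if
  \<open>S\<close> meets one of the new ones.\<close>

lemma pairing_split:
  assumes eq: "equiv E \<rho>" and j: "joined k \<rho> \<rho>'" and pq: "p k \<in> E" "q k \<in> E"
    and eq': "equiv E \<rho>'" and S: "S \<subseteq> E" "inj_on (cls \<rho>) S"
  shows "pairing \<rho>' c S
    = (\<Sum>P\<in>Pow (E // \<rho>'). if edge_term (E // \<rho>') P (E // \<rho>) (cls \<rho> ` S) then c P else 0)"
proof -
  define A B where "A = cls \<rho> (p k)" and "B = cls \<rho> (q k)"
  note Q = joined_quotient[OF eq j pq, folded A_def B_def]
  let ?C = "E // \<rho>" and ?C' = "E // \<rho>'" and ?Q = "cls \<rho> ` S"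
  have fin: "finite ?C'" using eq' finite_E by (auto simp: equiv_def intro!: finite_quotient)
  have AC: "A \<notin> ?C'" "B \<notin> ?C'" "A \<union> B \<in> ?C'" "A \<union> B \<notin> ?C" "A \<in> ?C" "B \<in> ?C" using Q by blast+
  have M: "\<rho> `` {p k, q k} = A \<union> B" by (auto simp: A_def B_def)
  have cls': "cls \<rho>' x = (if x \<in> A \<union> B then A \<union> B else cls \<rho> x)" for x
    unfolding joined_classes[OF eq j] M ..
  have clsA: "cls \<rho> x = A" if "x \<in> A" for x
    using that unfolding A_def by (intro equiv_class_eq[OF eq, symmetric]) simp
  have clsB: "cls \<rho> x = B" if "x \<in> B" for x
    using that unfolding B_def by (intro equiv_class_eq[OF eq, symmetric]) simp
  have self: "x \<in> cls \<rho> x" if "x \<in> E" for x using that eq by (auto simp: equiv_def refl_on_def)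
  define T where "T = S - (A \<union> B)"
  define Q0 where "Q0 = cls \<rho> ` T"
  have Q0: "Q0 \<subseteq> ?C" "Q0 \<subseteq> ?C'" "A \<notin> Q0" "B \<notin> Q0" "A \<union> B \<notin> Q0"
  proof -
    show "Q0 \<subseteq> ?C" using S(1) by (auto simp: Q0_def T_def intro: quotientI)
    show "A \<notin> Q0" "B \<notin> Q0" "A \<union> B \<notin> Q0"
      using self S(1) unfolding Q0_def T_def by blast+
    show "Q0 \<subseteq> ?C'"
    proof
      fix X assume X: "X \<in> Q0"
      then have "X \<notin> ?C - ?C'" unfolding Q(2) using \<open>A \<notin> Q0\<close> \<open>B \<notin> Q0\<close> by auto
      then show "X \<in> ?C'" using X \<open>Q0 \<subseteq> ?C\<close> by blast
    qed
  qed
  have clsT: "cls \<rho>' ` T = Q0" unfolding Q0_def by (intro image_cong refl) (auto simp: cls' T_def)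
  have injT: "inj_on (cls \<rho>') T"
  proof (rule inj_onI)
    fix x y assume "x \<in> T" "y \<in> T" "cls \<rho>' x = cls \<rho>' y"
    then show "x = y" using inj_onD[OF S(2), of x y] by (simp add: cls' T_def)
  qed
  have Qsub: "?Q = Q0 \<union> (if S \<inter> A \<noteq> {} then {A} else {}) \<union> (if S \<inter> B \<noteq> {} then {B} else {})"
  proof -
    have "S = T \<union> (S \<inter> A) \<union> (S \<inter> B)" by (auto simp: T_def)
    then have "?Q = Q0 \<union> cls \<rho> ` (S \<inter> A) \<union> cls \<rho> ` (S \<inter> B)" unfolding Q0_def by blast
    moreover have "cls \<rho> ` (S \<inter> A) = (if S \<inter> A \<noteq> {} then {A} else {})" using clsA by auto
    moreover have "cls \<rho> ` (S \<inter> B) = (if S \<inter> B \<noteq> {} then {B} else {})" using clsB by auto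
    ultimately show ?thesis by simp
  qed
  define Y where "Y = (if S \<inter> A \<noteq> {} then {A} else {}) \<union> (if S \<inter> B \<noteq> {} then {B} else {})"
  have "Y \<subseteq> {A, B}" by (auto simp: Y_def)
  note terms = edge_terms_split[OF Q(1,3,2) Q0(2,1) this]
  have QY: "?Q = Q0 \<union> Y" unfolding Qsub Y_def by (rule Un_assoc)
  consider "S \<inter> A \<noteq> {}" "S \<inter> B \<noteq> {}" | "S \<inter> A = {}" "S \<inter> B = {}"
    | "(S \<inter> A \<noteq> {}) \<noteq> (S \<inter> B \<noteq> {})" by blast
  then show ?thesis
  proof cases
    case 1
    then obtain x y where xy: "x \<in> S" "x \<in> A" "y \<in> S" "y \<in> B" by blast
    then have "cls \<rho>' x = cls \<rho>' y" "x \<noteq> y" using clsA[of x] clsB[of y] Q(1) by (auto simp: cls')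
    then have "\<not> inj_on (cls \<rho>') S" using xy by (auto simp: inj_on_def)
    moreover have "{P \<in> Pow ?C'. edge_term ?C' P ?C ?Q} = {}"
      unfolding QY terms using 1 by (auto simp: Y_def)
    ultimately show ?thesis
      using sum_filter_eq[of "Pow ?C'" "\<lambda>P. edge_term ?C' P ?C ?Q" "{}" c] fin by (simp add: pairing_def)
  next
    case 2
    then have "S = T" by (auto simp: T_def)
    have "{P \<in> Pow ?C'. edge_term ?C' P ?C ?Q} = {Q0}"
      unfolding QY terms using 2 by (auto simp: Y_def)
    then show ?thesis
      using sum_filter_eq[of "Pow ?C'" "\<lambda>P. edge_term ?C' P ?C ?Q" "{Q0}" c] fin S(1) injT
      by (simp add: pairing_def clsT \<open>S = T\<close>)
  next
    case 3
    then obtain s where s: "s \<in> S" "s \<in> A \<union> B" by blast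
    have only: "x = s" if "x \<in> S" "x \<in> A \<union> B" for x
    proof -
      have "cls \<rho> x = cls \<rho> s" using 3 that s clsA[of x] clsA[of s] clsB[of x] clsB[of s] by blast
      then show ?thesis using inj_onD[OF S(2)] that s by blast
    qed
    have ST: "S = insert s T"
    proof
      show "S \<subseteq> insert s T" using only unfolding T_def by blast
      show "insert s T \<subseteq> S" using s(1) by (simp add: T_def)
    qed
    have sT: "T - {s} = T" using s by (auto simp: T_def)
    have "A \<union> B \<notin> cls \<rho>' ` T" using clsT Q0(5) by simp
    then have "inj_on (cls \<rho>') S" using injT s(2) sT by (simp add: ST cls')
    moreover have "cls \<rho>' s = A \<union> B" using s(2) by (simp add: cls')
    then have "cls \<rho>' ` S = insert (A \<union> B) Q0" by (simp only: ST image_insert clsT)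
    moreover have "{P \<in> Pow ?C'. edge_term ?C' P ?C ?Q} = {insert (A \<union> B) Q0}"
      unfolding QY terms using 3 Q(1) by (auto simp: Y_def doubleton_eq_iff split: if_splits)
    ultimately show ?thesis
      using sum_filter_eq[of "Pow ?C'" "\<lambda>P. edge_term ?C' P ?C ?Q" "{insert (A \<union> B) Q0}" c] fin S(1)
      by (simp add: pairing_def)
  qed
qed

end

section \<open>Checkerboard orientations of planar diagrams\<close>

text \<open>The sum factors over \<open>b\<close> into terms (-1)^d + 1, where d is the size of the
  fibre of \<open>h\<close> over \<open>b\<close>; an odd fibre makes it vanish.\<close>

lemma sum_signs_over_subsets:
  assumes "finite D" "finite B"
  shows "(\<Sum>\<phi>\<in>Pow B. (- 1) ^ card {x \<in> D. h x \<in> \<phi>})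
    = (if \<forall>b\<in>B. even (card {x \<in> D. h x = b}) then 2 ^ card B else (0 :: int))"
proof -
  let ?u = "\<lambda>b. (- 1 :: int) ^ card {x \<in> D. h x = b}"
  have "(- 1) ^ card {x \<in> D. h x \<in> \<phi>} = (\<Prod>b\<in>\<phi>. ?u b)" if "\<phi> \<in> Pow B" for \<phi>
  proof -
    have fin: "finite \<phi>" using that assms(2) finite_subset by blast
    have "{x \<in> D. h x \<in> \<phi>} = (\<Union>b\<in>\<phi>. {x \<in> D. h x = b})" by auto
    then have "card {x \<in> D. h x \<in> \<phi>} = (\<Sum>b\<in>\<phi>. card {x \<in> D. h x = b})"
      using fin assms(1) by (simp only:) (intro card_UN_disjoint, auto)
    then show ?thesis by (simp only: power_sum)
  qed
  then have "(\<Sum>\<phi>\<in>Pow B. (- 1) ^ card {x \<in> D. h x \<in> \<phi>}) = (\<Sum>\<phi>\<in>Pow B. \<Prod>b\<in>\<phi>. ?u b)"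
    by (rule sum.cong[OF refl])
  also have "\<dots> = (\<Prod>b\<in>B. ?u b + 1)"
    using prod_add[OF assms(2), of ?u "\<lambda>_. 1"] by simp
  also have "\<dots> = (if \<forall>b\<in>B. even (card {x \<in> D. h x = b}) then 2 ^ card B else 0)"
  proof (cases "\<forall>b\<in>B. even (card {x \<in> D. h x = b})")
    case True
    then have "(\<Prod>b\<in>B. ?u b + 1) = (\<Prod>b\<in>B. 2)" by (intro prod.cong) auto
    then show ?thesis using True by simp
  next
    case False
    then obtain b where "b \<in> B" "?u b + 1 = 0" by auto
    then have "(\<Prod>b\<in>B. ?u b + 1) = 0" using assms(2) by (meson prod_zero)
    then show ?thesis using False by simp
  qed
  finally show ?thesis .
qed

text \<open>An incidence matrix over the field with two elements and its transpose have the same rank;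
  the proof counts the sum of \<open>(-1)\<^sup>N\<close> over all pairs of subsets in merge_map orders.\<close>

lemma card_even_incidence:
  fixes g :: "'x \<Rightarrow> 'a" and h :: "'x \<Rightarrow> 'b"
  assumes "finite D" "finite A" "finite B"
  shows "2 ^ card B * card {e. e \<subseteq> A \<and> (\<forall>b\<in>B. even (card {x \<in> D. h x = b \<and> g x \<in> e}))}
    = 2 ^ card A * card {\<phi>. \<phi> \<subseteq> B \<and> (\<forall>a\<in>A. even (card {x \<in> D. g x = a \<and> h x \<in> \<phi>}))}"
proof -
  have count: "(\<Sum>e\<in>Pow A'. if P e then 2 ^ m else 0) = (2 ^ m * int (card {e. e \<subseteq> A' \<and> P e}) :: int)"
    if "finite A'" for A' :: "'c set" and P m
  proof -
    have "{e \<in> Pow A'. P e} = {e. e \<subseteq> A' \<and> P e}" by auto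
    then show ?thesis using that by (simp add: sum.If_cases Int_def)
  qed
  have "(\<Sum>e\<in>Pow A. \<Sum>\<phi>\<in>Pow B. (- 1 :: int) ^ card {x \<in> D. g x \<in> e \<and> h x \<in> \<phi>})
    = 2 ^ card B * int (card {e. e \<subseteq> A \<and> (\<forall>b\<in>B. even (card {x \<in> D. h x = b \<and> g x \<in> e}))})"
  proof -
    have "(\<Sum>\<phi>\<in>Pow B. (- 1 :: int) ^ card {x \<in> D. g x \<in> e \<and> h x \<in> \<phi>})
      = (if \<forall>b\<in>B. even (card {x \<in> D. h x = b \<and> g x \<in> e}) then 2 ^ card B else 0)" for e
    proof -
      have "{x \<in> {x \<in> D. g x \<in> e}. h x \<in> \<phi>} = {x \<in> D. g x \<in> e \<and> h x \<in> \<phi>}"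
        "{x \<in> {x \<in> D. g x \<in> e}. h x = b} = {x \<in> D. h x = b \<and> g x \<in> e}" for \<phi> b by auto
      then show ?thesis using sum_signs_over_subsets[of "{x \<in> D. g x \<in> e}" B h] assms by simp
    qed
    then show ?thesis using count[OF assms(2)] by simp
  qed
  moreover have "(\<Sum>\<phi>\<in>Pow B. \<Sum>e\<in>Pow A. (- 1 :: int) ^ card {x \<in> D. g x \<in> e \<and> h x \<in> \<phi>})
    = 2 ^ card A * int (card {\<phi>. \<phi> \<subseteq> B \<and> (\<forall>a\<in>A. even (card {x \<in> D. g x = a \<and> h x \<in> \<phi>}))})"
  proof -
    have "(\<Sum>e\<in>Pow A. (- 1 :: int) ^ card {x \<in> D. g x \<in> e \<and> h x \<in> \<phi>})
      = (if \<forall>a\<in>A. even (card {x \<in> D. g x = a \<and> h x \<in> \<phi>}) then 2 ^ card A else 0)" for \<phi>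
    proof -
      have "{x \<in> {x \<in> D. h x \<in> \<phi>}. g x \<in> e} = {x \<in> D. g x \<in> e \<and> h x \<in> \<phi>}"
        "{x \<in> {x \<in> D. h x \<in> \<phi>}. g x = a} = {x \<in> D. g x = a \<and> h x \<in> \<phi>}" for e a by auto
      then show ?thesis using sum_signs_over_subsets[of "{x \<in> D. h x \<in> \<phi>}" A g] assms by simp
    qed
    then show ?thesis using count[OF assms(3)] by simp
  qed
  ultimately have "int (2 ^ card B * card {e. e \<subseteq> A \<and> (\<forall>b\<in>B. even (card {x \<in> D. h x = b \<and> g x \<in> e}))})
    = int (2 ^ card A * card {\<phi>. \<phi> \<subseteq> B \<and> (\<forall>a\<in>A. even (card {x \<in> D. g x = a \<and> h x \<in> \<phi>}))})"
    using sum.swap[of "\<lambda>e \<phi>. (- 1 :: int) ^ card {x \<in> D. g x \<in> e \<and> h x \<in> \<phi>}" "Pow B" "Pow A"]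
    by simp
  then show ?thesis by (simp only: of_nat_eq_iff)
qed

text \<open>A permutation leaves the set where \<open>Q\<close> holds as often as it enters
  it.\<close>

lemma even_card_changes:
  fixes Q :: "'x \<Rightarrow> bool"
  assumes "finite X" "bij_betw \<sigma> X X"
  shows "even (card {x \<in> X. Q x \<noteq> Q (\<sigma> x)})"
proof -
  have "bij_betw \<sigma> {x \<in> X. Q (\<sigma> x)} {x \<in> X. Q x}"
    using assms(2) unfolding bij_betw_def by (auto simp: inj_on_def)
  then have eq: "card {x \<in> X. Q (\<sigma> x)} = card {x \<in> X. Q x}" by (rule bij_betw_same_card)
  have "card {x \<in> X. Q x} = card {x \<in> X. Q x \<and> Q (\<sigma> x)} + card {x \<in> X. Q x \<and> \<not> Q (\<sigma> x)}"
    using assms(1) by (subst card_Un_disjoint[symmetric]) (auto intro!: arg_cong[where f = card])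
  moreover have "card {x \<in> X. Q (\<sigma> x)} = card {x \<in> X. Q x \<and> Q (\<sigma> x)} + card {x \<in> X. \<not> Q x \<and> Q (\<sigma> x)}"
    using assms(1) by (subst card_Un_disjoint[symmetric]) (auto intro!: arg_cong[where f = card])
  moreover have "card {x \<in> X. Q x \<noteq> Q (\<sigma> x)} = card {x \<in> X. Q x \<and> \<not> Q (\<sigma> x)} + card {x \<in> X. \<not> Q x \<and> Q (\<sigma> x)}"
    using assms(1) by (subst card_Un_disjoint[symmetric]) (auto intro!: arg_cong[where f = card])
  ultimately show ?thesis using eq by simp
qed

lemma card_le_double_image:
  assumes "finite A" "\<And>x y. x \<in> A \<Longrightarrow> y \<in> A \<Longrightarrow> f x = f y \<Longrightarrow> y = x \<or> y = c x"
  shows "card A \<le> 2 * card (f ` A)"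
proof -
  have "A = (\<Union>b\<in>f ` A. {x \<in> A. f x = b})" by auto
  then have "card A \<le> (\<Sum>b\<in>f ` A. card {x \<in> A. f x = b})"
    using card_UN_le[of "f ` A" "\<lambda>b. {x \<in> A. f x = b}"] assms(1) by simp
  also have "\<dots> \<le> (\<Sum>b\<in>f ` A. 2)"
  proof (rule sum_mono)
    fix b assume "b \<in> f ` A"
    then obtain x where "x \<in> A" "f x = b" by auto
    then have "{y \<in> A. f y = b} \<subseteq> {x, c x}" using assms(2)[of x] by blast
    then have "card {y \<in> A. f y = b} \<le> card {x, c x}" by (intro card_mono) auto
    also have "\<dots> \<le> 2" by (simp add: card_insert_if)
    finally show "card {y \<in> A. f y = b} \<le> 2" .
  qed
  finally show ?thesis by simp
qed

lemma equiv_connected: "equiv S {(x, y) \<in> S \<times> S. (x, y) \<in> (R \<union> R\<inverse>)\<^sup>*}"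
proof (rule equivI)
  show "refl_on S {(x, y) \<in> S \<times> S. (x, y) \<in> (R \<union> R\<inverse>)\<^sup>*}" by (auto simp: refl_on_def)
  have "sym ((R \<union> R\<inverse>)\<^sup>*)" by (intro sym_rtrancl sym_Un_converse)
  then show "sym {(x, y) \<in> S \<times> S. (x, y) \<in> (R \<union> R\<inverse>)\<^sup>*}" by (auto simp: sym_def)
  show "trans {(x, y) \<in> S \<times> S. (x, y) \<in> (R \<union> R\<inverse>)\<^sup>*}" by (auto simp: trans_def)
qed auto

section \<open>Darts, faces and the Euler count\<close>

locale plane_diagram =
  fixes L :: "'a link_diagram"
  assumes is_link: "is_link_diagram L" and connected: "connected_diagram L"
begin

abbreviation "D \<equiv> darts L"
abbreviation "arc \<equiv> dart_arc L"

lemma finite_darts: "finite D"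
  by (simp add: darts_def)

lemma incoming_subset: "incoming_darts L \<subseteq> D"
  by (auto simp: incoming_darts_def)

lemma ex1_incoming: "x \<in> D \<Longrightarrow> \<exists>!y. y \<in> incoming_darts L \<and> arc y = arc x"
  using is_link unfolding is_link_diagram_def by blast

lemma ex1_outgoing: "x \<in> D \<Longrightarrow> \<exists>!y. y \<in> D - incoming_darts L \<and> arc y = arc x"
  using is_link unfolding is_link_diagram_def by blast

lemma ex1_opposite:
  assumes "x \<in> D"
  shows "\<exists>!y. y \<in> D \<and> y \<noteq> x \<and> arc y = arc x"
proof -
  obtain i where i: "i \<in> incoming_darts L" "arc i = arc x"
    and i': "\<And>y. y \<in> incoming_darts L \<Longrightarrow> arc y = arc x \<Longrightarrow> y = i"
    using ex1_incoming[OF assms] by metis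
  obtain j where j: "j \<in> D - incoming_darts L" "arc j = arc x"
    and j': "\<And>y. y \<in> D - incoming_darts L \<Longrightarrow> arc y = arc x \<Longrightarrow> y = j"
    using ex1_outgoing[OF assms] by metis
  have "y = i \<or> y = j" if "y \<in> D" "arc y = arc x" for y using that i' j' by blast
  moreover have "i \<in> D" "j \<in> D" "i \<noteq> j" using i j incoming_subset by auto
  ultimately show ?thesis using i j assms by metis
qed

definition opposite :: "nat \<times> nat \<Rightarrow> nat \<times> nat" where
  "opposite x = (THE y. y \<in> D \<and> y \<noteq> x \<and> arc y = arc x)"

lemma opposite:
  assumes "x \<in> D"
  shows "opposite x \<in> D" "opposite x \<noteq> x" "arc (opposite x) = arc x"
  using theI'[OF ex1_opposite[OF assms]] unfolding opposite_def by blast+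

lemma opposite_unique: "x \<in> D \<Longrightarrow> y \<in> D \<Longrightarrow> y \<noteq> x \<Longrightarrow> arc y = arc x \<Longrightarrow> y = opposite x"
  unfolding opposite_def by (rule the1_equality[OF ex1_opposite, symmetric]) simp_all

lemma opposite_opposite: "x \<in> D \<Longrightarrow> opposite (opposite x) = x"
  using opposite_unique[of "opposite x" x] opposite[of x] by auto

lemma same_arc: "x \<in> D \<Longrightarrow> {y \<in> D. arc y = arc x} = {x, opposite x}"
  using opposite[of x] opposite_unique[of x] by blast

definition turn :: "nat \<times> nat \<Rightarrow> nat \<times> nat" where
  "turn x = (fst x, (snd x + 1) mod 4)"

lemma turn_in_darts: "x \<in> D \<Longrightarrow> turn x \<in> D"
  by (auto simp: darts_def turn_def)

lemma inj_turn: "inj_on turn D"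
proof (rule inj_onI)
  fix x y assume "x \<in> D" "y \<in> D" "turn x = turn y"
  then have "fst x = fst y" "(snd x + 1) mod 4 = (snd y + 1) mod 4" "snd x < 4" "snd y < 4"
    by (auto simp: turn_def darts_def)
  moreover from this(3,4) have "snd x \<in> {0, 1, 2, 3}" "snd y \<in> {0, 1, 2, 3}" by auto
  ultimately have "fst x = fst y" "snd x = snd y" by auto
  then show "x = y" by (simp add: prod_eq_iff)
qed

lemma odd_turn: "odd (snd (turn x)) \<longleftrightarrow> even (snd x)"
  by (simp add: turn_def) presburger

definition next_dart :: "nat \<times> nat \<Rightarrow> nat \<times> nat" where
  "next_dart x = turn (opposite x)"

definition face_relation :: "((nat \<times> nat) \<times> (nat \<times> nat)) set" where
  "face_relation = {(x, y) \<in> D \<times> D. (x, y) \<in> ((\<lambda>x. (x, next_dart x)) ` D \<union> ((\<lambda>x. (x, next_dart x)) ` D)\<inverse>)\<^sup>*}"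

abbreviation "face x \<equiv> face_relation `` {x}"

lemma equiv_face: "equiv D face_relation"
  unfolding face_relation_def by (rule equiv_connected)

lemma diagram_faces_eq: "diagram_faces L = face ` D"
proof -
  have "{(x, (k, (p + 1) mod 4)) |x k p.
        x \<in> D \<and> (k, p) \<in> D \<and> x \<noteq> (k, p) \<and> arc x = arc (k, p)} = (\<lambda>x. (x, next_dart x)) ` D"
    (is "?A = ?B")
  proof
    show "?A \<subseteq> ?B"
    proof
      fix z assume "z \<in> ?A"
      then obtain x k p where z: "z = (x, (k, (p + 1) mod 4))" "x \<in> D" "(k, p) \<in> D" "x \<noteq> (k, p)"
        "arc x = arc (k, p)" by auto
      then have "(k, p) = opposite x" by (intro opposite_unique) auto
      then have "next_dart x = (k, (p + 1) mod 4)" by (simp add: next_dart_def turn_def flip: \<open>(k, p) = opposite x\<close>)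
      then show "z \<in> ?B" using z by auto
    qed
    show "?B \<subseteq> ?A"
    proof
      fix z assume "z \<in> ?B"
      then obtain x where x: "x \<in> D" "z = (x, next_dart x)" by auto
      obtain k p where kp: "opposite x = (k, p)" by fastforce
      then have "z = (x, (k, (p + 1) mod 4))" using x by (simp add: next_dart_def turn_def)
      moreover have "(k, p) \<in> D" "x \<noteq> (k, p)" "arc x = arc (k, p)"
        using opposite[OF x(1)] unfolding kp by auto
      ultimately show "z \<in> ?A" using x(1) by blast
    qed
  qed
  then show ?thesis
    unfolding diagram_faces_def connected_components_def face_relation_def
    by (auto simp: quotient_def)
qed

lemma next_dart_in_darts: "x \<in> D \<Longrightarrow> next_dart x \<in> D"
  by (simp add: next_dart_def turn_in_darts opposite)

lemma face_next: "x \<in> D \<Longrightarrow> face (next_dart x) = face x"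
  by (rule equiv_class_eq[OF equiv_face, symmetric])
    (auto simp: face_relation_def next_dart_in_darts)

lemma inj_next: "inj_on next_dart D"
proof (rule inj_onI)
  fix x y assume *: "x \<in> D" "y \<in> D" "next_dart x = next_dart y"
  then have "opposite x = opposite y"
    using inj_onD[OF inj_turn] opposite(1) unfolding next_dart_def by blast
  then show "x = y" using * opposite_opposite by metis
qed

lemma bij_next_face: "bij_betw next_dart {x \<in> D. face x = X} {x \<in> D. face x = X}"
  unfolding bij_betw_def
proof
  show inj: "inj_on next_dart {x \<in> D. face x = X}"
    using inj_next by (rule inj_on_subset) auto
  have "next_dart ` {x \<in> D. face x = X} \<subseteq> {x \<in> D. face x = X}"
    using face_next next_dart_in_darts by blast
  then show "next_dart ` {x \<in> D. face x = X} = {x \<in> D. face x = X}"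
    using inj finite_darts by (intro endo_inj_surj) auto
qed

lemma constant_on_darts:
  assumes "\<And>x y. x \<in> D \<Longrightarrow> y \<in> D \<Longrightarrow> fst x = fst y \<Longrightarrow> \<chi> x = \<chi> y"
    and "\<And>x. x \<in> D \<Longrightarrow> \<chi> (opposite x) = \<chi> x"
    and x: "x \<in> D" and y: "y \<in> D"
  shows "\<chi> x = \<chi> y"
proof -
  have arc: "\<chi> u = \<chi> w" if "u \<in> D" "w \<in> D" "arc u = arc w" for u w
    using that assms(2) opposite_unique[of u w] by metis
  have "arc x \<in> arcs L" "arc y \<in> arcs L"
    using x y is_link unfolding is_link_diagram_def by auto
  then have rel: "(arc x, arc y) \<in> {(arc u, arc w) |u w. u \<in> D \<and> w \<in> D \<and> fst u = fst w}\<^sup>*"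
    using connected unfolding connected_diagram_def by blast
  have "\<forall>z\<in>D. arc z = e \<longrightarrow> \<chi> z = \<chi> x"
    if "(arc x, e) \<in> {(arc u, arc w) |u w. u \<in> D \<and> w \<in> D \<and> fst u = fst w}\<^sup>*" for e
    using that
  proof (induction rule: rtrancl_induct)
    case base
    show ?case using arc x by blast
  next
    case (step e e')
    then obtain u w where uw: "u \<in> D" "w \<in> D" "fst u = fst w" "e = arc u" "e' = arc w" by auto
    then have "\<chi> w = \<chi> x" using step.IH assms(1)[of u w] by auto
    then show ?case using arc uw by metis
  qed
  from this[OF rel] show ?thesis using y by simp
qed

text \<open>Checkerboard colourability, in the form of an orientation of the arcs that alternates
  around every crossing. The obstruction is a class in the first cohomology of the underlying graph
  with coefficients in the field with two elements that vanishes on all faces; Euler's formula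
  says that the faces span the cycles.\<close>

lemma source_sink_orientation:
  obtains s :: "nat \<times> nat \<Rightarrow> bool"
  where "\<And>x. x \<in> D \<Longrightarrow> s (turn x) \<noteq> s x" "\<And>x. x \<in> D \<Longrightarrow> s (opposite x) \<noteq> s x"
proof (cases "n_crossings L = 0")
  case True
  then have "D = {}" by (simp add: darts_def)
  then show ?thesis using that by blast
next
  case False
  let ?n = "n_crossings L" and ?A = "arc ` D" and ?F = "face ` D"
  have x0: "(0, 0) \<in> D" using False by (simp add: darts_def)
  \<comment> \<open>The sets of arcs that evaluate to zero on the boundary of every face, an arc
    counting twice if both its sides lie on the face.\<close>
  define ker where "ker = {e. e \<subseteq> ?A \<and> (\<forall>b\<in>?F. even (card {x \<in> D. face x = b \<and> arc x \<in> e}))}"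
  define coker where "coker = {\<phi>. \<phi> \<subseteq> ?F \<and> (\<forall>a\<in>?A. even (card {x \<in> D. arc x = a \<and> face x \<in> \<phi>}))}"
  have fin: "finite ?A" "finite ?F" using finite_darts by auto
  have rank: "2 ^ card ?F * card ker = 2 ^ card ?A * card coker"
    unfolding ker_def coker_def by (rule card_even_incidence[OF finite_darts fin])
  \<comment> \<open>For such a set of faces, the two sides of every arc are both in it or both
    outside. Going around crossings and along arcs, connectedness leaves only none or all of the
    faces.\<close>
  have "coker \<subseteq> {{}, ?F}"
  proof
    fix \<phi> assume \<phi>: "\<phi> \<in> coker"
    have opp: "face (opposite x) \<in> \<phi> \<longleftrightarrow> face x \<in> \<phi>" if x: "x \<in> D" for x
    proof -
      have "even (card {y \<in> D. arc y = arc x \<and> face y \<in> \<phi>})" using \<phi> x by (auto simp: coker_def)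
      moreover have "{y \<in> D. arc y = arc x \<and> face y \<in> \<phi>} = {y \<in> {x, opposite x}. face y \<in> \<phi>}"
        using same_arc[OF x] by blast
      moreover have "{y \<in> {x, opposite x}. face y \<in> \<phi>} = (if face x \<in> \<phi> then {x} else {})
          \<union> (if face (opposite x) \<in> \<phi> then {opposite x} else {})" by auto
      ultimately show ?thesis using opposite(2)[OF x] by (auto split: if_splits)
    qed
    have turn: "face (turn x) \<in> \<phi> \<longleftrightarrow> face x \<in> \<phi>" if x: "x \<in> D" for x
      using opp[OF x] face_next[OF opposite(1)[OF x]] opposite_opposite[OF x]
      by (simp add: next_dart_def)
    have "face x \<in> \<phi> \<longleftrightarrow> face y \<in> \<phi>" if xy: "x \<in> D" "y \<in> D" for x y
    proof (rule constant_on_darts[of "\<lambda>x. face x \<in> \<phi>", OF _ opp xy])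
      have zero: "face (k, p) \<in> \<phi> \<longleftrightarrow> face (k, 0) \<in> \<phi>" if "(k, p) \<in> D" for k p
        using that
      proof (induction p)
        case (Suc p)
        then have "(k, p) \<in> D" "turn (k, p) = (k, Suc p)" by (auto simp: darts_def turn_def)
        then show ?case using Suc.IH turn by metis
      qed simp
      fix u w assume "u \<in> D" "w \<in> D" "fst u = fst w"
      then show "(face u \<in> \<phi>) = (face w \<in> \<phi>)"
        using zero[of "fst u" "snd u"] zero[of "fst w" "snd w"] unfolding prod.collapse by simp
    qed
    then show "\<phi> \<in> {{}, ?F}" using \<phi> unfolding coker_def by blast
  qed
  then have "card coker \<le> card {{}, ?F}" by (rule card_mono[rotated]) simp
  also have "\<dots> \<le> 2" by (simp add: card_insert_if)
  finally have coker: "card coker \<le> 2" .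
  have "graph_components L \<noteq> {}" "finite (graph_components L)"
    using x0 finite_darts unfolding graph_components_def connected_components_def
    by (auto simp: quotient_def)
  then have "card (graph_components L) \<ge> 1" by (simp add: Suc_leI card_gt_0_iff)
  \<comment> \<open>At least one component is all that enters: the inequality already has the
    direction that bounds the size of \<open>ker\<close> by 2^(n-1).\<close>
  then have euler: "card ?A + 2 \<le> ?n + card ?F"
    using is_link unfolding is_link_diagram_def diagram_faces_eq by linarith
  have "2 ^ card ?F * (2 * card ker) = 2 * 2 ^ card ?A * card coker" using rank by simp
  also have "\<dots> \<le> 2 ^ (card ?A + 2)" using coker by simp
  also have "\<dots> \<le> 2 ^ (?n + card ?F)" using euler by (intro power_increasing) auto
  finally have ker: "2 * card ker \<le> 2 ^ ?n" by (simp add: power_add mult.commute)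
  \<comment> \<open>The arcs at which \<open>Q\<close> changes along the face permutation; under the
    symmetry assumption below, the two sides of an arc agree about this. A property changes an even
    number of times around a face, so these sets lie in \<open>ker\<close>. For membership of the
    crossing in \<open>t\<close> this is the coboundary of \<open>t\<close>.\<close>
  define cut where "cut Q = {a \<in> ?A. \<exists>x\<in>D. arc x = a \<and> Q x \<noteq> Q (next_dart x)}" for Q :: "nat \<times> nat \<Rightarrow> bool"
  have cut: "arc x \<in> cut Q \<longleftrightarrow> Q x \<noteq> Q (next_dart x)" "cut Q \<in> ker"
    if sym: "\<And>x. x \<in> D \<Longrightarrow> (Q (opposite x) \<noteq> Q (turn x)) = (Q x \<noteq> Q (next_dart x))"
      and x: "x \<in> D" for Q x
  proof -
    have 1: "arc x \<in> cut Q \<longleftrightarrow> Q x \<noteq> Q (next_dart x)" if x: "x \<in> D" for x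
    proof
      assume "arc x \<in> cut Q"
      then obtain y where y: "y \<in> D" "arc y = arc x" "Q y \<noteq> Q (next_dart y)" by (auto simp: cut_def)
      then have "y = x \<or> y = opposite x" using same_arc[OF x] by blast
      then show "Q x \<noteq> Q (next_dart x)"
        using y(3) sym[OF x] by (auto simp: next_dart_def opposite_opposite[OF x])
    qed (use x in \<open>auto simp: cut_def\<close>)
    then show "arc x \<in> cut Q \<longleftrightarrow> Q x \<noteq> Q (next_dart x)" using x .
    have "even (card {x \<in> D. face x = b \<and> arc x \<in> cut Q})" for b
    proof -
      have "{x \<in> D. face x = b \<and> arc x \<in> cut Q} = {x \<in> {x \<in> D. face x = b}. Q x \<noteq> Q (next_dart x)}"
        using 1 by blast
      then show ?thesis using even_card_changes[OF _ bij_next_face, of b Q] finite_darts by simp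
    qed
    then show "cut Q \<in> ker" by (auto simp: ker_def cut_def)
  qed
  have fst_turn: "fst (turn x) = fst x" for x by (simp add: turn_def)
  have cross: "((fst (opposite x) \<in> t) \<noteq> (fst (turn x) \<in> t)) = ((fst x \<in> t) \<noteq> (fst (next_dart x) \<in> t))" for x t
    by (auto simp: next_dart_def fst_turn)
  let ?\<delta> = "\<lambda>t. cut (\<lambda>x. fst x \<in> t)"
  have \<delta>: "arc x \<in> ?\<delta> t \<longleftrightarrow> ((fst x \<in> t) \<noteq> (fst (opposite x) \<in> t))" if "x \<in> D" for x t
    using cut(1)[of "\<lambda>x. fst x \<in> t", OF cross that] by (simp add: next_dart_def fst_turn)
  have finker: "finite ker"
    by (rule finite_subset[of _ "Pow ?A"]) (use fin in \<open>auto simp: ker_def\<close>)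
  have im: "?\<delta> ` Pow {..<?n} \<subseteq> ker"
  proof
    fix e assume "e \<in> ?\<delta> ` Pow {..<?n}"
    then obtain t where "e = ?\<delta> t" by (elim imageE)
    then show "e \<in> ker" using cut(2)[of "\<lambda>x. fst x \<in> t", OF cross x0] by (simp only:)
  qed
  \<comment> \<open>A set of crossings and its complement are the only ones with a given coboundary.
    So there are at least 2^(n-1) coboundaries, and they fill \<open>ker\<close>.\<close>
  have "card (Pow {..<?n}) \<le> 2 * card (?\<delta> ` Pow {..<?n})"
  proof (rule card_le_double_image[where c = "\<lambda>t. {..<?n} - t"])
    fix t t' assume t: "t \<in> Pow {..<?n}" "t' \<in> Pow {..<?n}" and eq: "?\<delta> t = ?\<delta> t'"
    have "(fst x \<in> t \<longleftrightarrow> fst x \<in> t') = (fst y \<in> t \<longleftrightarrow> fst y \<in> t')" if "x \<in> D" "y \<in> D" for x y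
    proof (rule constant_on_darts[of "\<lambda>x. fst x \<in> t \<longleftrightarrow> fst x \<in> t'", OF _ _ that])
      fix x assume "x \<in> D"
      then show "(fst (opposite x) \<in> t \<longleftrightarrow> fst (opposite x) \<in> t') = (fst x \<in> t \<longleftrightarrow> fst x \<in> t')"
        using \<delta>[of x t] \<delta>[of x t'] eq by auto
    qed auto
    note const = this
    have "(k \<in> t \<longleftrightarrow> k \<in> t') = (0 \<in> t \<longleftrightarrow> 0 \<in> t')" if "k < ?n" for k
    proof -
      have "(k, 0) \<in> D" using that by (simp add: darts_def)
      from const[OF this x0] show ?thesis by simp
    qed
    then show "t' = t \<or> t' = {..<?n} - t" using t by (cases "0 \<in> t \<longleftrightarrow> 0 \<in> t'") auto
  qed simp
  then have "card ker \<le> card (?\<delta> ` Pow {..<?n})" using ker by (simp add: card_Pow)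
  then have "?\<delta> ` Pow {..<?n} = ker" using im finker by (intro card_seteq) auto
  moreover have odd_sym: "(odd (snd (opposite x)) \<noteq> odd (snd (turn x))) = (odd (snd x) \<noteq> odd (snd (next_dart x)))"
    for x by (auto simp: next_dart_def odd_turn)
  \<comment> \<open>This set consists of the arcs whose two ends have positions of equal parity,
    that is, where the signs by parity of position fail to alternate along the arc. Reversing the
    signs at the crossings in \<open>t\<close> repairs exactly these arcs.\<close>
  moreover have "cut (\<lambda>x. odd (snd x)) \<in> ker" by (rule cut(2)[OF odd_sym x0])
  ultimately obtain t where t: "?\<delta> t = cut (\<lambda>x. odd (snd x))" by (metis (no_types, lifting) imageE)
  have par: "((fst x \<in> t) \<noteq> (fst (opposite x) \<in> t)) = (odd (snd x) = odd (snd (opposite x)))" if x: "x \<in> D" for x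
    using \<delta>[OF x, of t] cut(1)[OF odd_sym x] unfolding t by (auto simp: next_dart_def odd_turn)
  show ?thesis
  proof (rule that[of "\<lambda>x. (fst x \<in> t) \<noteq> odd (snd x)"])
    show "((fst (turn x) \<in> t) \<noteq> odd (snd (turn x))) \<noteq> ((fst x \<in> t) \<noteq> odd (snd x))" for x
      by (auto simp: fst_turn odd_turn)
    show "((fst (opposite x) \<in> t) \<noteq> odd (snd (opposite x))) \<noteq> ((fst x \<in> t) \<noteq> odd (snd x))" if "x \<in> D" for x
      using par[OF that] by auto
  qed
qed

end

section \<open>The cube of resolutions of a planar diagram\<close>

lemma funpow_periodic:
  assumes "finite H" "inj_on \<sigma> H" "\<sigma> ` H \<subseteq> H" "x \<in> H"
  obtains m where "m \<ge> 1" "(\<sigma> ^^ m) x = x"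
proof -
  have mem: "(\<sigma> ^^ i) x \<in> H" for i using assms(3,4) by (induction i) auto
  have "finite (range (\<lambda>i. (\<sigma> ^^ i) x))"
    by (rule finite_subset[OF _ assms(1)]) (use mem in auto)
  then have "\<not> inj (\<lambda>i. (\<sigma> ^^ i) x)"
    using range_inj_infinite by blast
  then obtain i j where ij: "i < j" "(\<sigma> ^^ i) x = (\<sigma> ^^ j) x"
    unfolding inj_def by (metis nat_neq_iff)
  have "(\<sigma> ^^ (j - i)) x = x" if "i \<le> j" "(\<sigma> ^^ i) x = (\<sigma> ^^ j) x" for i j
    using that
  proof (induction i arbitrary: j)
    case (Suc i)
    then obtain j' where j: "j = Suc j'" by (cases j) auto
    then have "(\<sigma> ^^ i) x = (\<sigma> ^^ j') x" using Suc.prems inj_onD[OF assms(2)] mem by simp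
    then show ?case using Suc j by simp
  qed simp
  then show ?thesis using that[of "j - i"] ij by simp
qed

text \<open>\<open>\<tau>\<close> is \<open>\<sigma>\<close> after the transposition of
  \<open>a\<close> and \<open>c\<close>. If both lie on one \<open>\<sigma>\<close>-cycle, the
  \<open>\<tau>\<close>-orbit of \<open>a\<close> runs through the segment from
  \<open>\<sigma> c\<close> to \<open>a\<close> and closes up without meeting \<open>c\<close>. If
  they lie on different cycles, it runs through the cycle of \<open>c\<close> and arrives at
  \<open>c\<close>.\<close>

lemma transposition_cycles:
  assumes fin: "finite H" and inj: "inj_on \<sigma> H" and into: "\<sigma> ` H \<subseteq> H" and H: "a \<in> H" "c \<in> H" "a \<noteq> c"
    and \<tau>: "\<tau> a = \<sigma> c" "\<tau> c = \<sigma> a" "\<And>x. x \<in> H \<Longrightarrow> x \<noteq> a \<Longrightarrow> x \<noteq> c \<Longrightarrow> \<tau> x = \<sigma> x"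
  shows "(\<exists>i. (\<sigma> ^^ i) a = c) \<longleftrightarrow> \<not> (\<exists>i. (\<tau> ^^ i) a = c)"
proof
  have mem: "(\<sigma> ^^ i) c \<in> H" for i using into H(2) by (induction i) auto
  assume "\<exists>i. (\<sigma> ^^ i) a = c"
  then obtain i where i: "(\<sigma> ^^ i) a = c" by blast
  obtain m where m: "m \<ge> 1" "(\<sigma> ^^ m) a = a" using funpow_periodic[OF fin inj into H(1)] .
  have per: "(\<sigma> ^^ (m * t)) a = a" for t
    by (induction t) (simp_all add: m(2) funpow_add)
  have "i \<le> m * (i + 1)" using le_trans[OF _ mult_le_mono1[OF m(1), of "i + 1"], of i] by simp
  then have "m * (i + 1) = m * (i + 1) - i + i" by simp
  then have "(\<sigma> ^^ (m * (i + 1) - i)) c = a"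
    using per[of "i + 1"] i by (metis comp_apply funpow_add)
  moreover have "m * (i + 1) - i \<ge> 1"
  proof -
    have "N - i \<ge> 1" if "1 * (i + 1) \<le> N" for N using that by simp
    then show ?thesis using mult_le_mono1[OF m(1)] by blast
  qed
  ultimately have ex: "\<exists>j. j \<ge> 1 \<and> (\<sigma> ^^ j) c = a" by blast
  \<comment> \<open>The first arrival at \<open>a\<close> after \<open>c\<close>: by minimality,
    \<open>c\<close> does not recur on this segment, which is therefore closed under
    \<open>\<tau>\<close>.\<close>
  define j where "j = (LEAST j. j \<ge> 1 \<and> (\<sigma> ^^ j) c = a)"
  have j: "j \<ge> 1" "(\<sigma> ^^ j) c = a" using LeastI_ex[OF ex] unfolding j_def by auto
  have min: "\<not> (i \<ge> 1 \<and> (\<sigma> ^^ i) c = a)" if "i < j" for i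
    using that not_less_Least unfolding j_def by blast
  have avoid: "(\<sigma> ^^ i) c \<noteq> c" if "1 \<le> i" "i \<le> j" for i
  proof
    assume ic: "(\<sigma> ^^ i) c = c"
    have "(\<sigma> ^^ (j - i)) c = a"
      using j(2) ic that by (metis comp_apply funpow_add le_add_diff_inverse2)
    moreover have "i \<noteq> j" using ic j(2) H(3) by auto
    ultimately show False using min[of "j - i"] that by auto
  qed
  have "\<exists>i. 1 \<le> i \<and> i \<le> j \<and> (\<tau> ^^ n) a = (\<sigma> ^^ i) c" for n
  proof (induction n)
    case 0
    then show ?case using j by force
  next
    case (Suc n)
    then obtain i where i: "1 \<le> i" "i \<le> j" "(\<tau> ^^ n) a = (\<sigma> ^^ i) c" by blast
    show ?case
    proof (cases "i = j")
      case True
      then have "(\<tau> ^^ Suc n) a = (\<sigma> ^^ 1) c" using i j \<tau>(1) by simp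
      then show ?thesis using j(1) by blast
    next
      case False
      then have "(\<sigma> ^^ i) c \<noteq> a" using i min[of i] by auto
      then have "(\<tau> ^^ Suc n) a = (\<sigma> ^^ Suc i) c" using i avoid[of i] \<tau>(3)[OF mem] by simp
      moreover have "1 \<le> Suc i" "Suc i \<le> j" using i False by auto
      ultimately show ?thesis by blast
    qed
  qed
  then show "\<not> (\<exists>i. (\<tau> ^^ i) a = c)" using avoid by metis
next
  have mem: "(\<sigma> ^^ i) c \<in> H" for i using into H(2) by (induction i) auto
  assume nex: "\<not> (\<exists>i. (\<tau> ^^ i) a = c)"
  show "\<exists>i. (\<sigma> ^^ i) a = c"
  proof (rule ccontr)
    assume nc: "\<not> (\<exists>i. (\<sigma> ^^ i) a = c)"
    have ex: "\<exists>m. m \<ge> 1 \<and> (\<sigma> ^^ m) c = c" using funpow_periodic[OF fin inj into H(2)] by metis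
    define m where "m = (LEAST m. m \<ge> 1 \<and> (\<sigma> ^^ m) c = c)"
    have m: "m \<ge> 1" "(\<sigma> ^^ m) c = c" using LeastI_ex[OF ex] unfolding m_def by auto
    have min: "\<not> (i \<ge> 1 \<and> (\<sigma> ^^ i) c = c)" if "i < m" for i
      using that not_less_Least unfolding m_def by blast
    have "(\<tau> ^^ Suc i) a = (\<sigma> ^^ Suc i) c" if "Suc i \<le> m" for i
      using that
    proof (induction i)
      case 0
      then show ?case using \<tau>(1) by simp
    next
      case (Suc i)
      have "(\<sigma> ^^ Suc i) c \<noteq> a"
      proof
        assume *: "(\<sigma> ^^ Suc i) c = a"
        have "(\<sigma> ^^ (m - Suc i)) a = (\<sigma> ^^ (m - Suc i + Suc i)) c"
          unfolding funpow_add comp_apply * ..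
        also have "\<dots> = c" using m(2) Suc.prems by simp
        finally show False using nc by blast
      qed
      moreover have "(\<sigma> ^^ Suc i) c \<noteq> c" using min[of "Suc i"] Suc.prems by auto
      ultimately have "\<tau> ((\<sigma> ^^ Suc i) c) = \<sigma> ((\<sigma> ^^ Suc i) c)" by (intro \<tau>(3) mem)
      then show ?case using Suc by simp
    qed
    from this[of "m - 1"] have "(\<tau> ^^ m) a = c" using m by simp
    then show False using nex by blast
  qed
qed

section \<open>Resolutions as permutations of oriented arcs\<close>

context plane_diagram
begin

abbreviation "n \<equiv> n_crossings L"

definition smooth :: "nat set \<Rightarrow> ('a \<times> 'a) set" where
  "smooth v = (\<Union>k<n. smoothing (k \<in> v) (crossings L ! k))"

definition rel :: "nat set \<Rightarrow> ('a \<times> 'a) set" where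
  "rel v = {(x, y) \<in> arcs L \<times> arcs L. (x, y) \<in> (smooth v \<union> (smooth v)\<inverse>)\<^sup>*}"

lemma circles_eq: "circles L v = arcs L // rel v"
  by (simp add: circles_def connected_components_def rel_def smooth_def)

lemma equiv_rel: "equiv (arcs L) (rel v)"
  unfolding rel_def by (rule equiv_connected)

lemma smoothing_arcs:
  "smoothing b (crossings L ! k) =
    (if b then {(arc (k, 0), arc (k, 3)), (arc (k, 1), arc (k, 2))}
     else {(arc (k, 0), arc (k, 1)), (arc (k, 2), arc (k, 3))})"
  by (cases "crossings L ! k") (simp add: dart_arc_def numeral_3_eq_3 numeral_2_eq_2)

text \<open>The dart at the same crossing to which the smoothing connects \<open>x\<close>: the
  1-smoothing pairs the positions 0, 3 and 1, 2, the 0-smoothing 0, 1 and 2, 3.\<close>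

definition mate :: "nat set \<Rightarrow> nat \<times> nat \<Rightarrow> nat \<times> nat" where
  "mate v x = (fst x, if fst x \<in> v then 3 - snd x else if even (snd x) then snd x + 1 else snd x - 1)"

lemma dart_cases:
  assumes "x \<in> D"
  obtains k where "k < n" "x = (k, 0)" | k where "k < n" "x = (k, 1)"
    | k where "k < n" "x = (k, 2)" | k where "k < n" "x = (k, 3)"
proof -
  have "fst x < n" "snd x = 0 \<or> snd x = 1 \<or> snd x = 2 \<or> snd x = 3" using assms by (auto simp: darts_def)
  then show ?thesis using that by (metis prod.collapse)
qed

lemma mate_in_darts: "x \<in> D \<Longrightarrow> mate v x \<in> D"
  by (auto elim!: dart_cases simp: mate_def darts_def)

lemma mate_mate: "x \<in> D \<Longrightarrow> mate v (mate v x) = x"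
  by (auto elim!: dart_cases simp: mate_def)

lemma smooth_mates: "smooth v \<union> (smooth v)\<inverse> = (\<lambda>x. (arc x, arc (mate v x))) ` D"
proof -
  have "D = (\<Union>k<n. {(k, 0), (k, 1), (k, 2), (k, 3)})"
    by (auto elim!: dart_cases simp: darts_def)
  moreover have "smoothing (k \<in> v) (crossings L ! k) \<union> (smoothing (k \<in> v) (crossings L ! k))\<inverse>
    = (\<lambda>x. (arc x, arc (mate v x))) ` {(k, 0), (k, 1), (k, 2), (k, 3)}" for k
    by (cases "k \<in> v") (auto simp: smoothing_arcs mate_def)
  moreover have "smooth v \<union> (smooth v)\<inverse>
    = (\<Union>k<n. smoothing (k \<in> v) (crossings L ! k) \<union> (smoothing (k \<in> v) (crossings L ! k))\<inverse>)"
    by (auto simp: smooth_def)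
  ultimately show ?thesis by (simp only: image_UN)
qed

lemma arc_in_arcs: "x \<in> D \<Longrightarrow> arc x \<in> arcs L"
  using is_link by (auto simp: is_link_diagram_def)

lemma smooth_subset: "smooth v \<subseteq> arcs L \<times> arcs L"
proof -
  have "smooth v \<subseteq> (\<lambda>x. (arc x, arc (mate v x))) ` D" using smooth_mates by blast
  then show ?thesis using arc_in_arcs mate_in_darts by blast
qed

lemma smooth_subset_rel: "smooth v \<subseteq> rel v"
  using smooth_subset[of v] unfolding rel_def by blast

lemma rel_least:
  assumes "equiv (arcs L) T" "smooth v \<subseteq> T"
  shows "rel v \<subseteq> T"
proof -
  have "(x, y) \<in> T" if "(x, y) \<in> (smooth v \<union> (smooth v)\<inverse>)\<^sup>*" "x \<in> arcs L" for x y
    using that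
  proof (induction rule: rtrancl_induct)
    case base
    then show ?case using assms(1) by (auto simp: equiv_def refl_on_def)
  next
    case (step y z)
    then have "(y, z) \<in> T" using assms by (auto simp: equiv_def dest: symD)
    then show ?case using step assms(1) by (auto simp: equiv_def dest: transD)
  qed
  then show ?thesis by (auto simp: rel_def)
qed

text \<open>Both smoothings connect legs that are neighbours around the crossing, where the signs
  alternate.\<close>

lemma sign_mate:
  fixes s :: "nat \<times> nat \<Rightarrow> bool"
  assumes s: "\<And>x. x \<in> D \<Longrightarrow> s (turn x) \<noteq> s x" and x: "x \<in> D"
  shows "s (mate v x) \<noteq> s x"
proof -
  obtain k where k: "k < n" "fst x = k" using x by (auto simp: darts_def)
  then have D: "(k, 0) \<in> D" "(k, 1) \<in> D" "(k, 2) \<in> D" by (auto simp: darts_def)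
  have "turn (k, 0) = (k, 1)" "turn (k, 1) = (k, 2)" "turn (k, 2) = (k, 3)"
    by (simp_all add: turn_def)
  then have "s (k, 1) \<noteq> s (k, 0)" "s (k, 2) \<noteq> s (k, 1)" "s (k, 3) \<noteq> s (k, 2)"
    using s[OF D(1)] s[OF D(2)] s[OF D(3)] by simp_all
  moreover have "snd x = 0 \<or> snd x = 1 \<or> snd x = 2 \<or> snd x = 3"
    by (rule dart_cases[OF x]) simp_all
  then have "x = (k, 0) \<or> x = (k, 1) \<or> x = (k, 2) \<or> x = (k, 3)"
    using k(2) by (auto simp: prod_eq_iff)
  ultimately show ?thesis by (elim disjE) (auto simp: mate_def)
qed

text \<open>Among the darts with \<open>s\<close>, each arc that meets a crossing has exactly one
  end. Passing through a crossing by \<open>mate\<close> and along an arc by \<open>opposite\<close>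
  changes the sign twice, so \<open>\<sigma>\<close> permutes these darts and runs once around each
  circle through a crossing.\<close>

lemma rel_iff_funpow:
  fixes v and s :: "nat \<times> nat \<Rightarrow> bool"
  defines "\<sigma> \<equiv> \<lambda>x. opposite (mate v x)"
  assumes s: "\<And>x. x \<in> D \<Longrightarrow> s (turn x) \<noteq> s x" "\<And>x. x \<in> D \<Longrightarrow> s (opposite x) \<noteq> s x"
  shows permutes_heads: "inj_on \<sigma> {x \<in> D. s x}" "\<sigma> ` {x \<in> D. s x} \<subseteq> {x \<in> D. s x}"
    and "x \<in> D \<Longrightarrow> s x \<Longrightarrow> y \<in> D \<Longrightarrow> s y \<Longrightarrow> (arc x, arc y) \<in> rel v \<longleftrightarrow> (\<exists>i. (\<sigma> ^^ i) x = y)"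
proof -
  let ?H = "{x \<in> D. s x}"
  show inj: "inj_on \<sigma> ?H"
  proof (rule inj_onI)
    fix x y assume "x \<in> ?H" "y \<in> ?H" "\<sigma> x = \<sigma> y"
    then show "x = y"
      unfolding \<sigma>_def using opposite_opposite mate_mate mate_in_darts by (metis mem_Collect_eq)
  qed
  show into: "\<sigma> ` ?H \<subseteq> ?H"
    using s(2) sign_mate[of s, OF s(1)] opposite(1) mate_in_darts unfolding \<sigma>_def by blast
  have head: "y = z" if "y \<in> ?H" "z \<in> ?H" "arc y = arc z" for y z
  proof (rule ccontr)
    assume "y \<noteq> z"
    then have "y = opposite z" using that opposite_unique by blast
    then show False using that s(2)[of z] by simp
  qed
  have step: "(arc z, arc (\<sigma> z)) \<in> smooth v \<union> (smooth v)\<inverse>" if "z \<in> D" for z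
    unfolding smooth_mates \<sigma>_def using that opposite(3)[OF mate_in_darts[OF that]] by auto
  have forward: "\<forall>y\<in>?H. arc y = e \<longrightarrow> (\<exists>i. (\<sigma> ^^ i) x = y)"
    if x: "x \<in> ?H" and e: "(arc x, e) \<in> (smooth v \<union> (smooth v)\<inverse>)\<^sup>*" for x e
    using e
  proof (induction rule: rtrancl_induct)
    case base
    have "(\<sigma> ^^ 0) x = y" if "y \<in> ?H" "arc y = arc x" for y using head[OF x that(1)] that by simp
    then show ?case by blast
  next
    case (step e e')
    obtain z where z: "z \<in> D" "e = arc z" "e' = arc (mate v z)"
      using step.hyps(2) unfolding smooth_mates by blast
    show ?case
    proof (intro ballI impI)
      fix y assume y: "y \<in> ?H" "arc y = e'"
      show "\<exists>i. (\<sigma> ^^ i) x = y"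
      proof (cases "s z")
        case True
        then obtain i where i: "(\<sigma> ^^ i) x = z" using step.IH z by blast
        have \<sigma>z: "\<sigma> z \<in> ?H" using into z True by blast
        have "arc (\<sigma> z) = e'"
          unfolding \<sigma>_def z(3) by (rule opposite(3)[OF mate_in_darts[OF z(1)]])
        then have "y = \<sigma> z" using head[OF y(1) \<sigma>z] y(2) by simp
        then have "(\<sigma> ^^ Suc i) x = y" using i by simp
        then show ?thesis by blast
      next
        case False
        then have mz: "mate v z \<in> ?H" using sign_mate[of s, OF s(1) z(1)] mate_in_darts[OF z(1)] by blast
        have "y = mate v z" using head[OF y(1) mz] y(2) z(3) by simp
        \<comment> \<open>Here the strand is traversed against the orientation, so \<open>y\<close>
          is the predecessor under \<open>\<sigma>\<close> of a dart already reached. Periodicity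
          reaches it by going forward around the cycle.\<close>
        then have \<sigma>y: "\<sigma> y = opposite z" unfolding \<sigma>_def by (simp add: mate_mate[OF z(1)])
        have "opposite z \<in> ?H" using False s(2)[OF z(1)] opposite(1)[OF z(1)] by blast
        then obtain i where i: "(\<sigma> ^^ i) x = \<sigma> y"
          using step.IH opposite(3)[OF z(1)] z(2) unfolding \<sigma>y by blast
        obtain m where m: "m \<ge> 1" "(\<sigma> ^^ m) y = y"
          by (rule funpow_periodic[OF _ inj into y(1)]) (use finite_darts in auto)
        then obtain m' where "m = Suc m'" by (cases m) auto
        then have "(\<sigma> ^^ (m' + i)) x = y"
          using m(2) i by (simp add: funpow_add funpow_swap1)
        then show ?thesis by blast
      qed
    qed
  qed
  have backward: "(arc x, arc ((\<sigma> ^^ i) x)) \<in> (smooth v \<union> (smooth v)\<inverse>)\<^sup>*" if x: "x \<in> ?H" for x i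
  proof (induction i)
    case (Suc i)
    have "(\<sigma> ^^ i) x \<in> ?H" using into x by (induction i) auto
    then have "(arc ((\<sigma> ^^ i) x), arc ((\<sigma> ^^ Suc i) x)) \<in> smooth v \<union> (smooth v)\<inverse>"
      using step by simp
    then show ?case using Suc.IH by (rule rtrancl_into_rtrancl[rotated])
  qed simp
  assume xy: "x \<in> D" "s x" "y \<in> D" "s y"
  then have H: "x \<in> ?H" "y \<in> ?H" by auto
  show "(arc x, arc y) \<in> rel v \<longleftrightarrow> (\<exists>i. (\<sigma> ^^ i) x = y)"
  proof
    assume "(arc x, arc y) \<in> rel v"
    then have "(arc x, arc y) \<in> (smooth v \<union> (smooth v)\<inverse>)\<^sup>*" by (simp add: rel_def)
    from bspec[OF forward[OF H(1) this] H(2)] show "\<exists>i. (\<sigma> ^^ i) x = y" by simp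
  next
    assume "\<exists>i. (\<sigma> ^^ i) x = y"
    then show "(arc x, arc y) \<in> rel v"
      using backward[OF H(1)] arc_in_arcs[OF xy(1)] arc_in_arcs[OF xy(3)] by (auto simp: rel_def)
  qed
qed

text \<open>Of the darts at \<open>k\<close>, exactly those at legs 0 and 2 have the chosen sign.
  Changing the smoothing swaps their images under the permutation of the circles, and
  \<open>transposition_cycles\<close> applies. Without an alternating orientation, both smoothings
  could put the two strands on one circle.\<close>

lemma exactly_one_smoothing_joins:
  assumes k: "k < n" "k \<notin> v"
  shows "(arc (k, 0), arc (k, 2)) \<in> rel v \<longleftrightarrow> (arc (k, 0), arc (k, 2)) \<notin> rel (insert k v)"
proof -
  obtain s0 :: "nat \<times> nat \<Rightarrow> bool"
    where s0: "\<And>x. x \<in> D \<Longrightarrow> s0 (turn x) \<noteq> s0 x" "\<And>x. x \<in> D \<Longrightarrow> s0 (opposite x) \<noteq> s0 x"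
    by (rule source_sink_orientation) (rule that)
  \<comment> \<open>Normalized so that leg 0, and hence leg 2, has sign \<open>True\<close>.\<close>
  define s where "s x \<longleftrightarrow> s0 x = s0 (k, 0)" for x
  have s: "\<And>x. x \<in> D \<Longrightarrow> s (turn x) \<noteq> s x" "\<And>x. x \<in> D \<Longrightarrow> s (opposite x) \<noteq> s x"
    using s0 unfolding s_def by metis+
  have D: "(k, 0) \<in> D" "(k, 1) \<in> D" "(k, 2) \<in> D" using k by (auto simp: darts_def)
  have "s0 (k, 1) \<noteq> s0 (k, 0)" "s0 (k, 2) \<noteq> s0 (k, 1)"
    using s0(1)[OF D(1)] s0(1)[OF D(2)] by (simp_all add: turn_def numeral_2_eq_2)
  then have sk: "s (k, 0)" "s (k, 2)" "\<not> s (k, 1)" by (auto simp: s_def)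
  have "turn (k, 2) = (k, 3)" by (simp add: turn_def)
  then have sk3: "\<not> s (k, 3)" using s(1)[OF D(3)] sk(2) by simp
  note perm = rel_iff_funpow[of s, OF s]
  have "mate (insert k v) x = mate v x" if "x \<in> {x \<in> D. s x}" "x \<noteq> (k, 0)" "x \<noteq> (k, 2)" for x
  proof -
    have "fst x \<noteq> k"
      using that sk(3) sk3 by (auto elim!: dart_cases)
    then show ?thesis by (simp add: mate_def)
  qed
  then have "(\<exists>i. ((\<lambda>x. opposite (mate v x)) ^^ i) (k, 0) = (k, 2))
    \<longleftrightarrow> \<not> (\<exists>i. ((\<lambda>x. opposite (mate (insert k v) x)) ^^ i) (k, 0) = (k, 2))"
    using D sk k finite_darts
    by (intro transposition_cycles[OF _ perm(1,2)]) (auto simp: mate_def)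
  moreover have "(arc (k, 0), arc (k, 2)) \<in> rel w
      \<longleftrightarrow> (\<exists>i. ((\<lambda>x. opposite (mate w x)) ^^ i) (k, 0) = (k, 2))" for w
    by (rule rel_iff_funpow(3)[of s]) (use s D sk in auto)
  ultimately show ?thesis by simp
qed

end

lemma equiv_join_classes:
  assumes S: "equiv E S" and ac: "a \<in> E" "c \<in> E"
  shows "equiv E (S \<union> S `` {a, c} \<times> S `` {a, c})"
proof (rule equivI)
  let ?M = "S `` {a, c}"
  have sub: "S \<subseteq> E \<times> E" and r: "\<And>x. x \<in> E \<Longrightarrow> (x, x) \<in> S" and s: "\<And>x y. (x, y) \<in> S \<Longrightarrow> (y, x) \<in> S"
    and t: "\<And>x y z. (x, y) \<in> S \<Longrightarrow> (y, z) \<in> S \<Longrightarrow> (x, z) \<in> S"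
    using S unfolding equiv_def refl_on_def sym_def trans_def by blast+
  show "S \<union> ?M \<times> ?M \<subseteq> E \<times> E" using sub by blast
  show "refl_on E (S \<union> ?M \<times> ?M)" using r by (auto simp: refl_on_def)
  show "sym (S \<union> ?M \<times> ?M)" using s by (auto simp: sym_def)
  have closed: "y \<in> ?M" if "x \<in> ?M" "(x, y) \<in> S" for x y using that t by blast
  show "trans (S \<union> ?M \<times> ?M)"
  proof (rule transI)
    fix x y z assume "(x, y) \<in> S \<union> ?M \<times> ?M" "(y, z) \<in> S \<union> ?M \<times> ?M"
    then consider "(x, y) \<in> S" "(y, z) \<in> S" | "(x, y) \<in> S" "y \<in> ?M" "z \<in> ?M"
      | "x \<in> ?M" "y \<in> ?M" "(y, z) \<in> S" | "x \<in> ?M" "z \<in> ?M" by blast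
    then show "(x, z) \<in> S \<union> ?M \<times> ?M"
    proof cases
      case 1
      then show ?thesis using t by blast
    next
      case 2
      then show ?thesis using closed[OF _ s] by blast
    next
      case 3
      then show ?thesis using closed by blast
    qed blast
  qed
qed

text \<open>If \<open>a\<close> and \<open>c\<close> are already related by \<open>S'\<close>, the
  two pairs generating \<open>S'\<close> relate all four legs. So \<open>S'\<close> contains
  \<open>S\<close> together with the join of the classes of \<open>a\<close> and \<open>c\<close>,
  while this join contains the generators of \<open>S'\<close>.\<close>

lemma resmoothing_joins_classes:
  assumes S: "equiv E S" "R0 \<subseteq> S" "(a, b) \<in> S" "(c, d) \<in> S"
    and S': "equiv E S'" "R0 \<subseteq> S'" "(a, d) \<in> S'" "(c, b) \<in> S'"
    and least: "\<And>T. equiv E T \<Longrightarrow> R0 \<subseteq> T \<Longrightarrow> (a, b) \<in> T \<Longrightarrow> (c, d) \<in> T \<Longrightarrow> S \<subseteq> T"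
    and least': "\<And>T. equiv E T \<Longrightarrow> R0 \<subseteq> T \<Longrightarrow> (a, d) \<in> T \<Longrightarrow> (c, b) \<in> T \<Longrightarrow> S' \<subseteq> T"
    and ac: "(a, c) \<in> S'"
  shows "S' = S \<union> S `` {a, c} \<times> S `` {a, c}"
proof
  have aE: "a \<in> E" "c \<in> E" using S(1,3,4) by (auto simp: equiv_def)
  then have refl: "(a, a) \<in> S" "(c, c) \<in> S" using S(1) by (auto simp: equiv_def refl_on_def)
  show "S' \<subseteq> S \<union> S `` {a, c} \<times> S `` {a, c}"
    by (rule least'[OF equiv_join_classes[OF S(1) aE]]) (use S refl in blast)+
  have s: "\<And>x y. (x, y) \<in> S' \<Longrightarrow> (y, x) \<in> S'"
    and t: "\<And>x y z. (x, y) \<in> S' \<Longrightarrow> (y, z) \<in> S' \<Longrightarrow> (x, z) \<in> S'"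
    using S'(1) unfolding equiv_def sym_def trans_def by blast+
  have SS': "S \<subseteq> S'"
    by (rule least[OF S'(1,2)]) (rule t[OF ac S'(4)] t[OF s[OF ac] S'(3)])+
  have "(a, x) \<in> S'" if "x \<in> S `` {a, c}" for x
    using that SS' t[OF ac] by blast
  then have "S `` {a, c} \<times> S `` {a, c} \<subseteq> S'" using s t by blast
  then show "S \<union> S `` {a, c} \<times> S `` {a, c} \<subseteq> S'" using SS' by blast
qed

context plane_diagram
begin

lemma finite_arcs: "finite (arcs L)"
  using is_link by (simp add: is_link_diagram_def)

end

sublocale plane_diagram \<subseteq> cube_of_circles "arcs L" "\<lambda>k. dart_arc L (k, 0)" "\<lambda>k. dart_arc L (k, 2)"
  by unfold_locales (rule finite_arcs)

context plane_diagram
begin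

lemma smooth_insert:
  assumes k: "k < n" "k \<notin> v"
  defines "R0 \<equiv> \<Union>l\<in>{..<n} - {k}. smoothing (l \<in> v) (crossings L ! l)"
  shows "smooth v = R0 \<union> {(arc (k, 0), arc (k, 1)), (arc (k, 2), arc (k, 3))}"
    and "smooth (insert k v) = R0 \<union> {(arc (k, 0), arc (k, 3)), (arc (k, 1), arc (k, 2))}"
proof -
  have split: "(\<Union>l<n. F l) = (\<Union>l\<in>{..<n} - {k}. F l) \<union> F k" for F :: "nat \<Rightarrow> ('a \<times> 'a) set"
    using k(1) by auto
  show "smooth v = R0 \<union> {(arc (k, 0), arc (k, 1)), (arc (k, 2), arc (k, 3))}"
    unfolding smooth_def split R0_def using k(2) by (simp add: smoothing_arcs)
  have "(\<Union>l\<in>{..<n} - {k}. smoothing (l \<in> insert k v) (crossings L ! l)) = R0"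
    unfolding R0_def by (rule SUP_cong) auto
  then show "smooth (insert k v) = R0 \<union> {(arc (k, 0), arc (k, 3)), (arc (k, 1), arc (k, 2))}"
    unfolding smooth_def split by (simp add: smoothing_arcs)
qed

lemma rel_joined:
  assumes k: "k < n" "k \<notin> v"
  shows "joined k (rel v) (rel (insert k v)) \<or> joined k (rel (insert k v)) (rel v)"
proof -
  define R0 where "R0 = (\<Union>l\<in>{..<n} - {k}. smoothing (l \<in> v) (crossings L ! l))"
  note sm = smooth_insert[OF k, folded R0_def]
  let ?S = "rel v" and ?S' = "rel (insert k v)"
  have sym: "(x, y) \<in> T \<Longrightarrow> (y, x) \<in> T" if "equiv (arcs L) T" for T x y
    using that by (auto simp: equiv_def dest: symD)
  have S: "R0 \<subseteq> ?S" "(arc (k, 0), arc (k, 1)) \<in> ?S" "(arc (k, 2), arc (k, 3)) \<in> ?S"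
    using smooth_subset_rel[of v] unfolding sm by auto
  have S': "R0 \<subseteq> ?S'" "(arc (k, 0), arc (k, 3)) \<in> ?S'" "(arc (k, 1), arc (k, 2)) \<in> ?S'"
    using smooth_subset_rel[of "insert k v"] unfolding sm by auto
  have S'': "(arc (k, 2), arc (k, 1)) \<in> ?S'" by (rule sym[OF equiv_rel S'(3)])
  have least: "?S \<subseteq> T" if "equiv (arcs L) T" "R0 \<subseteq> T" "(arc (k, 0), arc (k, 1)) \<in> T" "(arc (k, 2), arc (k, 3)) \<in> T" for T
    by (rule rel_least[OF that(1)]) (use that in \<open>simp add: sm\<close>)
  have least': "?S' \<subseteq> T" if "equiv (arcs L) T" "R0 \<subseteq> T" "(arc (k, 0), arc (k, 3)) \<in> T" "(arc (k, 2), arc (k, 1)) \<in> T" for T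
    by (rule rel_least[OF that(1)]) (use that sym[OF that(1,4)] in \<open>simp add: sm\<close>)
  show ?thesis
  proof (cases "(arc (k, 0), arc (k, 2)) \<in> rel v")
    case True
    then have "(arc (k, 0), arc (k, 2)) \<notin> ?S'" using exactly_one_smoothing_joins[OF k] by blast
    moreover have "?S = ?S' \<union> ?S' `` {arc (k, 0), arc (k, 2)} \<times> ?S' `` {arc (k, 0), arc (k, 2)}"
      by (rule resmoothing_joins_classes[OF equiv_rel S'(1,2) S'' equiv_rel S(1,2,3) least' least True])
    ultimately show ?thesis by (simp add: joined_def)
  next
    case False
    then have True': "(arc (k, 0), arc (k, 2)) \<in> ?S'" using exactly_one_smoothing_joins[OF k] by blast
    have "?S' = ?S \<union> ?S `` {arc (k, 0), arc (k, 2)} \<times> ?S `` {arc (k, 0), arc (k, 2)}"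
      by (rule resmoothing_joins_classes[OF equiv_rel S(1,2,3) equiv_rel S'(1,2) S'' least least' True'])
    then show ?thesis using False by (simp add: joined_def)
  qed
qed

lemma legs_in_arcs: "k < n \<Longrightarrow> arc (k, 0) \<in> arcs L" "k < n \<Longrightarrow> arc (k, 2) \<in> arcs L"
  by (intro arc_in_arcs; simp add: darts_def)+

lemma cube_rel: "cube {..<n} rel"
  unfolding cube_def using equiv_rel legs_in_arcs rel_joined by blast

text \<open>The resolutions \<open>{}\<close> and \<open>{k}\<close> have opposite smoothings at
  \<open>k\<close>, and their pairs together link leg 0 to the other three legs of
  \<open>k\<close>.\<close>

lemma connected_rel: "connected_cube {..<n} rel"
proof -
  define G where "G = (\<Union>v\<in>Pow {..<n}. rel v)"
  have G: "rel v \<subseteq> G" if "v \<subseteq> {..<n}" for v using that by (auto simp: G_def)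
  have "sym G" using equiv_rel by (auto simp: G_def sym_def equiv_def)
  then have symG: "(y, x) \<in> G\<^sup>*" if "(x, y) \<in> G\<^sup>*" for x y
    using that sym_rtrancl by (metis symD)
  have root: "(arc (k, 0), arc x) \<in> G\<^sup>*" if x: "x \<in> D" and k: "fst x = k" for x k
  proof -
    have kn: "k < n" using x k by (auto simp: darts_def)
    have "smooth {} \<subseteq> G" "smooth {k} \<subseteq> G"
      using smooth_subset_rel G[of "{}"] G[of "{k}"] kn by blast+
    then have "(arc (k, 0), arc (k, 1)) \<in> G" "(arc (k, 0), arc (k, 3)) \<in> G" "(arc (k, 1), arc (k, 2)) \<in> G"
      using smooth_insert[OF kn, of "{}"] by auto
    then have "(arc (k, 0), arc (k, 1)) \<in> G\<^sup>*" "(arc (k, 0), arc (k, 3)) \<in> G\<^sup>*" "(arc (k, 0), arc (k, 2)) \<in> G\<^sup>*"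
      by (auto intro: rtrancl_into_rtrancl)
    moreover have "snd x = 0 \<or> snd x = 1 \<or> snd x = 2 \<or> snd x = 3" using x by (auto simp: darts_def)
    then have "x = (k, 0) \<or> x = (k, 1) \<or> x = (k, 2) \<or> x = (k, 3)"
      using k by (auto simp: prod_eq_iff)
    ultimately show ?thesis by auto
  qed
  have "{(arc x, arc y) |x y. x \<in> D \<and> y \<in> D \<and> fst x = fst y} \<subseteq> G\<^sup>*"
  proof clarify
    fix k i l j assume "(k, i) \<in> D" "(l, j) \<in> D" "fst (k, i) = fst (l, j)"
    then show "(arc (k, i), arc (l, j)) \<in> G\<^sup>*"
      using symG[OF root[of "(k, i)" k]] root[of "(l, j)" k] by (auto intro: rtrancl_trans)
  qed
  then have "{(arc x, arc y) |x y. x \<in> D \<and> y \<in> D \<and> fst x = fst y}\<^sup>* \<subseteq> G\<^sup>*"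
    by (rule rtrancl_subset_rtrancl)
  then show ?thesis
    using connected unfolding connected_diagram_def connected_cube_def G_def by blast
qed

section \<open>The Khovanov complex as a cube of function spaces\<close>

abbreviation N :: "nat set" where "N \<equiv> {..<n}"

abbreviation sgn :: "nat set \<Rightarrow> nat \<Rightarrow> 'f::field" where
  "sgn \<equiv> \<lambda>v k. (- 1) ^ card {l \<in> v. l < k}"

definition pair :: "('a kh_state \<Rightarrow> 'f::field) \<Rightarrow> nat set \<Rightarrow> 'a set \<Rightarrow> 'f" where
  "pair c v = (if v \<subseteq> N then pairing (rel v) (\<lambda>P. c (v, P)) else 0)"

text \<open>Inverse of \<open>pair\<close> on supported chains: the coefficient of a labelling is
  the value at a set with one arbitrary arc from each circle labelled
  \<open>v\<^sub>+\<close>.\<close>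

definition unpair :: "(nat set \<Rightarrow> 'a set \<Rightarrow> 'f::field) \<Rightarrow> 'a kh_state \<Rightarrow> 'f" where
  "unpair f s = (if s \<in> kh_states L then f (fst s) ((\<lambda>Z. SOME x. x \<in> Z) ` snd s) else 0)"

definition kh_supported :: "int \<Rightarrow> ('a kh_state \<Rightarrow> 'f::field) set" where
  "kh_supported i = {c. \<forall>s. c s \<noteq> 0 \<longrightarrow> s \<in> kh_states L \<and> hom_degree L s = i}"

lemma kh_supportedD: "c \<in> kh_supported i \<Longrightarrow> c s \<noteq> 0 \<Longrightarrow> s \<in> kh_states L"
  "c \<in> kh_supported i \<Longrightarrow> c s \<noteq> 0 \<Longrightarrow> hom_degree L s = i"
  unfolding kh_supported_def by blast+

lemma finite_circles: "finite (circles L v)"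
  unfolding circles_eq using finite_arcs equiv_rel[of v] by (auto simp: equiv_def intro!: finite_quotient)

lemma kh_states_eq: "kh_states L = (SIGMA v:Pow N. Pow (circles L v))"
  by (auto simp: kh_states_def)

lemma finite_kh_states: "finite (kh_states L)"
  unfolding kh_states_eq using finite_circles by (intro finite_SigmaI) auto

lemma linear_pair: "pair (c + c') = pair c + pair c'" "pair (scale a c) = scale2 a (pair c)"
  by (auto simp: pair_def pairing_def fun_eq_iff)

lemma pair_in_U: "pair c v \<in> U (rel v)"
  by (simp add: pair_def pairing_in_U equiv_rel)

lemma pair_in_chains:
  assumes "c \<in> kh_supported i"
  shows "pair c \<in> chains N rel (i + int (n_minus L))"
proof (rule chainsI)
  fix v
  show "pair c v \<in> U (rel v)" by (rule pair_in_U)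
  assume nz: "pair c v \<noteq> 0"
  then have v: "v \<subseteq> N" by (rule contrapos_np) (simp add: pair_def)
  obtain S where "pair c v S \<noteq> 0" using nz by (metis ext zero_fun_apply)
  then obtain P where "c (v, P) \<noteq> 0" by (auto simp: pair_def pairing_def v split: if_splits)
  then have "hom_degree L (v, P) = i" by (rule kh_supportedD[OF assms])
  then show "v \<subseteq> N \<and> int (card v) = i + int (n_minus L)" using v by (simp add: hom_degree_def)
qed

lemma representative:
  assumes "Z \<in> circles L v"
  shows "(SOME x. x \<in> Z) \<in> Z" "(SOME x. x \<in> Z) \<in> arcs L" "cls (rel v) (SOME x. x \<in> Z) = Z"
proof -
  obtain x where x: "x \<in> arcs L" "Z = cls (rel v) x" using assms unfolding circles_eq by (rule quotientE)
  then have "x \<in> Z" using equiv_rel[of v] by (auto simp: equiv_def refl_on_def)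
  then show *: "(SOME x. x \<in> Z) \<in> Z" by (rule someI)
  then have r: "(x, SOME x. x \<in> Z) \<in> rel v" using x by simp
  then show "(SOME x. x \<in> Z) \<in> arcs L" by (auto simp: rel_def)
  show "cls (rel v) (SOME x. x \<in> Z) = Z"
    by (rule trans[OF equiv_class_eq[OF equiv_rel r, symmetric] x(2)[symmetric]])
qed

lemma unpair_pair:
  assumes "\<And>s. c s \<noteq> 0 \<Longrightarrow> s \<in> kh_states L"
  shows "unpair (pair c) = c"
proof
  fix s :: "'a kh_state"
  obtain v P where s: "s = (v, P)" by fastforce
  show "unpair (pair c) s = c s"
  proof (cases "s \<in> kh_states L")
    case True
    then have v: "v \<subseteq> N" and P: "P \<subseteq> circles L v" by (auto simp: s kh_states_def)
    let ?r = "\<lambda>Z :: 'a set. SOME x. x \<in> Z"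
    have cls: "cls (rel v) (?r Z) = Z" if "Z \<in> P" for Z using representative(3) P that by blast
    have "?r ` P \<subseteq> arcs L" using representative(2) P by blast
    moreover have "inj_on (cls (rel v)) (?r ` P)" by (rule inj_onI) (use cls in auto)
    moreover have "cls (rel v) ` ?r ` P = P" using cls by (simp add: image_image)
    ultimately show ?thesis using True v by (simp add: s unpair_def pair_def pairing_def)
  next
    case False
    then show ?thesis using assms[of s] by (cases "c s = 0") (simp_all add: unpair_def)
  qed
qed

text \<open>On a set meeting each circle at most once, replacing its arcs by the chosen
  representatives does not change the value. On all other sets both sides vanish.\<close>

lemma pair_unpair:
  assumes f: "f \<in> chains N rel m"
  shows "pair (unpair f) = f"
proof -
  have "pair (unpair f) v S = f v S" for v S
  proof (cases "v \<subseteq> N")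
    case False
    then have "f v = 0" using chainsD(2)[OF f] by blast
    then show ?thesis using False by (simp add: pair_def)
  next
    case v: True
    have U: "f v \<in> U (rel v)" by (rule chainsD(1)[OF f])
    show ?thesis
    proof (cases "S \<subseteq> arcs L \<and> inj_on (cls (rel v)) S")
      case True
      let ?r = "\<lambda>Z :: 'a set. SOME x. x \<in> Z"
      have mem: "cls (rel v) x \<in> circles L v" if "x \<in> S" for x
        using True that unfolding circles_eq by (intro quotientI) auto
      then have "(v, cls (rel v) ` S) \<in> kh_states L" using v by (auto simp: kh_states_def)
      then have "pair (unpair f) v S = f v ((\<lambda>x. ?r (cls (rel v) x)) ` S)"
        using v True by (simp add: pair_def pairing_def unpair_def image_image)
      also have "\<dots> = f v S"
      proof (rule U_replace[OF U equiv_rel])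
        show "S \<subseteq> arcs L" "inj_on (cls (rel v)) S" using True by auto
        fix x assume "x \<in> S"
        then show "(x, ?r (cls (rel v) x)) \<in> rel v" using representative(1)[OF mem] by blast
      qed
      finally show ?thesis .
    next
      case False
      have "f v S = 0"
      proof (rule ccontr)
        assume nz: "f v S \<noteq> 0"
        then have S: "S \<subseteq> arcs L" by (rule U_support[OF U])
        then obtain x y where xy: "x \<in> S" "y \<in> S" "x \<noteq> y" "cls (rel v) x = cls (rel v) y"
          using False by (auto simp: inj_on_def)
        then have "(x, y) \<in> rel v" using eq_equiv_class_iff[OF equiv_rel, of x y v] S by blast
        then show False using U_meets_twice[OF U _ xy(3,1,2)] nz by blast
      qed
      then show ?thesis using False v by (auto simp: pair_def pairing_def)
    qed
  qed
  then show ?thesis by (simp add: fun_eq_iff)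
qed

lemma unpair_supported:
  assumes f: "f \<in> chains N rel m"
  shows "unpair f \<in> kh_supported (m - int (n_minus L))"
  unfolding kh_supported_def
proof (intro CollectI allI impI)
  fix s assume nz: "unpair f s \<noteq> 0"
  then have s: "s \<in> kh_states L" by (auto simp: unpair_def split: if_splits)
  have "f (fst s) \<noteq> 0" using nz s by (auto simp: unpair_def)
  then have "int (card (fst s)) = m" by (rule chainsD(3)[OF f])
  then show "s \<in> kh_states L \<and> hom_degree L s = m - int (n_minus L)"
    using s by (simp add: hom_degree_def split_beta)
qed

text \<open>Regroups the sum over all source states by the edges that enter \<open>w\<close>, the
  shape in which it can be compared with \<open>diff\<close> term by term.\<close>

lemma kh_differential_expand:
  assumes w: "w \<subseteq> N" and Q: "Q \<subseteq> circles L w"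
  shows "kh_differential L c (w, Q) = (\<Sum>k\<in>w. sgn (w - {k}) k *
    (\<Sum>P\<in>Pow (circles L (w - {k})). if edge_term (circles L (w - {k})) P (circles L w) Q
      then c (w - {k}, P) else 0))"
proof -
  let ?T = "\<lambda>v. \<Sum>P\<in>Pow (circles L v). if edge_term (circles L v) P (circles L w) Q then c (v, P) else 0"
  have "kh_differential L c (w, Q)
      = (\<Sum>v\<in>Pow N. \<Sum>P\<in>Pow (circles L v). kh_coeff L (v, P) (w, Q) * c (v, P))"
    unfolding kh_differential_def kh_states_eq using finite_circles
    by (subst sum.Sigma) (auto intro!: sum.cong)
  also have "\<dots> = (\<Sum>v\<in>Pow N. \<Sum>k\<in>N - v. if w = insert k v then sgn v k * ?T v else 0)"
  proof (rule sum.cong[OF refl])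
    fix v
    have "(\<Sum>P\<in>Pow (circles L v). kh_coeff L (v, P) (w, Q) * c (v, P))
      = (\<Sum>P\<in>Pow (circles L v). \<Sum>k\<in>N - v. if w = insert k v then
          sgn v k * (if edge_term (circles L v) P (circles L w) Q then c (v, P) else 0) else 0)"
      using Q by (auto simp: kh_coeff_def sum_distrib_right intro!: sum.cong)
    also have "\<dots> = (\<Sum>k\<in>N - v. \<Sum>P\<in>Pow (circles L v). if w = insert k v then
          sgn v k * (if edge_term (circles L v) P (circles L w) Q then c (v, P) else 0) else 0)"
      by (rule sum.swap)
    also have "\<dots> = (\<Sum>k\<in>N - v. if w = insert k v then sgn v k * ?T v else 0)"
      by (intro sum.cong refl) (simp add: sum_distrib_left)
    finally show "(\<Sum>P\<in>Pow (circles L v). kh_coeff L (v, P) (w, Q) * c (v, P))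
      = (\<Sum>k\<in>N - v. if w = insert k v then sgn v k * ?T v else 0)" .
  qed
  also have "\<dots> = (\<Sum>x\<in>(SIGMA v:Pow N. N - v).
      if w = insert (snd x) (fst x) then sgn (fst x) (snd x) * ?T (fst x) else 0)"
    by (subst sum.Sigma) (auto simp: split_def)
  also have "\<dots> = (\<Sum>x\<in>{x \<in> (SIGMA v:Pow N. N - v). w = insert (snd x) (fst x)}.
      sgn (fst x) (snd x) * ?T (fst x))"
    by (rule sum.inter_filter[symmetric]) auto
  also have "\<dots> = (\<Sum>k\<in>w. sgn (w - {k}) k * ?T (w - {k}))"
  proof (rule sum.reindex_bij_witness[where i = "\<lambda>k. (w - {k}, k)" and j = snd])
    fix x assume x: "x \<in> {x \<in> (SIGMA v:Pow N. N - v). w = insert (snd x) (fst x)}"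
    then have eq: "w - {snd x} = fst x" by auto
    show "(w - {snd x}, snd x) = x"
      "sgn (w - {snd x}) (snd x) * ?T (w - {snd x}) = sgn (fst x) (snd x) * ?T (fst x)"
      unfolding eq by simp_all
    show "snd x \<in> w" using x by auto
  qed (use w in auto)
  finally show ?thesis .
qed

lemma kh_differential_supported:
  assumes "kh_differential L c t \<noteq> 0"
  shows "t \<in> kh_states L"
proof -
  obtain w Q where t: "t = (w, Q)" by fastforce
  obtain s where "s \<in> kh_states L" "kh_coeff L s t * c s \<noteq> 0"
    using assms unfolding kh_differential_def by (meson sum.neutral)
  then obtain v P where "kh_coeff L (v, P) (w, Q) \<noteq> (0 :: 'b)" and v: "v \<subseteq> N"
    by (cases s) (auto simp: t kh_states_def)
  moreover have "kh_coeff L (v, P) (w, Q) = (0 :: 'b)"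
    if "\<not> (\<exists>k\<in>N - v. w = insert k v \<and> Q \<subseteq> circles L w)"
    unfolding kh_coeff_def case_prod_conv by (rule sum.neutral) (use that in auto)
  ultimately obtain k where "k \<in> N - v" "w = insert k v" "Q \<subseteq> circles L w" by blast
  then show ?thesis using v by (auto simp: t kh_states_def)
qed

text \<open>On sets that meet each circle of \<open>w\<close> at most once, the edges are compared
  through \<open>merge_map_pairing\<close> and \<open>pairing_split\<close>. On the others both
  sides vanish, since every edge ends in \<open>U (rel w)\<close>.\<close>

lemma pair_differential: "pair (kh_differential L c) = diff N rel sgn (pair c)"
proof -
  have "pair (kh_differential L c) w S = diff N rel sgn (pair c) w S" for w S
  proof (cases "w \<subseteq> N")
    case False
    have "pair c (w - {k}) = 0" if "k \<in> N" for k using False that by (auto simp: pair_def)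
    then show ?thesis using False by (simp add: pair_def diff_def)
  next
    case w: True
    then have wN: "w \<inter> N = w" by auto
    have edge_U: "edge (rel (w - {k})) k (pair c (w - {k})) \<in> U (rel w)" if "k \<in> w" for k
    proof -
      have "insert k (w - {k}) = w" using that by auto
      then show ?thesis
        using edge_in_U[OF cube_rel, of k "w - {k}" "pair c (w - {k})"] that w pair_in_U by auto
    qed
    show ?thesis
    proof (cases "S \<subseteq> arcs L \<and> inj_on (cls (rel w)) S")
      case False
      have "edge (rel (w - {k})) k (pair c (w - {k})) S = 0" if k: "k \<in> w" for k
      proof (rule ccontr)
        assume nz: "edge (rel (w - {k})) k (pair c (w - {k})) S \<noteq> 0"
        then have S: "S \<subseteq> arcs L" by (rule U_support[OF edge_U[OF k]])
        then obtain x y where xy: "x \<in> S" "y \<in> S" "x \<noteq> y" "cls (rel w) x = cls (rel w) y"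
          using False by (auto simp: inj_on_def)
        then have "(x, y) \<in> rel w" using eq_equiv_class_iff[OF equiv_rel, of x y w] S by blast
        then show False using U_meets_twice[OF edge_U[OF k] _ xy(3,1,2)] nz by blast
      qed
      then show ?thesis using False w by (auto simp: pair_def pairing_def diff_def wN)
    next
      case S: True
      have Q: "cls (rel w) ` S \<subseteq> circles L w" using S unfolding circles_eq by (auto intro: quotientI)
      have "edge (rel (w - {k})) k (pair c (w - {k})) S
        = (\<Sum>P\<in>Pow (circles L (w - {k})). if edge_term (circles L (w - {k})) P (circles L w) (cls (rel w) ` S)
            then c (w - {k}, P) else 0)" if k: "k \<in> w" for k
      proof -
        let ?v = "w - {k}"
        have kv: "k < n" "k \<notin> ?v" "insert k ?v = w" and v: "?v \<subseteq> N" using k w by auto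
        from rel_joined[OF kv(1,2)] show ?thesis
          unfolding kv(3)
        proof
          assume j: "joined k (rel ?v) (rel w)"
          then have "(dart_arc L (k, 0), dart_arc L (k, 2)) \<notin> rel ?v" by (simp add: joined_def)
          then show ?thesis
            using merge_map_pairing[OF equiv_rel j legs_in_arcs[OF kv(1)], of S "\<lambda>P. c (?v, P)"] S v
            by (simp add: edge_def pair_def circles_eq)
        next
          assume j: "joined k (rel w) (rel ?v)"
          then have "(dart_arc L (k, 0), dart_arc L (k, 2)) \<in> rel ?v"
            by (rule joined_mem[OF _ equiv_rel legs_in_arcs[OF kv(1)]])
          then show ?thesis
            using pairing_split[OF equiv_rel j legs_in_arcs[OF kv(1)] equiv_rel, of S "\<lambda>P. c (?v, P)"] S v
            by (simp add: edge_def pair_def circles_eq)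
        qed
      qed
      then show ?thesis
        using S w by (simp add: pair_def pairing_def diff_def wN kh_differential_expand[OF w Q])
    qed
  qed
  then show ?thesis by (simp add: fun_eq_iff)
qed

lemma kh_homology_bound:
  obtains \<phi> :: "nat \<Rightarrow> ('a kh_state \<Rightarrow> 'f::field) \<Rightarrow> 'f"
  where "\<And>j x y. \<phi> j (x + y) = \<phi> j x + \<phi> j y" "\<And>j c x. \<phi> j (scale c x) = c * \<phi> j x"
    "\<And>z. z \<in> kh_supported i \<Longrightarrow> kh_differential L z = 0
      \<Longrightarrow> \<forall>j<2 * int_binomial (int n) (i + int (n_minus L)). \<phi> j z = 0
      \<Longrightarrow> \<exists>w\<in>kh_supported (i - 1). kh_differential L w = z"
proof -
  let ?m = "i + int (n_minus L)" and ?sgn = "sgn :: nat set \<Rightarrow> nat \<Rightarrow> 'f"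
  have "homology_bound N rel ?sgn ?m (2 * int_binomial (int (card N)) ?m)"
    by (rule homology_bound_connected[OF cube_rel anticommuting_standard_signs[OF cube_rel] _ connected_rel]) simp
  then have b: "homology_bound N rel ?sgn ?m (2 * int_binomial (int n) ?m)" by simp
  obtain \<phi> h where lin: "\<And>j. linear_functional (\<phi> j)" "linear_operator h"
    and h: "\<And>z. z \<in> chains N rel ?m \<Longrightarrow> diff N rel ?sgn z = 0
      \<Longrightarrow> \<forall>j<2 * int_binomial (int n) ?m. \<phi> j z = 0
      \<Longrightarrow> h z \<in> chains N rel (?m - 1) \<and> diff N rel ?sgn (h z) = z"
    by (rule homology_boundE[OF b]) (rule that)
  show ?thesis
  proof (rule that[of "\<lambda>j z. \<phi> j (pair z)"])
    show "\<phi> j (pair (x + y)) = \<phi> j (pair x) + \<phi> j (pair y)" for j x y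
      using lin(1)[of j] unfolding linear_functional_def linear_pair by blast
    show "\<phi> j (pair (scale c x)) = c * \<phi> j (pair x)" for j c x
      using lin(1)[of j] unfolding linear_functional_def linear_pair by blast
    fix z :: "'a kh_state \<Rightarrow> 'f"
    assume z: "z \<in> kh_supported i" and dz: "kh_differential L z = 0"
      and \<phi>: "\<forall>j<2 * int_binomial (int n) ?m. \<phi> j (pair z) = 0"
    have "pair (0 :: 'a kh_state \<Rightarrow> 'f) = 0" by (simp add: pair_def pairing_def fun_eq_iff)
    then have "diff N rel ?sgn (pair z) = 0" using pair_differential[of z] dz by simp
    with h[OF pair_in_chains[OF z]] \<phi>
    have y: "h (pair z) \<in> chains N rel (?m - 1)" "diff N rel ?sgn (h (pair z)) = pair z" by blast+
    let ?w = "unpair (h (pair z))"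
    have "pair (kh_differential L ?w) = pair z"
      unfolding pair_differential pair_unpair[OF y(1)] by (rule y(2))
    then have "unpair (pair (kh_differential L ?w)) = unpair (pair z)" by simp
    moreover have "unpair (pair (kh_differential L ?w)) = kh_differential L ?w"
      by (rule unpair_pair) (rule kh_differential_supported)
    moreover have "unpair (pair z) = z" by (rule unpair_pair) (rule kh_supportedD(1)[OF z])
    ultimately have "kh_differential L ?w = z" by simp
    moreover have "?w \<in> kh_supported (i - 1)" using unpair_supported[OF y(1)] by (simp add: algebra_simps)
    ultimately show "\<exists>w\<in>kh_supported (i - 1). kh_differential L w = z" by blast
  qed
qed

end

section \<open>Dimension of Khovanov homology\<close>

definition linear_subspace :: "('s \<Rightarrow> 'f::field) set \<Rightarrow> bool" where
  "linear_subspace W \<longleftrightarrow> 0 \<in> W \<and> (\<forall>x\<in>W. \<forall>y\<in>W. x + y \<in> W) \<and> (\<forall>c. \<forall>x\<in>W. scale c x \<in> W)"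

definition linear_form :: "(('s \<Rightarrow> 'f::field) \<Rightarrow> 'f) \<Rightarrow> bool" where
  "linear_form \<phi> \<longleftrightarrow> (\<forall>x y. \<phi> (x + y) = \<phi> x + \<phi> y) \<and> (\<forall>c x. \<phi> (scale c x) = c * \<phi> x)"

lemma linear_subspaceD:
  assumes "linear_subspace W"
  shows "0 \<in> W" "x \<in> W \<Longrightarrow> y \<in> W \<Longrightarrow> x + y \<in> W" "x \<in> W \<Longrightarrow> scale c x \<in> W"
  using assms by (auto simp: linear_subspace_def)

lemma linear_formD:
  assumes "linear_form \<phi>"
  shows "\<phi> (x + y) = \<phi> x + \<phi> y" "\<phi> (scale c x) = c * \<phi> x" "\<phi> 0 = 0"
proof -
  show "\<phi> (x + y) = \<phi> x + \<phi> y" and s: "\<phi> (scale c x) = c * \<phi> x" for c x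
    using assms by (auto simp: linear_form_def)
  have "\<phi> (scale 0 0) = 0 * \<phi> 0" by (rule s)
  moreover have "scale 0 0 = (0 :: 'a \<Rightarrow> 'b)" by (simp add: fun_eq_iff)
  ultimately show "\<phi> 0 = 0" by simp
qed

text \<open>A kernel of \<open>N\<close> functionals has codimension at most \<open>N\<close>,
  stated as generation of \<open>Z\<close> by at most \<open>N\<close> elements and the kernel.
  Quantifying over subspaces \<open>W\<close> avoids quotients and bases, and suits a preimage of a
  span.\<close>

lemma common_kernel_codimension:
  assumes "linear_subspace Z" "\<And>i. linear_form (\<phi> i)"
  shows "\<exists>G\<subseteq>Z. finite G \<and> card G \<le> N \<and>
    (\<forall>W. linear_subspace W \<longrightarrow> G \<subseteq> W \<longrightarrow> {z \<in> Z. \<forall>i<N. \<phi> i z = 0} \<subseteq> W \<longrightarrow> Z \<subseteq> W)"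
  using assms
proof (induction N arbitrary: Z)
  case 0
  show ?case by (rule exI[of _ "{}"]) simp
next
  case (Suc N)
  let ?Z' = "{z \<in> Z. \<phi> N z = 0}"
  have form: "\<phi> i (x + y) = \<phi> i x + \<phi> i y" "\<phi> i (scale c x) = c * \<phi> i x" "\<phi> i 0 = 0" for i c x y
    by (rule linear_formD[OF Suc.prems(2)])+
  have sub: "linear_subspace ?Z'"
    using linear_subspaceD[OF Suc.prems(1)] by (auto simp: linear_subspace_def form)
  from Suc.IH[OF sub Suc.prems(2)]
  obtain G where G: "G \<subseteq> ?Z'" "finite G" "card G \<le> N"
    and gen: "\<forall>W. linear_subspace W \<longrightarrow> G \<subseteq> W \<longrightarrow> {z \<in> ?Z'. \<forall>i<N. \<phi> i z = 0} \<subseteq> W \<longrightarrow> ?Z' \<subseteq> W"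
    by (elim exE conjE) (rule that)
  have ker: "{z \<in> ?Z'. \<forall>i<N. \<phi> i z = 0} = {z \<in> Z. \<forall>i<Suc N. \<phi> i z = 0}"
    by (auto simp: less_Suc_eq)
  show ?case
  proof (cases "\<exists>z0\<in>Z. \<phi> N z0 \<noteq> 0")
    case True
    then obtain z0 where z0: "z0 \<in> Z" "\<phi> N z0 \<noteq> 0" by blast
    show ?thesis
    proof (intro exI[of _ "insert z0 G"] conjI allI impI)
      show "insert z0 G \<subseteq> Z" using G z0 by auto
      show "finite (insert z0 G)" using G by simp
      show "card (insert z0 G) \<le> Suc N" using G by (simp add: card_insert_if)
      fix W assume W: "linear_subspace W" "insert z0 G \<subseteq> W" "{z \<in> Z. \<forall>i<Suc N. \<phi> i z = 0} \<subseteq> W"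
      have Z'W: "?Z' \<subseteq> W"
        by (rule gen[rule_format, OF W(1)]) (use W(2,3) in \<open>simp_all only: ker insert_subset\<close>)
      show "Z \<subseteq> W"
      proof
        fix z assume z: "z \<in> Z"
        \<comment> \<open>The multiple of \<open>z0\<close> whose removal from \<open>z\<close> puts
          it into the kernel of the last functional.\<close>
        let ?c = "\<phi> N z / \<phi> N z0"
        have "z + scale (- ?c) z0 \<in> ?Z'"
          using z z0 linear_subspaceD[OF Suc.prems(1)] by (simp add: form)
        then have "(z + scale (- ?c) z0) + scale ?c z0 \<in> W"
          using Z'W W(2) linear_subspaceD[OF W(1)] by blast
        moreover have "(z + scale (- ?c) z0) + scale ?c z0 = z" by (simp add: fun_eq_iff)
        ultimately show "z \<in> W" by simp
      qed
    qed
  next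
    case False
    then have Z: "?Z' = Z" by auto
    show ?thesis
    proof (intro exI[of _ G] conjI allI impI)
      show "G \<subseteq> Z" "finite G" "card G \<le> Suc N" using G by auto
      fix W assume "linear_subspace W" "G \<subseteq> W" "{z \<in> Z. \<forall>i<Suc N. \<phi> i z = 0} \<subseteq> W"
      then show "Z \<subseteq> W" using gen[rule_format, of W] unfolding ker by (simp only: Z)
    qed
  qed
qed

text \<open>The homology is given as a bare record of operations. The vector space axioms are
  transferred to it along a surjection from a space of functions, where they are evident.\<close>

locale linear_image =
  fixes Z :: "('s \<Rightarrow> 'f::field) set" and V :: "('f, 'w) module" and T :: "('s \<Rightarrow> 'f) \<Rightarrow> 'w"
  assumes Z: "linear_subspace Z" and image: "T ` Z = carrier V"
    and T_add: "x \<in> Z \<Longrightarrow> y \<in> Z \<Longrightarrow> T (x + y) = T x \<oplus>\<^bsub>V\<^esub> T y"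
    and T_scale: "x \<in> Z \<Longrightarrow> T (scale c x) = c \<odot>\<^bsub>V\<^esub> T x"
    and T_zero: "T 0 = \<zero>\<^bsub>V\<^esub>"
begin

lemma T_carrier: "x \<in> Z \<Longrightarrow> T x \<in> carrier V"
  using image by blast

lemma T_cases: "a \<in> carrier V \<Longrightarrow> (\<And>x. x \<in> Z \<Longrightarrow> a = T x \<Longrightarrow> thesis) \<Longrightarrow> thesis"
  using image by blast

lemma abelian_group_V: "abelian_group V"
proof (rule abelian_groupI)
  fix a b c assume "a \<in> carrier V" "b \<in> carrier V" "c \<in> carrier V"
  then obtain x y z where xyz: "x \<in> Z" "a = T x" "y \<in> Z" "b = T y" "z \<in> Z" "c = T z"
    using image by (metis imageE)
  note Zs = linear_subspaceD[OF Z]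
  show "a \<oplus>\<^bsub>V\<^esub> b \<in> carrier V" using xyz by (simp add: T_add[symmetric] T_carrier Zs)
  show "a \<oplus>\<^bsub>V\<^esub> b \<oplus>\<^bsub>V\<^esub> c = a \<oplus>\<^bsub>V\<^esub> (b \<oplus>\<^bsub>V\<^esub> c)"
    using xyz by (simp add: T_add[symmetric] Zs add.assoc)
  show "a \<oplus>\<^bsub>V\<^esub> b = b \<oplus>\<^bsub>V\<^esub> a" using xyz by (simp add: T_add[symmetric] add.commute)
next
  show "\<zero>\<^bsub>V\<^esub> \<in> carrier V" using T_carrier[OF linear_subspaceD(1)[OF Z]] by (simp add: T_zero)
next
  fix a assume "a \<in> carrier V"
  then obtain x where x: "x \<in> Z" "a = T x" by (rule T_cases)
  show "\<zero>\<^bsub>V\<^esub> \<oplus>\<^bsub>V\<^esub> a = a"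
    using x T_add[OF linear_subspaceD(1)[OF Z] x(1)] by (simp add: T_zero)
  have "T (scale (- 1) x + x) = T (scale (- 1) x) \<oplus>\<^bsub>V\<^esub> a"
    using x by (simp add: T_add linear_subspaceD[OF Z])
  moreover have "scale (- 1) x + x = 0" by (simp add: fun_eq_iff)
  ultimately show "\<exists>y\<in>carrier V. y \<oplus>\<^bsub>V\<^esub> a = \<zero>\<^bsub>V\<^esub>"
    using x T_carrier[OF linear_subspaceD(3)[OF Z x(1)]] T_zero by metis
qed

lemma module_V: "module class_ring V"
proof (rule moduleI)
  show "cring (class_ring :: 'f ring)" by (rule domain.axioms(1)[OF field.axioms(1)[OF class_field.field_axioms]])
  show "abelian_group V" by (rule abelian_group_V)
  note Zs = linear_subspaceD[OF Z]
  fix c d :: 'f and a assume "a \<in> carrier V"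
  then obtain x where x: "x \<in> Z" "a = T x" by (rule T_cases)
  show "c \<odot>\<^bsub>V\<^esub> a \<in> carrier V" using x by (simp add: T_scale[symmetric] T_carrier Zs)
  have 1: "scale (c + d) x = scale c x + scale d x" "scale (c * d) x = scale c (scale d x)" "scale 1 x = x"
    by (simp_all add: fun_eq_iff algebra_simps)
  show "(c \<oplus>\<^bsub>class_ring\<^esub> d) \<odot>\<^bsub>V\<^esub> a = c \<odot>\<^bsub>V\<^esub> a \<oplus>\<^bsub>V\<^esub> d \<odot>\<^bsub>V\<^esub> a"
    using x by (simp add: T_scale[symmetric] T_add[symmetric] Zs 1)
  show "(c \<otimes>\<^bsub>class_ring\<^esub> d) \<odot>\<^bsub>V\<^esub> a = c \<odot>\<^bsub>V\<^esub> (d \<odot>\<^bsub>V\<^esub> a)"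
    using x by (simp add: T_scale[symmetric] Zs 1)
  show "\<one>\<^bsub>class_ring\<^esub> \<odot>\<^bsub>V\<^esub> a = a"
    using x by (simp add: T_scale[symmetric] 1)
  fix b assume "b \<in> carrier V"
  then obtain y where y: "y \<in> Z" "b = T y" by (rule T_cases)
  have "scale c (x + y) = scale c x + scale c y" by (simp add: fun_eq_iff algebra_simps)
  then show "c \<odot>\<^bsub>V\<^esub> (a \<oplus>\<^bsub>V\<^esub> b) = c \<odot>\<^bsub>V\<^esub> a \<oplus>\<^bsub>V\<^esub> c \<odot>\<^bsub>V\<^esub> b"
    using x y by (simp add: T_scale[symmetric] T_add[symmetric] Zs)
qed

text \<open>The common kernel is mapped to zero, so the images of the at most \<open>N\<close>
  complementary generators span \<open>V\<close>.\<close>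

lemma dim_le:
  assumes \<phi>: "\<And>i. linear_form (\<phi> i)"
    and ker: "\<And>z. z \<in> Z \<Longrightarrow> \<forall>i<N. \<phi> i z = 0 \<Longrightarrow> T z = \<zero>\<^bsub>V\<^esub>"
  shows "vectorspace.dim (class_ring :: 'f ring) V \<le> N"
proof -
  interpret V: vectorspace "class_ring :: 'f ring" V
    by (rule vectorspace.intro[OF module_V class_field.field_axioms])
  from common_kernel_codimension[where \<phi> = \<phi> and N = N, OF Z \<phi>]
  obtain G where G: "G \<subseteq> Z" "finite G" "card G \<le> N"
    and gen: "\<forall>W. linear_subspace W \<longrightarrow> G \<subseteq> W \<longrightarrow> {z \<in> Z. \<forall>i<N. \<phi> i z = 0} \<subseteq> W \<longrightarrow> Z \<subseteq> W"
    by (elim exE conjE) (rule that)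
  have TG: "T ` G \<subseteq> carrier V" using G(1) image by blast
  interpret span: LinearCombinations.submodule "class_ring :: 'f ring" "V.span (T ` G)" V
    by (rule V.span_is_submodule[OF TG])
  let ?W = "{z \<in> Z. T z \<in> V.span (T ` G)}"
  note Zs = linear_subspaceD[OF Z]
  have "linear_subspace ?W"
    unfolding linear_subspace_def
    using span.smult_closed by (auto simp: Zs T_add T_scale T_zero)
  moreover have "G \<subseteq> ?W" using G(1) V.in_own_span[OF TG] by blast
  moreover have "{z \<in> Z. \<forall>i<N. \<phi> i z = 0} \<subseteq> ?W" using ker by auto
  ultimately have "Z \<subseteq> ?W" by (rule gen[rule_format])
  then have "T ` Z \<subseteq> V.span (T ` G)" by auto
  then have "V.span (T ` G) = carrier V" using span.subset unfolding image by (rule equalityI[rotated])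
  \<comment> \<open>\<open>V.dim\<close> is the least size of a finite generating set, so the
    generating set just found bounds it.\<close>
  then have "V.dim \<le> card (T ` G)"
    unfolding V.dim_def using TG G(2) by (intro Least_le exI[of _ "T ` G"]) auto
  also have "\<dots> \<le> N" using card_image_le[OF G(2), of T] G(3) by simp
  finally show ?thesis .
qed

end

section \<open>Quantum degrees and the quotient modules\<close>

context plane_diagram
begin

text \<open>Apart from constants, the degree is twice the number of labels \<open>v\<^sub>+\<close>,
  minus the number of circles, plus the size of \<open>v\<close>. A merge loses one label
  \<open>v\<^sub>+\<close> and one circle; a split keeps the number of labels
  \<open>v\<^sub>+\<close> and gains a circle. In both cases the new element of \<open>v\<close>
  restores the balance.\<close>

lemma q_degree_edge:
  assumes v: "v \<subseteq> N" and k: "k \<in> N - v" and P: "P \<subseteq> circles L v" and Q: "Q \<subseteq> circles L (insert k v)"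
    and e: "edge_term (circles L v) P (circles L (insert k v)) Q"
  shows "q_degree L (v, P) = q_degree L (insert k v, Q)"
proof -
  let ?C = "circles L v" and ?C' = "circles L (insert k v)"
  have fin: "finite ?C" "finite ?C'" by (rule finite_circles)+
  have fins: "finite P" "finite Q" "finite v"
    using finite_subset[OF P fin(1)] finite_subset[OF Q fin(2)] finite_subset[OF v] by auto
  have q: "q_degree L (u, R) = 2 * int (card R) - int (card (circles L u)) + int (card u) + int (n_plus L) - 2 * int (n_minus L)"
    if "R \<subseteq> circles L u" for u R
  proof -
    have "card (circles L u - R) = card (circles L u) - card R" "card R \<le> card (circles L u)"
      using that finite_circles finite_subset[OF that] by (auto intro: card_Diff_subset card_mono)
    then show ?thesis by (simp add: q_degree_def)
  qed
  have cv: "int (card (insert k v)) = int (card v) + 1" using k fins(3) by simp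
  define Q0 where "Q0 = Q \<inter> ?C"
  have Q0: "Q0 \<subseteq> ?C" "Q0 \<subseteq> ?C'" "finite Q0" using Q fins(2) by (auto simp: Q0_def)
  have kn: "k < n" "k \<notin> v" using k by auto
  note pq = legs_in_arcs[OF kn(1)]
  from rel_joined[OF kn] show ?thesis
  proof
    assume j: "joined k (rel v) (rel (insert k v))"
    obtain A B where AB: "A \<noteq> B" "?C - ?C' = {A, B}" "?C' - ?C = {A \<union> B}"
      using joined_quotient(1-3)[OF equiv_rel j pq] unfolding circles_eq by metis
    have notin: "A \<notin> Q0" "B \<notin> Q0" "A \<union> B \<notin> Q0"
      using AB(2,3) Q0(1,2) by (metis Diff_iff insertI1 insertI2 subsetD)+
    have card: "int (card ?C) = int (card ?C') + 1"
      using joined_card[OF equiv_rel equiv_rel j pq] by (simp add: circles_eq)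
    have "Q - ?C \<subseteq> {A \<union> B}" using Q AB(3) by blast
    then consider "Q = Q0" | "Q = insert (A \<union> B) Q0" unfolding Q0_def by blast
    then have "int (card P) = int (card Q) + 1"
    proof cases
      case 1
      then have "P \<in> {P \<in> Pow ?C. edge_term ?C P ?C' Q0}" using P e by simp
      then have "P = insert A Q0 \<or> P = insert B Q0"
        unfolding edge_terms_merge(1)[OF AB Q0(1,2)] by simp
      then show ?thesis using 1 notin Q0(3) by auto
    next
      case 2
      then have "P \<in> {P \<in> Pow ?C. edge_term ?C P ?C' (insert (A \<union> B) Q0)}" using P e by simp
      then have "P = insert A (insert B Q0)"
        unfolding edge_terms_merge(2)[OF AB Q0(1,2)] by simp
      then show ?thesis using 2 notin Q0(3) AB(1) by auto
    qed
    then show ?thesis using card cv by (simp add: q[OF P] q[OF Q])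
  next
    assume j: "joined k (rel (insert k v)) (rel v)"
    obtain A B where AB: "A \<noteq> B" "?C - ?C' = {A \<union> B}" "?C' - ?C = {A, B}"
      using joined_quotient(1-3)[OF equiv_rel j pq] unfolding circles_eq by metis
    have notin: "A \<notin> Q0" "B \<notin> Q0" "A \<union> B \<notin> Q0"
      using AB(2,3) Q0(1,2) by (metis Diff_iff insertI1 insertI2 subsetD)+
    have card: "int (card ?C') = int (card ?C) + 1"
      using joined_card[OF equiv_rel equiv_rel j pq] by (simp add: circles_eq)
    define Y where "Y = Q - ?C"
    have Y: "Y \<subseteq> {A, B}" and QY: "Q = Q0 \<union> Y" using Q AB(3) unfolding Y_def Q0_def by blast+
    have "P \<in> {P \<in> Pow ?C. edge_term ?C P ?C' (Q0 \<union> Y)}" using P e QY by simp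
    then have PY: "P \<in> (if Y = {A, B} then {} else if Y = {} then {Q0} else {insert (A \<union> B) Q0})"
      unfolding edge_terms_split[OF AB Q0(1,2) Y] .
    have "Y \<in> Pow {A, B}" using Y by simp
    then consider "Y = {}" | "Y = {A}" | "Y = {B}" | "Y = {A, B}" unfolding Pow_doubleton by blast
    then have "int (card P) = int (card Q)"
      by cases (use PY QY notin Q0(3) AB(1) in \<open>simp_all add: doubleton_eq_iff\<close>)
    then show ?thesis using card cv by (simp add: q[OF P] q[OF Q])
  qed
qed

lemma q_degree_kh_coeff:
  assumes "s \<in> kh_states L" "kh_coeff L s t \<noteq> (0 :: 'f::field)"
  shows "q_degree L s = q_degree L t"
proof -
  obtain v P w Q where s: "s = (v, P)" and t: "t = (w, Q)" by fastforce
  have vP: "v \<subseteq> N" "P \<subseteq> circles L v" using assms(1) by (auto simp: s kh_states_def)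
  have "kh_coeff L (v, P) (w, Q) = (0 :: 'f)"
    if "\<not> (\<exists>k\<in>N - v. w = insert k v \<and> Q \<subseteq> circles L w \<and> edge_term (circles L v) P (circles L w) Q)"
    unfolding kh_coeff_def case_prod_conv by (rule sum.neutral) (use that in auto)
  then obtain k where "k \<in> N - v" "w = insert k v" "Q \<subseteq> circles L w"
    "edge_term (circles L v) P (circles L w) Q"
    using assms(2) unfolding s t by blast
  then show ?thesis unfolding s t using q_degree_edge vP by blast
qed

definition q_part :: "int \<Rightarrow> ('a kh_state \<Rightarrow> 'f::field) \<Rightarrow> 'a kh_state \<Rightarrow> 'f" where
  "q_part j c s = (if q_degree L s = j then c s else 0)"

lemma q_part_add: "q_part j (x + y) = q_part j x + q_part j y"
  by (simp add: q_part_def fun_eq_iff)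

lemma q_part_scale: "q_part j (scale a x) = scale a (q_part j x)"
  by (simp add: q_part_def fun_eq_iff)

lemma q_part_zero: "q_part j 0 = 0"
  by (simp add: q_part_def fun_eq_iff)

text \<open>Lets the bound be proved for chains of mixed quantum degree: the homogeneous parts of a
  cycle are cycles, and those of a primitive are primitives.\<close>

lemma q_part_differential: "q_part j (kh_differential L c) = kh_differential L (q_part j c)"
proof
  fix t
  have "kh_coeff L s t * q_part j c s = (if q_degree L t = j then kh_coeff L s t * c s else 0)"
    if "s \<in> kh_states L" for s
    using q_degree_kh_coeff[OF that, of t, where 'f = 'b]
    by (cases "kh_coeff L s t = (0 :: 'b)") (auto simp: q_part_def)
  then have "kh_differential L (q_part j c) t
    = (\<Sum>s\<in>kh_states L. if q_degree L t = j then kh_coeff L s t * c s else 0)"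
    unfolding kh_differential_def by (rule sum.cong[OF refl])
  then show "q_part j (kh_differential L c) t = kh_differential L (q_part j c) t"
    by (simp add: q_part_def kh_differential_def)
qed

lemma kh_differential_add: "kh_differential L (x + y) = kh_differential L x + kh_differential L y"
  by (simp add: kh_differential_def fun_eq_iff sum.distrib distrib_left)

lemma kh_differential_scale: "kh_differential L (scale a x) = scale a (kh_differential L x)"
  by (simp add: kh_differential_def fun_eq_iff sum_distrib_left mult_ac)

lemma kh_differential_zero: "kh_differential L 0 = 0"
  by (simp add: kh_differential_def fun_eq_iff)

lemma carrier_kh_chains:
  "c \<in> carrier (kh_chains L i j) \<longleftrightarrow>
    (\<forall>s. c s \<noteq> 0 \<longrightarrow> s \<in> kh_states L \<and> hom_degree L s = i \<and> q_degree L s = j)"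
  by (simp add: kh_chains_def)

lemma q_part_in_chains: "c \<in> kh_supported i \<Longrightarrow> q_part j c \<in> carrier (kh_chains L i j)"
  unfolding carrier_kh_chains using kh_supportedD by (auto simp: q_part_def split: if_splits)

lemma subspace_kh_chains: "linear_subspace (carrier (kh_chains L i j))"
  unfolding linear_subspace_def Ball_def carrier_kh_chains by (auto, (metis add.right_neutral)+)

lemma subspace_kh_boundaries: "linear_subspace (kh_boundaries L i j)"
proof -
  note C = linear_subspaceD[OF subspace_kh_chains[of "i - 1" j]]
  show ?thesis
    unfolding linear_subspace_def kh_boundaries_def
    using C by (auto simp: kh_differential_add[symmetric] kh_differential_scale[symmetric] intro!: imageI)
      (metis C(1) image_eqI kh_differential_zero)
qed

definition cycles_total :: "int \<Rightarrow> ('a kh_state \<Rightarrow> 'f::field) set" where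
  "cycles_total i = {z \<in> kh_supported i. kh_differential L z = 0}"

definition coset :: "int \<Rightarrow> int \<Rightarrow> ('a kh_state \<Rightarrow> 'f::field) \<Rightarrow> ('a kh_state \<Rightarrow> 'f) set" where
  "coset i j a = (\<lambda>h. h + a) ` kh_boundaries L i j"

lemma coset_eq: "kh_boundaries L i j +>\<^bsub>(kh_chains L i j)\<lparr>carrier := Z\<rparr>\<^esub> a = coset i j a"
  by (auto simp: a_r_coset_def r_coset_def coset_def kh_chains_def plus_fun_def)

lemma Kh_simps:
  "carrier (Kh L i j) = coset i j ` kh_cycles L i j"
  "\<zero>\<^bsub>Kh L i j\<^esub> = kh_boundaries L i j"
  "X \<oplus>\<^bsub>Kh L i j\<^esub> Y = {x + y |x y. x \<in> X \<and> y \<in> Y}"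
  "c \<odot>\<^bsub>Kh L i j\<^esub> X = (\<Union>x\<in>X. coset i j (scale c x))"
proof -
  show "carrier (Kh L i j) = coset i j ` kh_cycles L i j"
    unfolding Kh_def quotient_module_def A_RCOSETS_def RCOSETS_def
    by (auto simp: coset_def r_coset_def kh_chains_def plus_fun_def)
  show "\<zero>\<^bsub>Kh L i j\<^esub> = kh_boundaries L i j" by (simp add: Kh_def quotient_module_def)
  show "X \<oplus>\<^bsub>Kh L i j\<^esub> Y = {x + y |x y. x \<in> X \<and> y \<in> Y}"
    by (auto simp: Kh_def quotient_module_def set_add_def set_mult_def kh_chains_def plus_fun_def)
  show "c \<odot>\<^bsub>Kh L i j\<^esub> X = (\<Union>x\<in>X. coset i j (scale c x))"
    by (simp add: Kh_def quotient_module_def coset_eq) (simp add: kh_chains_def scale_def)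
qed

lemma coset_add: "coset i j (a + b) = {x + y |x y. x \<in> coset i j a \<and> y \<in> coset i j b}"
proof -
  note B = linear_subspaceD[OF subspace_kh_boundaries[of i j]]
  show ?thesis
  proof
    show "coset i j (a + b) \<subseteq> {x + y |x y. x \<in> coset i j a \<and> y \<in> coset i j b}"
    proof
      fix u assume "u \<in> coset i j (a + b)"
      then obtain h where h: "h \<in> kh_boundaries L i j" "u = h + (a + b)" by (auto simp: coset_def)
      then have "h + a \<in> coset i j a" "0 + b \<in> coset i j b" "u = (h + a) + (0 + b)"
        using B(1) by (auto simp: coset_def add.assoc)
      then show "u \<in> {x + y |x y. x \<in> coset i j a \<and> y \<in> coset i j b}" by blast
    qed
    show "{x + y |x y. x \<in> coset i j a \<and> y \<in> coset i j b} \<subseteq> coset i j (a + b)"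
    proof clarify
      fix x y assume "x \<in> coset i j a" "y \<in> coset i j b"
      then obtain h h' where h: "h \<in> kh_boundaries L i j" "h' \<in> kh_boundaries L i j" "x = h + a" "y = h' + b"
        by (auto simp: coset_def)
      then have "x + y = (h + h') + (a + b)" by (simp add: add_ac)
      then show "x + y \<in> coset i j (a + b)" unfolding coset_def using B(2)[OF h(1,2)] by (rule image_eqI)
    qed
  qed
qed

lemma coset_boundary:
  assumes "a \<in> kh_boundaries L i j"
  shows "coset i j a = kh_boundaries L i j"
proof -
  note B = linear_subspaceD[OF subspace_kh_boundaries[of i j]]
  have "h \<in> coset i j a" if h: "h \<in> kh_boundaries L i j" for h
  proof -
    have "h + scale (- 1) a \<in> kh_boundaries L i j" using B(2)[OF h B(3)[OF assms]] .
    then have "(h + scale (- 1) a) + a \<in> coset i j a" unfolding coset_def by (rule imageI)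
    moreover have "(h + scale (- 1) a) + a = h" by (simp add: fun_eq_iff)
    ultimately show ?thesis by simp
  qed
  then show ?thesis using B(2)[OF _ assms] by (auto simp: coset_def)
qed

text \<open>Scalar multiplication of the quotient is a union over all representatives of the class;
  each of them yields the same coset.\<close>

lemma coset_scale: "coset i j (scale c a) = (\<Union>x\<in>coset i j a. coset i j (scale c x))"
proof -
  note B = linear_subspaceD[OF subspace_kh_boundaries[of i j]]
  have "coset i j (scale c (h + a)) = coset i j (scale c a)" if "h \<in> kh_boundaries L i j" for h
  proof -
    have "scale c (h + a) = scale c h + scale c a" by (simp add: fun_eq_iff distrib_left)
    then have "coset i j (scale c (h + a)) = {x + y |x y. x \<in> kh_boundaries L i j \<and> y \<in> coset i j (scale c a)}"
      by (simp only: coset_add coset_boundary[OF B(3)[OF that]])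
    also have "\<dots> = coset i j (0 + scale c a)"
      unfolding coset_add coset_boundary[OF B(1)] ..
    finally show ?thesis by simp
  qed
  then show ?thesis using B(1) unfolding coset_def[of i j a] by auto
qed

lemma Kh_total_linear_image:
  "linear_image (cycles_total i :: ('a kh_state \<Rightarrow> 'f::field) set) (Kh_total L i) (\<lambda>z j. coset i j (q_part j z))"
proof
  let ?Z = "cycles_total i :: ('a kh_state \<Rightarrow> 'f) set" and ?T = "\<lambda>z j. coset i j (q_part j z)"
  show "linear_subspace ?Z"
    unfolding linear_subspace_def cycles_total_def kh_supported_def
    by (auto simp: kh_differential_add kh_differential_scale kh_differential_zero) (metis add.right_neutral)+
  have cycle: "q_part j z \<in> kh_cycles L i j" if "z \<in> ?Z" for j z
    using that q_part_in_chains q_part_differential[of j z, symmetric]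
    by (auto simp: cycles_total_def kh_cycles_def q_part_zero zero_fun_def[symmetric])
  show "?T ` ?Z = carrier (Kh_total L i)"
  proof
    show "?T ` ?Z \<subseteq> carrier (Kh_total L i)"
    proof (rule image_subsetI)
      fix z assume z: "z \<in> ?Z"
      have "{j. ?T z j \<noteq> kh_boundaries L i j} \<subseteq> q_degree L ` kh_states L"
      proof
        fix j assume j: "j \<in> {j. ?T z j \<noteq> kh_boundaries L i j}"
        have "q_part j z \<noteq> 0"
        proof
          assume 0: "q_part j z = 0"
          have "coset i j (q_part j z) = kh_boundaries L i j"
            unfolding 0 by (rule coset_boundary[OF linear_subspaceD(1)[OF subspace_kh_boundaries]])
          then show False using j by simp
        qed
        then have "\<exists>s. q_part j z s \<noteq> 0" by (rule contrapos_np) (simp add: fun_eq_iff)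
        then obtain s where "q_part j z s \<noteq> 0" ..
        then have s: "q_degree L s = j" "z s \<noteq> 0" by (auto simp: q_part_def split: if_splits)
        have "z \<in> kh_supported i" using z by (simp add: cycles_total_def)
        from kh_supportedD(1)[OF this s(2)] show "j \<in> q_degree L ` kh_states L"
          using s(1) by blast
      qed
      then have "finite {j. ?T z j \<noteq> kh_boundaries L i j}"
        by (rule finite_subset) (simp add: finite_kh_states)
      then show "?T z \<in> carrier (Kh_total L i)"
        using cycle[OF z] by (auto simp: Kh_total_def direct_sum_module_def Kh_simps)
    qed
    show "carrier (Kh_total L i) \<subseteq> ?T ` ?Z"
    proof
      fix f assume "f \<in> carrier (Kh_total L i :: ('f, _) module)"
      then have "\<forall>j. \<exists>a. a \<in> kh_cycles L i j \<and> f j = coset i j a"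
        by (auto simp: Kh_total_def direct_sum_module_def Kh_simps)
      then obtain a where a: "\<And>j. a j \<in> kh_cycles L i j" "\<And>j. f j = coset i j (a j)" by metis
      \<comment> \<open>Each state takes its value from the representative in its own quantum
        degree, so the homogeneous parts of \<open>z\<close> are the chosen cycles.\<close>
      define z where "z s = a (q_degree L s) s" for s
      have part: "q_part j z = a j" for j
        using a(1)[of j] unfolding kh_cycles_def mem_Collect_eq carrier_kh_chains
        by (auto simp: q_part_def z_def fun_eq_iff)
      have "z \<in> kh_supported i"
        using a(1) unfolding kh_cycles_def mem_Collect_eq carrier_kh_chains kh_supported_def z_def by blast
      moreover have "kh_differential L z t = 0" for t
      proof -
        have "kh_differential L z t = q_part (q_degree L t) (kh_differential L z) t" by (simp add: q_part_def)
        also have "\<dots> = 0"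
          unfolding q_part_differential part using a(1)[of "q_degree L t"] by (simp add: kh_cycles_def)
        finally show ?thesis .
      qed
      ultimately have "z \<in> ?Z" by (simp add: cycles_total_def fun_eq_iff)
      moreover have "?T z = f" by (simp add: part a(2) fun_eq_iff)
      ultimately show "f \<in> ?T ` ?Z" by blast
    qed
  qed
  show "?T (x + y) = ?T x \<oplus>\<^bsub>Kh_total L i\<^esub> ?T y" for x y :: "'a kh_state \<Rightarrow> 'f"
    by (simp add: Kh_total_def direct_sum_module_def Kh_simps q_part_add coset_add)
  show "?T (scale c x) = c \<odot>\<^bsub>Kh_total L i\<^esub> ?T x" for c and x :: "'a kh_state \<Rightarrow> 'f"
    by (simp add: Kh_total_def direct_sum_module_def Kh_simps q_part_scale coset_scale[symmetric])
  show "?T 0 = \<zero>\<^bsub>Kh_total L i\<^esub>"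
    by (simp add: Kh_total_def direct_sum_module_def Kh_simps q_part_zero
        coset_boundary linear_subspaceD(1)[OF subspace_kh_boundaries])
qed

theorem dim_Kh_total:
  "vectorspace.dim (class_ring :: 'f::field ring) (Kh_total L i :: ('f, int \<Rightarrow> ('a kh_state \<Rightarrow> 'f) set) module)
    \<le> 2 * int_binomial (int (n_crossings L)) (i + int (n_minus L))"
proof -
  interpret linear_image "cycles_total i :: ('a kh_state \<Rightarrow> 'f) set" "Kh_total L i" "\<lambda>z j. coset i j (q_part j z)"
    by (rule Kh_total_linear_image)
  obtain \<phi> :: "nat \<Rightarrow> ('a kh_state \<Rightarrow> 'f) \<Rightarrow> 'f"
    where \<phi>: "\<And>j x y. \<phi> j (x + y) = \<phi> j x + \<phi> j y" "\<And>j c x. \<phi> j (scale c x) = c * \<phi> j x"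
      and bound: "\<And>z. z \<in> kh_supported i \<Longrightarrow> kh_differential L z = 0
      \<Longrightarrow> \<forall>j<2 * int_binomial (int n) (i + int (n_minus L)). \<phi> j z = 0
      \<Longrightarrow> \<exists>w\<in>kh_supported (i - 1). kh_differential L w = z"
    by (rule kh_homology_bound[where 'f = 'f and i = i]) (rule that)
  show ?thesis
  proof (rule dim_le)
    show "linear_form (\<phi> j)" for j using \<phi> by (simp add: linear_form_def)
    fix z assume z: "z \<in> cycles_total i"
      and "\<forall>j<2 * int_binomial (int n) (i + int (n_minus L)). \<phi> j z = 0"
    then obtain w where w: "w \<in> kh_supported (i - 1)" "kh_differential L w = z"
      using bound unfolding cycles_total_def by blast
    \<comment> \<open>The primitive \<open>w\<close> has mixed quantum degree; its part in degree
      \<open>j\<close> bounds the part of \<open>z\<close> in degree \<open>j\<close>.\<close>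
    have "q_part j z \<in> kh_boundaries L i j" for j
      unfolding kh_boundaries_def w(2)[symmetric] q_part_differential
      by (rule imageI) (rule q_part_in_chains[OF w(1)])
    then show "(\<lambda>j. coset i j (q_part j z)) = \<zero>\<^bsub>Kh_total L i\<^esub>"
      by (simp add: Kh_total_def direct_sum_module_def Kh_simps coset_boundary)
  qed
qed

end

theorem proposition1p5:
  fixes L :: "'a link_diagram" and i :: int
  assumes "is_link_diagram L" and "connected_diagram L"
  shows "vectorspace.dim (class_ring :: 'f::field ring)
           (Kh_total L i :: ('f, int \<Rightarrow> ('a kh_state \<Rightarrow> 'f) set) module)
         \<le> 2 * int_binomial (int (n_crossings L)) (i + int (n_minus L))"
  by (rule plane_diagram.dim_Kh_total[OF plane_diagram.intro[OF assms]])

end
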